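(* Let $\alpha\in(0,2\pi]$, let $f:\mathbb{R}^2\to\mathbb{R}$ be a probability density function that is bounded and almost everywhere continuous, and let $(r_n)_{n\ge1}$ be a sequence of positive reals with $r_n\to0$. Let $k\in\mathbb{N}$, $k\ge 1$, and let $T$ be a connected feasible digraph of order $k$. Let $\tilde H_{n,T}$ be the number of isolated $T$-subgraphs of the random sector digraph $G(\mathcal{X}_n,\mathcal{Y}_n,r_n)$. Suppose $nr_n^2\to\lambda\in(0,\infty)$ as $n\to\infty$. Then $$\lim_{n\to\infty}n^{-1}\tilde H_{n,T}=k^{-1}\int_{\mathbb{R}^2}\varphi_T(\lambda f(x))f(x)\,\mathrm{d}x\quad\text{almost surely},$$ where for $k\ge2$ $$\varphi_T(t):=\frac{t^{k-1}}{(k-1)!(2\pi)^k}\int_{[0,2\pi]^k}\int_{(\mathbb{R}^2)^{k-1}}h_T(0,x_2,\dots,x_k,y_1,\dots,y_k)\,e^{-t|S(0,x_2,\dots,x_k,y_1,\dots,y_k)|}\,\mathrm{d}x_2\cdots\mathrm{d}x_k\,\mathrm{d}y_1\cdots\mathrm{d}y_k,$$ and for $k=1$, $\varphi_T(t):=e^{-t\alpha/2}$. Here $S(x_1,\dots,x_k,y_1,\dots,y_k):=\bigcup_{i=1}^kS(x_i,y_i,1)$ and $|\cdot|$ is Lebesgue measure on $\mathbb{R}^2$.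
   Context: Sectors: for $x\in\mathbb{R}^2$, $y\in[0,2\pi]$, $r>0$, $S(x,y,r)$ is the sector of the Euclidean disk of radius $r$ centered at $x$, with central angle $\alpha$ and inclination $y$ measured anticlockwise from the horizontal direction, i.e. $S(x,y,r)=\{x+\rho(\cos\phi,\sin\phi):0\le\rho\le r,\ y\le\phi\le y+\alpha\}$. Sector digraph: for distinct points $x_1,\dots,x_m\in\mathbb{R}^2$ and angles $y_1,\dots,y_m$, the digraph $G(\{x_i\},\{y_i\},r)$ has vertex set $\{x_1,\dots,x_m\}$ and an arc $(x_i,x_j)$, $i\ne j$, if and only if $x_j\in S(x_i,y_i,r)$. Random model: $X_1,X_2,\dots$ are i.i.d. random vectors in $\mathbb{R}^2$ with density $f$; $Y_1,Y_2,\dots$ are i.i.d. uniform on $[0,2\pi)$, independent of the $X_i$; $\mathcal{X}_n=\{X_1,\dots,X_n\}$, $\mathcal{Y}_n=\{Y_1,\dots,Y_n\}$. The random sector digraph is $G(\mathcal{X}_n,\mathcal{Y}_n,r_n)$. Subgraphs: $T$ is a fixed digraph on $k$ vertices, connected in the sense that its underlying undirected graph is connected. $T$ is feasible if $P(G(\mathcal{X}_k,\mathcal{Y}_k,r)\cong T)>0$ for some $r>0$. A subgraph $H$ of a digraph $G$ is isolated if it is an induced subgraph and no arc of $G$ leaves $H$ (no arc goes from a vertex of $H$ to a vertex outside $H$). An isolated $T$-subgraph is an isolated subgraph isomorphic to $T$; the count is over vertex subsets of size $k$. Indicator: $h_T(x_1,\dots,x_k,y_1,\dots,y_k)=1$ if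 $G(\{x_1,\dots,x_k\},\{y_1,\dots,y_k\},1)\cong T$, and $0$ otherwise. *)

theory Defs
  imports "HOL-Probability.Probability" "Graph_Theory.Graph_Theory"
begin

definition sector :: "real \<Rightarrow> real^2 \<Rightarrow> real \<Rightarrow> real \<Rightarrow> (real^2) set" where
  "sector \<alpha> x y r =
     {x + \<rho> *\<^sub>R vector [cos \<phi>, sin \<phi>] | \<rho> \<phi>. 0 \<le> \<rho> \<and> \<rho> \<le> r \<and> y \<le> \<phi> \<and> \<phi> \<le> y + \<alpha>}"

text \<open>
  The points are given as an indexed family, and the vertex \<open>x i\<close> is represented by its
  index \<open>i\<close>. For pairwise distinct points this merely renames the vertices; for the random
  points below (and for almost all arguments of the indicator \<open>h_T\<close>) distinctness holds almost
  surely, the points having a density.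
\<close>

definition sector_digraph ::
  "real \<Rightarrow> 'i set \<Rightarrow> ('i \<Rightarrow> real^2) \<Rightarrow> ('i \<Rightarrow> real) \<Rightarrow> real \<Rightarrow> ('i, 'i \<times> 'i) pre_digraph" where
  "sector_digraph \<alpha> I x y r =
     \<lparr>verts = I,
      arcs = {(i, j). i \<in> I \<and> j \<in> I \<and> i \<noteq> j \<and> x j \<in> sector \<alpha> (x i) (y i) r},
      tail = fst, head = snd\<rparr>"

definition isolated_subgraph :: "('a, 'b) pre_digraph \<Rightarrow> ('a, 'b) pre_digraph \<Rightarrow> bool" where
  "isolated_subgraph H G \<longleftrightarrow>
     induced_subgraph H G \<and> \<not> (\<exists>e\<in>arcs G. tail G e \<in> verts H \<and> head G e \<notin> verts H)"

definition num_isolated :: "('a, 'b) pre_digraph \<Rightarrow> ('c, 'd) pre_digraph \<Rightarrow> nat" where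
  "num_isolated G T =
     card {W. W \<subseteq> verts G \<and> card W = card (verts T) \<and>
              isolated_subgraph (G \<restriction> W) G \<and> digraph_iso (G \<restriction> W) T}"

text \<open>
  The last assumption says that the variables \<open>X 1, X 2, \<dots>, Y 1, Y 2, \<dots>\<close> are (jointly)
  independent. It is the characterization \<open>indep_vars_def2\<close> written out, because
  \<open>indep_vars\<close> itself needs all variables to take values in the same type.
\<close>

locale sector_model = prob_space M
  for M :: "'w measure" +
  fixes f :: "real^2 \<Rightarrow> real"
    and X :: "nat \<Rightarrow> 'w \<Rightarrow> real^2"
    and Y :: "nat \<Rightarrow> 'w \<Rightarrow> real"
  assumes density_nonneg: "\<And>x. 0 \<le> f x"
    and X_density: "\<And>i. i \<ge> 1 \<Longrightarrow> distributed M lborel (X i) (\<lambda>x. ennreal (f x))"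
    and Y_uniform:
      "\<And>i. i \<ge> 1 \<Longrightarrow>
         distributed M lborel (Y i) (\<lambda>y. ennreal (indicator {0..<2*pi} y / (2*pi)))"
    and XY_indep:
      "indep_sets
         (\<lambda>j. case j of
            Inl i \<Rightarrow> {X i -` A \<inter> space M | A. A \<in> sets borel}
          | Inr i \<Rightarrow> {Y i -` A \<inter> space M | A. A \<in> sets borel})
         ({1..} <+> {1..})"

definition random_sector_digraph ::
  "real \<Rightarrow> (nat \<Rightarrow> 'w \<Rightarrow> real^2) \<Rightarrow> (nat \<Rightarrow> 'w \<Rightarrow> real) \<Rightarrow> nat \<Rightarrow> real \<Rightarrow> 'w \<Rightarrow>
     (nat, nat \<times> nat) pre_digraph" where
  "random_sector_digraph \<alpha> X Y n r \<omega> =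
     sector_digraph \<alpha> {1..n} (\<lambda>i. X i \<omega>) (\<lambda>i. Y i \<omega>) r"

definition feasible ::
  "'w measure \<Rightarrow> real \<Rightarrow> (nat \<Rightarrow> 'w \<Rightarrow> real^2) \<Rightarrow> (nat \<Rightarrow> 'w \<Rightarrow> real) \<Rightarrow>
     ('v, 'e) pre_digraph \<Rightarrow> bool" where
  "feasible M \<alpha> X Y T \<longleftrightarrow>
     (\<exists>r>0. measure M {\<omega> \<in> space M.
        digraph_iso (random_sector_digraph \<alpha> X Y (card (verts T)) r \<omega>) T} > 0)"

definition h_T :: "real \<Rightarrow> ('v, 'e) pre_digraph \<Rightarrow> (nat \<Rightarrow> real^2) \<Rightarrow> (nat \<Rightarrow> real) \<Rightarrow> real" where
  "h_T \<alpha> T x y = (if digraph_iso (sector_digraph \<alpha> {1..card (verts T)} x y 1) T then 1 else 0)"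

definition phi :: "real \<Rightarrow> ('v, 'e) pre_digraph \<Rightarrow> real \<Rightarrow> real" where
  "phi \<alpha> T t =
     (let k = card (verts T) in
      if k = 1 then exp (- t * \<alpha> / 2)
      else t ^ (k - 1) / (fact (k - 1) * (2 * pi) ^ k) *
        (LINT y : Pi\<^sub>E {1..k} (\<lambda>_. {0..2*pi}) | Pi\<^sub>M {1..k} (\<lambda>_. lborel).
         LINT x | Pi\<^sub>M {2..k} (\<lambda>_. lborel).
           h_T \<alpha> T (x(1 := 0)) y *
           exp (- t * measure lborel (\<Union>i\<in>{1..k}. sector \<alpha> ((x(1 := 0)) i) (y i) 1))))"

end

theory Submission
  imports Defs "HOL-Real_Asymp.Real_Asymp"
begin

text \<open>
  Overlapping isolated copies of \<open>T\<close> prevent the count \<open>H\<close> from having bounded differences: one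
  point may be the sink of arbitrarily many copies. We therefore only count copies all of whose
  vertices lie in cells of the grid of mesh \<open>r\<close> that contain at most \<open>K\<close> points. Since \<open>T\<close> is
  connected, a copy has diameter at most \<open>D * r\<close>, and moving one point affects at most
  \<open>(2 * (2 * D + 3)\<^sup>2 * K) ^ k\<close> of these copies, so McDiarmid's inequality applies. A Chernoff bound on the
  occupation numbers shows that for \<open>K\<close> of order \<open>log n\<close> no cell contains more than \<open>K\<close> points, with
  a probability that suffices for the Borel-Cantelli lemma.

  For the mean, all \<open>k\<close>-subsets contribute equally. Conditioning on the vertices of the copy turns
  isolation into the factor \<open>(1 - p) ^ (n - k)\<close>, where \<open>p\<close> is the mass that \<open>f\<close> gives to the union of
  the \<open>k\<close> sectors. The substitution \<open>x\<^sub>i = x\<^sub>1 + r * z\<^sub>i\<close> and dominated convergence give the limit at the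
  continuity points of \<open>f\<close>.
\<close>

section \<open>Sectors\<close>

text \<open>The truncation error is estimated crudely: a count never exceeds \<open>n ^ k\<close>,
  so it suffices to make crowded cells so rare that their probability times \<open>n ^ k\<close> is
  summable. This is what the factor \<open>k + 3\<close> in the truncation level buys. The price is
  a difference bound that is a power of \<open>ln n\<close>; the exponent in McDiarmid's inequality,
  of order \<open>n / (ln n) ^ (2 * k)\<close>, still outgrows every multiple of
  \<open>ln n\<close>. The deviation bounds hold for each \<open>n\<close> separately, so graphs of
  different sizes are never compared. This matters because the count is not monotone: a new point
  can create copies and destroy the isolation of others. Connectedness enters twice through one
  diameter bound: it localises the effect of moving a point, and it confines the offsets
  \<open>z\<^sub>i\<close> to a fixed ball, on which the bound of \<open>f\<close> yields an
  integrable majorant. The exponential in \<open>phi\<close> arises because, at a continuity point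
  \<open>u\<close> of \<open>f\<close>, the product \<open>n * p\<close> tends to
  \<open>\<Lambda> * f u\<close> times the area of the union of the unit sectors.\<close>

lemma sectorI:
  assumes "w = x + \<rho> *\<^sub>R vector [cos \<phi>, sin \<phi>]" "0 \<le> \<rho>" "\<rho> \<le> r" "y \<le> \<phi>" "\<phi> \<le> y + \<alpha>"
  shows "w \<in> sector \<alpha> x y r"
  using assms by (auto simp: sector_def)

text \<open>Translation and scaling reduce all sectors to unit sectors at the origin; measurability,
  area and the substitution in the mean all rest on this.\<close>

lemma sector_iff:
  assumes "r > 0"
  shows "w \<in> sector \<alpha> x y r \<longleftrightarrow> (1 / r) *\<^sub>R (w - x) \<in> sector \<alpha> 0 y 1"
proof
  assume "w \<in> sector \<alpha> x y r"
  then obtain \<rho> \<phi> where "w = x + \<rho> *\<^sub>R vector [cos \<phi>, sin \<phi>]" "0 \<le> \<rho>" "\<rho> \<le> r" "y \<le> \<phi>" "\<phi> \<le> y + \<alpha>"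
    by (auto simp: sector_def)
  then show "(1 / r) *\<^sub>R (w - x) \<in> sector \<alpha> 0 y 1"
    using assms by (auto intro!: sectorI[of _ _ "\<rho> / r" \<phi>])
next
  assume "(1 / r) *\<^sub>R (w - x) \<in> sector \<alpha> 0 y 1"
  then obtain \<rho> \<phi> where *: "(1 / r) *\<^sub>R (w - x) = \<rho> *\<^sub>R vector [cos \<phi>, sin \<phi>]" "0 \<le> \<rho>" "\<rho> \<le> 1" "y \<le> \<phi>" "\<phi> \<le> y + \<alpha>"
    by (auto simp: sector_def)
  have "w - x = r *\<^sub>R ((1 / r) *\<^sub>R (w - x))"
    using assms by simp
  also have "\<dots> = (r * \<rho>) *\<^sub>R vector [cos \<phi>, sin \<phi>]"
    by (simp only: * scaleR_scaleR)
  finally have "w = x + (r * \<rho>) *\<^sub>R vector [cos \<phi>, sin \<phi>]"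
    by (simp add: algebra_simps)
  moreover have "r * \<rho> \<le> r" using *(3) assms by (simp add: mult_left_le)
  ultimately show "w \<in> sector \<alpha> x y r"
    using * assms by (auto intro!: sectorI[of _ _ "r * \<rho>" \<phi>])
qed

lemma norm_unit_vector [simp]: "norm (vector [cos \<phi>, sin \<phi>] :: real^2) = 1"
  by (simp add: norm_vec_def L2_set_def sum_2)

lemma sector_dist:
  assumes "w \<in> sector \<alpha> x y r"
  shows "dist x w \<le> r"
  using assms by (auto simp: sector_def dist_norm)

lemma sector_subset_cball: "sector \<alpha> x y r \<subseteq> cball x r"
  using sector_dist by auto

section \<open>Compactness and joint measurability of sectors\<close>

lemma continuous_on_unit_vector [continuous_intros]:
  fixes g :: "'a::t2_space \<Rightarrow> real"
  assumes "continuous_on S g"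
  shows "continuous_on S (\<lambda>x. vector [cos (g x), sin (g x)] :: real^2)"
proof -
  have "(\<lambda>x. vector [cos (g x), sin (g x)] :: real^2) = (\<lambda>x. \<chi> i. if i = 1 then cos (g x) else sin (g x))"
    by (auto simp: vec_eq_iff forall_2)
  moreover have "continuous_on S \<dots>"
  proof (rule continuous_on_vec_lambda)
    show "continuous_on S (\<lambda>x. if i = 1 then cos (g x) else sin (g x))" for i :: 2
      using assms by (cases "i = 1") (auto intro: continuous_on_cos continuous_on_sin)
  qed
  ultimately show ?thesis by (simp only:)
qed

lemma compact_sector: "compact (sector \<alpha> x y r)"
proof -
  have "sector \<alpha> x y r = (\<lambda>(\<rho>, \<phi>). x + \<rho> *\<^sub>R vector [cos \<phi>, sin \<phi>]) ` ({0..r} \<times> {y..y+\<alpha>})"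
  proof (intro equalityI subsetI)
    fix w assume "w \<in> sector \<alpha> x y r"
    then obtain \<rho> \<phi> where "w = x + \<rho> *\<^sub>R vector [cos \<phi>, sin \<phi>]" "0 \<le> \<rho>" "\<rho> \<le> r" "y \<le> \<phi>" "\<phi> \<le> y + \<alpha>"
      by (auto simp: sector_def)
    then show "w \<in> (\<lambda>(\<rho>, \<phi>). x + \<rho> *\<^sub>R vector [cos \<phi>, sin \<phi>]) ` ({0..r} \<times> {y..y+\<alpha>})"
      by (intro image_eqI[of _ _ "(\<rho>, \<phi>)"]) simp_all
  next
    fix w assume "w \<in> (\<lambda>(\<rho>, \<phi>). x + \<rho> *\<^sub>R vector [cos \<phi>, sin \<phi>]) ` ({0..r} \<times> {y..y+\<alpha>})"
    then obtain \<rho> \<phi> where "w = x + \<rho> *\<^sub>R vector [cos \<phi>, sin \<phi>]" "0 \<le> \<rho>" "\<rho> \<le> r" "y \<le> \<phi>" "\<phi> \<le> y + \<alpha>"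
      by auto
    then show "w \<in> sector \<alpha> x y r" by (rule sectorI)
  qed
  moreover have "continuous_on ({0..r} \<times> {y..y+\<alpha>}) (\<lambda>(\<rho>, \<phi>). x + \<rho> *\<^sub>R vector [cos \<phi>, sin \<phi>] :: real^2)"
    by (auto simp: case_prod_unfold intro!: continuous_intros)
  ultimately show ?thesis
    by (simp add: compact_continuous_image compact_Times)
qed

lemma sector_measurable [measurable]: "sector \<alpha> x y r \<in> sets borel"
  by (intro borel_closed compact_imp_closed compact_sector)

text \<open>Measurability is needed jointly in the inclination and the point. Measuring angles
  relative to \<open>y\<close> makes the parameter set \<open>{0..1} \<times> {0..\<alpha>}\<close>
  independent of \<open>y\<close>. Its compactness gives a convergent subsequence of parameters
  along any convergent sequence in the graph, and continuity identifies the limit.\<close>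

lemma closed_sector_graph: "closed {(y, w). w \<in> sector \<alpha> 0 y 1}"
proof -
  have eq: "{(y, w). w \<in> sector \<alpha> 0 y 1} =
    (\<lambda>p. (fst p, (fst (snd p)) *\<^sub>R vector [cos (fst p + snd (snd p)), sin (fst p + snd (snd p))]))
      ` (UNIV \<times> ({0..1} \<times> {0..\<alpha>}))" (is "?L = ?g ` ?S")
  proof (intro equalityI subrelI)
    fix y w assume "(y, w) \<in> ?L"
    then obtain \<rho> \<phi> where *: "w = \<rho> *\<^sub>R vector [cos \<phi>, sin \<phi>]" "0 \<le> \<rho>" "\<rho> \<le> 1" "y \<le> \<phi>" "\<phi> \<le> y + \<alpha>"
      by (auto simp: sector_def)
    then show "(y, w) \<in> ?g ` ?S"
      by (intro image_eqI[of _ _ "(y, (\<rho>, \<phi> - y))"]) auto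
  next
    fix y w assume "(y, w) \<in> ?g ` ?S"
    then obtain \<rho> t where *: "w = \<rho> *\<^sub>R vector [cos (y + t), sin (y + t)]" "0 \<le> \<rho>" "\<rho> \<le> 1" "0 \<le> t" "t \<le> \<alpha>"
      by auto
    have "w \<in> sector \<alpha> 0 y 1"
      by (rule sectorI[of _ _ \<rho> "y + t"]) (use * in auto)
    then show "(y, w) \<in> ?L" by simp
  qed
  show ?thesis
  proof (unfold closed_sequential_limits, intro allI impI, elim conjE)
    fix s l assume s: "\<forall>n. s n \<in> ?L" "s \<longlonglongrightarrow> l"
    have "\<forall>n. \<exists>p. p \<in> {0..1} \<times> {0..\<alpha>} \<and> s n = ?g (fst (s n), p)"
    proof
      fix n
      from s(1) have "s n \<in> ?g ` ?S" unfolding eq by blast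
      then obtain a where "a \<in> ?S" "s n = ?g a" by blast
      then show "\<exists>p. p \<in> {0..1} \<times> {0..\<alpha>} \<and> s n = ?g (fst (s n), p)"
        by (intro exI[of _ "snd a"]) auto
    qed
    then obtain p where p: "\<And>n. p n \<in> {0..1} \<times> {0..\<alpha>}" "\<And>n. s n = ?g (fst (s n), p n)"
      using choice[of "\<lambda>n p. p \<in> {0..1} \<times> {0..\<alpha>} \<and> s n = ?g (fst (s n), p)"] by blast
    have "compact ({0..1::real} \<times> {0..\<alpha>})" by (intro compact_Times compact_Icc)
    then obtain q \<sigma> where q: "q \<in> {0..1} \<times> {0..\<alpha>}" "strict_mono \<sigma>" "(p \<circ> \<sigma>) \<longlonglongrightarrow> q"
      using p(1) unfolding compact_def by blast
    have "continuous_on UNIV ?g" by (intro continuous_intros)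
    moreover have "(\<lambda>n. (fst (s (\<sigma> n)), p (\<sigma> n))) \<longlonglongrightarrow> (fst l, q)"
      using q s LIMSEQ_subseq_LIMSEQ[OF s(2) q(2)] by (intro tendsto_intros) (auto simp: o_def)
    ultimately have "(\<lambda>n. ?g (fst (s (\<sigma> n)), p (\<sigma> n))) \<longlonglongrightarrow> ?g (fst l, q)"
      by (intro continuous_on_tendsto_compose[where f="?g" and s=UNIV]) auto
    then have "(\<lambda>n. s (\<sigma> n)) \<longlonglongrightarrow> ?g (fst l, q)"
      using p(2) by simp
    moreover have "(\<lambda>n. s (\<sigma> n)) \<longlonglongrightarrow> l"
      using LIMSEQ_subseq_LIMSEQ[OF s(2) q(2)] by (simp add: o_def)
    ultimately have "l = ?g (fst l, q)" by (intro LIMSEQ_unique)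
    moreover have "(fst l, q) \<in> ?S" using q(1) by simp
    ultimately show "l \<in> ?L" unfolding eq by (rule image_eqI)
  qed
qed

lemma pred_sector [measurable (raw)]:
  assumes "r > 0"
  assumes [measurable]: "x \<in> borel_measurable M" "y \<in> borel_measurable M" "w \<in> borel_measurable M"
  shows "Measurable.pred M (\<lambda>z. w z \<in> sector \<alpha> (x z) (y z) r)"
proof -
  have "{(y, w). w \<in> sector \<alpha> 0 y 1} \<in> sets (borel \<Otimes>\<^sub>M borel)"
    using closed_sector_graph unfolding borel_prod by (rule borel_closed)
  then have "Measurable.pred M (\<lambda>z. (y z, (1 / r) *\<^sub>R (w z - x z)) \<in> {(y, w). w \<in> sector \<alpha> 0 y 1})"
    by measurable
  then show ?thesis
    by (simp add: sector_iff[OF assms(1)])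
qed

section \<open>Area of a sector\<close>

definition rotation2 :: "real \<Rightarrow> real^2 \<Rightarrow> real^2" where
  "rotation2 t v = vector [cos t * v$1 - sin t * v$2, sin t * v$1 + cos t * v$2]"

lemma rotation2_unit:
  "rotation2 t (\<rho> *\<^sub>R vector [cos \<phi>, sin \<phi>]) = \<rho> *\<^sub>R vector [cos (t + \<phi>), sin (t + \<phi>)]"
  by (simp add: rotation2_def vec_eq_iff forall_2 cos_add sin_add algebra_simps)

lemma orthogonal_rotation2: "orthogonal_transformation (rotation2 t)"
proof -
  have "(cos t * a - sin t * b)\<^sup>2 + (sin t * a + cos t * b)\<^sup>2 = a\<^sup>2 + b\<^sup>2" for a b
  proof -
    have "(cos t * a - sin t * b)\<^sup>2 + (sin t * a + cos t * b)\<^sup>2 = ((sin t)\<^sup>2 + (cos t)\<^sup>2) * (a\<^sup>2 + b\<^sup>2)"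
      by algebra
    then show ?thesis by simp
  qed
  moreover have "linear (rotation2 t)"
    by (rule linearI) (simp_all add: rotation2_def vec_eq_iff forall_2 algebra_simps)
  ultimately show ?thesis
    unfolding orthogonal_transformation
    by (simp add: rotation2_def norm_vec_def L2_set_def sum_2)
qed

lemma sector_rotation: "sector \<alpha> 0 y 1 = rotation2 y ` sector \<alpha> 0 0 1"
proof safe
  fix w assume "w \<in> sector \<alpha> 0 y 1"
  then obtain \<rho> \<phi> where *: "w = \<rho> *\<^sub>R vector [cos \<phi>, sin \<phi>]" "0 \<le> \<rho>" "\<rho> \<le> 1" "y \<le> \<phi>" "\<phi> \<le> y + \<alpha>"
    by (auto simp: sector_def)
  then have "w = rotation2 y (\<rho> *\<^sub>R vector [cos (\<phi> - y), sin (\<phi> - y)])"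
    by (simp add: rotation2_unit)
  moreover have "\<rho> *\<^sub>R vector [cos (\<phi> - y), sin (\<phi> - y)] \<in> sector \<alpha> 0 0 1"
    by (rule sectorI[of _ _ \<rho> "\<phi> - y"]) (use * in auto)
  ultimately show "w \<in> rotation2 y ` sector \<alpha> 0 0 1"
    by blast
next
  fix w assume "w \<in> sector \<alpha> 0 0 1"
  then obtain \<rho> \<phi> where "w = \<rho> *\<^sub>R vector [cos \<phi>, sin \<phi>]" "0 \<le> \<rho>" "\<rho> \<le> 1" "0 \<le> \<phi>" "\<phi> \<le> \<alpha>"
    by (auto simp: sector_def)
  then show "rotation2 y w \<in> sector \<alpha> 0 y 1"
    by (auto simp: rotation2_unit intro!: sectorI[of _ _ \<rho> "y + \<phi>"])
qed

lemma measure_sector_rotate: "measure lborel (sector \<alpha> 0 y 1) = measure lborel (sector \<alpha> 0 0 1)"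
proof -
  have "sector \<alpha> 0 0 1 \<in> lmeasurable"
    using compact_sector by (rule lmeasurable_compact)
  then have "measure lebesgue (rotation2 y ` sector \<alpha> 0 0 1) = measure lebesgue (sector \<alpha> 0 0 1)"
    by (rule measure_orthogonal_image[OF orthogonal_rotation2])
  then show ?thesis
    by (simp add: sector_rotation[symmetric] measure_completion)
qed

text \<open>The line through the origin in direction \<open>(cos t, sin t)\<close>, as the
  orthogonal complement of \<open>(sin t, - cos t)\<close>. Such lines carry the boundary rays in
  which adjacent sectors overlap.\<close>

lemma null_set_line: "{w :: real^2. w$1 * sin t = w$2 * cos t} \<in> null_sets lborel"
proof -
  define v :: "real^2" where "v = vector [sin t, - cos t]"
  have eq: "{w :: real^2. w$1 * sin t = w$2 * cos t} = {w. v \<bullet> w = 0}"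
    by (simp add: v_def inner_vec_def sum_2 algebra_simps)
  have "norm v = 1"
    by (simp add: v_def norm_vec_def L2_set_def sum_2)
  then have "v \<noteq> 0" by auto
  then have "{w. v \<bullet> w = 0} \<in> null_sets lebesgue"
    unfolding negligible_iff_null_sets[symmetric] by (intro negligible_hyperplane disjI1)
  moreover have "{w. v \<bullet> w = 0} \<in> sets lborel"
    unfolding sets_lborel by (intro borel_closed closed_hyperplane)
  ultimately show ?thesis
    unfolding eq by (simp only: null_sets_completion_iff)
qed

lemma sector_Un:
  assumes "0 \<le> a" "0 \<le> b"
  shows "sector (a + b) 0 0 1 = sector a 0 0 1 \<union> sector b 0 a 1"
proof (intro equalityI subsetI)
  fix w assume "w \<in> sector (a + b) 0 0 1"
  then obtain \<rho> \<phi> where *: "w = 0 + \<rho> *\<^sub>R vector [cos \<phi>, sin \<phi>]" "0 \<le> \<rho>" "\<rho> \<le> 1" "0 \<le> \<phi>" "\<phi> \<le> a + b"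
    by (auto simp: sector_def)
  show "w \<in> sector a 0 0 1 \<union> sector b 0 a 1"
  proof (cases "\<phi> \<le> a")
    case True
    then have "w \<in> sector a 0 0 1" by (intro sectorI[OF *(1)]) (use * in auto)
    then show ?thesis ..
  next
    case False
    then have "w \<in> sector b 0 a 1" by (intro sectorI[OF *(1)]) (use * in auto)
    then show ?thesis ..
  qed
next
  fix w assume "w \<in> sector a 0 0 1 \<union> sector b 0 a 1"
  then obtain \<rho> \<phi> where *: "w = 0 + \<rho> *\<^sub>R vector [cos \<phi>, sin \<phi>]" "0 \<le> \<rho>" "\<rho> \<le> 1" "0 \<le> \<phi>" "\<phi> \<le> a + b"
    using assms unfolding sector_def by fastforce
  then show "w \<in> sector (a + b) 0 0 1" by (intro sectorI[OF *(1)]) auto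
qed

text \<open>The two polar angles of a nonzero common point differ by a multiple of
  \<open>2 * pi\<close>, and the difference lies in \<open>[0, 2 * pi]\<close> because
  \<open>a + b \<le> 2 * pi\<close>. If they agree, both equal \<open>a\<close>; if they differ by a
  full turn, the first is \<open>0\<close>.\<close>

lemma sector_Int_subset:
  assumes "0 \<le> a" "0 \<le> b" "a + b \<le> 2 * pi"
  shows "sector a 0 0 1 \<inter> sector b 0 a 1 \<subseteq>
    {w. w$1 * sin 0 = w$2 * cos 0} \<union> {w. w$1 * sin a = w$2 * cos a}"
proof
  fix w assume w: "w \<in> sector a 0 0 1 \<inter> sector b 0 a 1"
  then obtain \<rho> \<phi> where 1: "w = \<rho> *\<^sub>R vector [cos \<phi>, sin \<phi>]" "0 \<le> \<rho>" "0 \<le> \<phi>" "\<phi> \<le> a"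
    by (auto simp: sector_def)
  obtain \<rho>' \<phi>' where 2: "w = \<rho>' *\<^sub>R vector [cos \<phi>', sin \<phi>']" "0 \<le> \<rho>'" "a \<le> \<phi>'" "\<phi>' \<le> a + b"
    using w by (auto simp: sector_def)
  have "norm w = \<rho>" "norm w = \<rho>'"
    using 1(2) 2(2) by (subst 1(1), simp, subst 2(1), simp)
  then have [simp]: "\<rho>' = \<rho>" by simp
  show "w \<in> {w. w$1 * sin 0 = w$2 * cos 0} \<union> {w. w$1 * sin a = w$2 * cos a}"
  proof (cases "\<rho> = 0")
    case False
    have "w$1 = \<rho> * cos \<phi>" "w$2 = \<rho> * sin \<phi>" by (subst 1(1), simp)+
    moreover have "w$1 = \<rho> * cos \<phi>'" "w$2 = \<rho> * sin \<phi>'" by (subst 2(1), simp)+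
    ultimately have "sin \<phi>' = sin \<phi> \<and> cos \<phi>' = cos \<phi>" using False by simp
    then obtain n :: int where n: "\<phi>' = \<phi> + 2 * pi * of_int n"
      unfolding sin_cos_eq_iff by auto
    have "\<phi>' - \<phi> \<ge> 0" "\<phi>' - \<phi> \<le> 2 * pi" using 1 2 assms by auto
    then have "0 \<le> real_of_int n" "real_of_int n \<le> 1"
      using n pi_gt_zero by (auto simp: zero_le_mult_iff not_le)
    then have "n = 0 \<or> n = 1" by linarith
    then have "\<phi> = a \<or> \<phi> = 0" using n 1 2 assms by auto
    then show ?thesis using 1(1) by auto
  qed (use 1 in simp)
qed

lemma measure_sector_add:
  assumes "0 \<le> a" "0 \<le> b" "a + b \<le> 2 * pi"
  shows "measure lborel (sector (a + b) 0 0 1) = measure lborel (sector a 0 0 1) + measure lborel (sector b 0 0 1)"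
proof -
  let ?S = "sector a 0 0 1" and ?T = "sector b 0 a 1"
  have "?S \<inter> ?T \<in> null_sets lborel"
  proof (rule null_sets_subset[OF _ _ sector_Int_subset[OF assms]])
    show "{w :: real^2. w$1 * sin 0 = w$2 * cos 0} \<union> {w. w$1 * sin a = w$2 * cos a} \<in> null_sets lborel"
      using null_set_line[of 0] null_set_line[of a] by auto
  qed simp
  then have "measure lborel (?T - ?S \<inter> ?T) = measure lborel ?T"
    by (intro measure_Diff_null_set) auto
  moreover have "?T - ?S \<inter> ?T = ?T - ?S" by blast
  moreover have "measure lborel (?S \<union> (?T - ?S)) = measure lborel ?S + measure lborel (?T - ?S)"
  proof (rule measure_Union)
    have "emeasure lborel ?S < \<infinity>" "emeasure lborel ?T < \<infinity>"
      by (intro emeasure_compact_finite compact_sector)+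
    moreover have "emeasure lborel (?T - ?S) \<le> emeasure lborel ?T"
      by (intro emeasure_mono) auto
    ultimately show "emeasure lborel ?S \<noteq> \<infinity>" "emeasure lborel (?T - ?S) \<noteq> \<infinity>"
      by (auto simp: less_top[symmetric] top_unique)
  qed auto
  moreover have "?S \<union> (?T - ?S) = sector (a + b) 0 0 1"
    using sector_Un[OF assms(1,2)] by blast
  ultimately show ?thesis
    using measure_sector_rotate[of b a] by simp
qed

lemma sector_full: "sector (2 * pi) 0 0 1 = cball 0 1"
proof (intro equalityI subsetI)
  fix w :: "real^2" assume "w \<in> cball 0 1"
  then have le: "norm w \<le> 1" by simp
  show "w \<in> sector (2 * pi) 0 0 1"
  proof (cases "w = 0")
    case True
    then show ?thesis by (intro sectorI[of _ _ 0 0]) auto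
  next
    case False
    have n: "(norm w)\<^sup>2 = (w$1)\<^sup>2 + (w$2)\<^sup>2" by (simp add: norm_vec_def L2_set_def sum_2)
    have "(w$1 / norm w)\<^sup>2 + (w$2 / norm w)\<^sup>2 = 1"
      using False by (simp add: power_divide add_divide_distrib[symmetric] n[symmetric])
    from sincos_total_2pi[OF this] obtain t where
      t: "0 \<le> t" "t < 2 * pi" "w$1 / norm w = cos t" "w$2 / norm w = sin t" by blast
    have "w = 0 + norm w *\<^sub>R vector [cos t, sin t]"
      using False by (simp add: vec_eq_iff forall_2 t(3,4)[symmetric])
    then show ?thesis by (rule sectorI) (use t le in auto)
  qed
qed (rule subsetD[OF sector_subset_cball])

lemma measure_sector_mono:
  assumes "a \<le> b"
  shows "measure lborel (sector a 0 0 1) \<le> measure lborel (sector b 0 0 1)"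
proof (rule measure_mono_fmeasurable)
  show "sector b 0 0 1 \<in> fmeasurable lborel" by (intro fmeasurable_compact compact_sector)
  show "sector a 0 0 1 \<subseteq> sector b 0 0 1"
    using assms by (auto simp: sector_def intro: order_trans)
qed simp

text \<open>The area is additive and monotone in the angle, hence linear.\<close>

lemma measure_sector:
  assumes "0 < \<alpha>" "\<alpha> \<le> 2 * pi"
  shows "measure lborel (sector \<alpha> 0 y 1) = \<alpha> / 2"
proof -
  define A where "A a = measure lborel (sector a 0 0 1)" for a
  have mult: "A (real j * a) = real j * A a" if "0 \<le> a" "real j * a \<le> 2 * pi" "j \<ge> 1" for j a
    using that(3,2)
  proof (induction j rule: dec_induct)
    case (step j)
    have "A (real j * a + a) = A (real j * a) + A a"
      unfolding A_def using that(1) step by (intro measure_sector_add) (auto simp: algebra_simps)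
    then show ?case using step that(1) by (simp add: algebra_simps)
  qed simp
  have full: "A (2 * pi) = pi"
    by (simp add: A_def sector_full content_cball unit_ball_vol_2)
  have unit: "A (2 * pi / real m) = pi / real m" if "m \<ge> 1" for m
    using mult[of "2 * pi / real m" m] full that by (simp add: field_simps)
  have grid: "A (real j * (2 * pi / real m)) = real j * (pi / real m)" if "m \<ge> 1" "j \<le> m" "j \<ge> 1" for j m
  proof -
    have "real j * (2 * pi / real m) \<le> 2 * pi"
      using that by (simp add: divide_le_eq)
    then show ?thesis using that unit[of m] mult[of "2 * pi / real m" j] by simp
  qed
  have nonneg: "A a \<ge> 0" for a by (simp add: A_def)
  have "A \<alpha> = \<alpha> / 2"
  proof (cases "\<alpha> = 2 * pi")
    case False
    define t where "t = \<alpha> / (2 * pi)"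
    have t: "0 < t" "t < 1" "\<alpha> = t * (2 * pi)" using assms False by (auto simp: t_def field_simps)
    have close: "\<bar>A \<alpha> - \<alpha> / 2\<bar> \<le> pi / real m" if m: "m \<ge> 1" for m
    proof -
      \<comment> \<open>The angle lies between the multiples \<open>j\<close> and
        \<open>j + 1\<close> of \<open>2 * pi / m\<close>, so linearity on this grid determines the
        area up to \<open>pi / m\<close>. Since \<open>t < 1\<close>, the upper multiple stays
        within a full turn; this is why the angle \<open>2 * pi\<close> is treated apart.\<close>
      define j where "j = nat \<lfloor>real m * t\<rfloor>"
      have mt: "0 \<le> real m * t" "real m * t < real m" using t m by auto
      then have j: "real j \<le> real m * t" "real m * t < real j + 1"
        by (auto simp: j_def)
      then have jm: "j + 1 \<le> m" using mt by linarith
      have jpi: "real m * t * pi \<le> (real j + 1) * pi" "real j * pi \<le> real m * t * pi"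
        using j by (auto intro!: mult_right_mono)
      have "A \<alpha> \<le> A (real (j + 1) * (2 * pi / real m))"
        unfolding A_def by (rule measure_sector_mono) (use jpi m in \<open>auto simp: t(3) field_simps\<close>)
      also have "\<dots> = real (j + 1) * (pi / real m)" using jm m by (intro grid) auto
      also have "\<dots> \<le> t * pi + pi / real m" using j m by (simp add: field_simps)
      finally have up: "A \<alpha> \<le> t * pi + pi / real m" .
      have "real j * (pi / real m) \<le> A \<alpha>"
      proof (cases "j = 0")
        case False
        then have "real j * (pi / real m) = A (real j * (2 * pi / real m))"
          using jm m by (intro grid[symmetric]) auto
        also have "\<dots> \<le> A \<alpha>"
          unfolding A_def by (rule measure_sector_mono) (use jpi m in \<open>auto simp: t(3) field_simps\<close>)
        finally show ?thesis .
      qed (simp add: nonneg)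
      moreover have "t * pi - pi / real m \<le> real j * (pi / real m)"
      proof -
        have "real m * t * pi / real m \<le> (real j + 1) * pi / real m"
          by (intro divide_right_mono jpi) simp
        then show ?thesis using m by (simp add: add_divide_distrib distrib_right)
      qed
      ultimately show ?thesis using up t(3) by (auto simp: abs_le_iff)
    qed
    have "(\<lambda>m. pi / real m) \<longlonglongrightarrow> 0" by real_asymp
    then have "\<bar>A \<alpha> - \<alpha> / 2\<bar> \<le> 0"
      by (rule LIMSEQ_le_const) (use close in blast)
    then show ?thesis by simp
  qed (simp add: full)
  then show ?thesis using measure_sector_rotate[of \<alpha> y] by (simp add: A_def)
qed

section \<open>McDiarmid's inequality\<close>

lemma abs_integral_le:
  fixes f g :: "'a \<Rightarrow> real"
  assumes "integrable M f" "integrable M g" "\<And>x. x \<in> space M \<Longrightarrow> \<bar>f x\<bar> \<le> g x"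
  shows "\<bar>\<integral>x. f x \<partial>M\<bar> \<le> (\<integral>x. g x \<partial>M)"
  using assms by (intro order_trans[OF integral_abs_bound integral_mono]) auto

text \<open>Induction on the coordinates: averaging over coordinate \<open>i\<close> leaves a
  function \<open>G\<close> of the others with the same difference bound, and for fixed other
  coordinates \<open>F - G\<close> is centred with values in \<open>{-c..c}\<close>. Hoeffding's
  lemma then contributes one factor \<open>exp (s\<^sup>2 * c\<^sup>2 / 2)\<close>. Using the
  interval of length \<open>2 * c\<close> rather than \<open>c\<close> costs only a constant in the
  exponent. The bound \<open>b\<close> makes \<open>F\<close> integrable.\<close>

lemma mcdiarmid_mgf:
  fixes N :: "'a measure" and F :: "('i \<Rightarrow> 'a) \<Rightarrow> real"
  assumes "prob_space N" "finite I" "s > 0" "c \<ge> 0"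
    and "F \<in> borel_measurable (PiM I (\<lambda>_. N))"
    and "\<And>x i a. x \<in> space (PiM I (\<lambda>_. N)) \<Longrightarrow> i \<in> I \<Longrightarrow> a \<in> space N \<Longrightarrow> \<bar>F (x(i := a)) - F x\<bar> \<le> c"
    and "\<And>x. x \<in> space (PiM I (\<lambda>_. N)) \<Longrightarrow> \<bar>F x\<bar> \<le> b"
  shows "(\<integral>\<^sup>+x. exp (s * (F x - (\<integral>x. F x \<partial>PiM I (\<lambda>_. N)))) \<partial>PiM I (\<lambda>_. N))
           \<le> ennreal (exp (real (card I) * (s\<^sup>2 * c\<^sup>2 / 2)))"
  using assms(2,5,6,7)
proof (induction I arbitrary: F rule: finite_induct)
  case empty
  interpret N: prob_space N by fact
  have "space (PiM {} (\<lambda>_. N)) = {\<lambda>_. undefined}" by (simp add: space_PiM)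
  have "(\<integral>x. F x \<partial>PiM {} (\<lambda>_. N)) = F (\<lambda>_. undefined)"
    by (simp add: PiM_empty lebesgue_integral_count_space_finite)
  then show ?case
    by (simp add: PiM_empty nn_integral_count_space_finite)
next
  case (insert i I)
  interpret N: prob_space N by fact
  interpret P: product_prob_space "\<lambda>_. N" I ..
  interpret P': product_prob_space "\<lambda>_. N" "insert i I" ..
  interpret P: prob_space "PiM I (\<lambda>_. N)" by (rule prob_space_PiM) (rule assms(1))
  interpret P': prob_space "PiM (insert i I) (\<lambda>_. N)" by (rule prob_space_PiM) (rule assms(1))
  note [measurable] = insert.prems(1)
  have int_F: "integrable (PiM (insert i I) (\<lambda>_. N)) F"
    using insert.prems(3) by (intro P'.integrable_const_bound[of _ b]) auto
  have sp: "x(i := a) \<in> space (PiM (insert i I) (\<lambda>_. N))"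
    if "x \<in> space (PiM I (\<lambda>_. N))" "a \<in> space N" for x a
    using that by (auto simp: space_PiM PiE_def extensional_def)
  have meas_p [measurable]: "(\<lambda>p. F ((fst p)(i := snd p))) \<in> borel_measurable (PiM I (\<lambda>_. N) \<Otimes>\<^sub>M N)"
    by measurable
  have meas_a: "(\<lambda>a. F (x(i := a))) \<in> borel_measurable N" if "x \<in> space (PiM I (\<lambda>_. N))" for x
    using measurable_compose[OF measurable_Pair1' [OF that] meas_p] by simp
  have int_a: "integrable N (\<lambda>a. F (x(i := a)))" if "x \<in> space (PiM I (\<lambda>_. N))" for x
  proof (rule N.integrable_const_bound[of _ b])
    show "AE a in N. norm (F (x(i := a))) \<le> b"
      unfolding real_norm_def using that by (intro AE_I2 insert.prems(3) sp)
  qed (rule meas_a[OF that])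
  define G where "G x = (\<integral>a. F (x(i := a)) \<partial>N)" for x
  have [measurable]: "G \<in> borel_measurable (PiM I (\<lambda>_. N))"
    unfolding G_def by (rule N.borel_measurable_lebesgue_integral) (simp add: case_prod_unfold)
  have EG: "(\<integral>x. F x \<partial>PiM (insert i I) (\<lambda>_. N)) = (\<integral>x. G x \<partial>PiM I (\<lambda>_. N))"
    unfolding G_def by (rule P.product_integral_insert[OF insert(1,2) int_F])
  let ?m = "\<integral>x. G x \<partial>PiM I (\<lambda>_. N)"
  have IH: "(\<integral>\<^sup>+x. exp (s * (G x - ?m)) \<partial>PiM I (\<lambda>_. N))
           \<le> ennreal (exp (real (card I) * (s\<^sup>2 * c\<^sup>2 / 2)))"
  proof (rule insert.IH)
    fix x j a assume x: "x \<in> space (PiM I (\<lambda>_. N))" and j: "j \<in> I" and a: "a \<in> space N"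
    have ja: "x(j := a) \<in> space (PiM I (\<lambda>_. N))"
      using x j a by (auto simp: space_PiM PiE_def extensional_def)
    have "G (x(j := a)) - G x = (\<integral>b. F (x(j := a, i := b)) - F (x(i := b)) \<partial>N)"
      unfolding G_def by (rule Bochner_Integration.integral_diff[symmetric]) (intro int_a ja x)+
    moreover have "\<bar>\<dots>\<bar> \<le> (\<integral>b. c \<partial>N)"
    proof (rule abs_integral_le)
      fix b assume b: "b \<in> space N"
      have *: "x(j := a, i := b) = x(i := b, j := a)"
        using insert(2) j by (auto simp: fun_upd_twist)
      have "\<bar>F (x(i := b, j := a)) - F (x(i := b))\<bar> \<le> c"
        by (rule insert.prems(2)[OF sp[OF x b] _ a]) (use j in simp)
      then show "\<bar>F (x(j := a, i := b)) - F (x(i := b))\<bar> \<le> c"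
        unfolding * .
    qed (auto intro!: int_a ja x Bochner_Integration.integrable_diff)
    ultimately show "\<bar>G (x(j := a)) - G x\<bar> \<le> c" by (simp add: N.prob_space)
  next
    fix x assume x: "x \<in> space (PiM I (\<lambda>_. N))"
    have "\<bar>G x\<bar> \<le> (\<integral>a. b \<partial>N)" unfolding G_def
      by (rule abs_integral_le)
         (auto intro!: int_a x insert.prems(3) sp)
    then show "\<bar>G x\<bar> \<le> b" by (simp add: N.prob_space)
  qed measurable
  have inner: "(\<integral>\<^sup>+a. exp (s * (F (x(i := a)) - G x)) \<partial>N) \<le> ennreal (exp (s\<^sup>2 * c\<^sup>2 / 2))"
    if x: "x \<in> space (PiM I (\<lambda>_. N))" for x
  proof -
    have bd: "F (x(i := a)) - G x \<in> {-c..c}" if a: "a \<in> space N" for a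
    proof -
      have "G x - F (x(i := a)) = (\<integral>b. F (x(i := b)) - F (x(i := a)) \<partial>N)"
        unfolding G_def by (subst Bochner_Integration.integral_diff) (auto intro!: int_a x simp: N.prob_space)
      moreover have "\<bar>\<dots>\<bar> \<le> (\<integral>b. c \<partial>N)"
      proof (rule abs_integral_le)
        fix b assume b: "b \<in> space N"
        have "\<bar>F (x(i := a, i := b)) - F (x(i := a))\<bar> \<le> c"
          by (rule insert.prems(2)[OF sp[OF x a] _ b]) simp
        then show "\<bar>F (x(i := b)) - F (x(i := a))\<bar> \<le> c"
          unfolding fun_upd_upd .
      qed (auto intro!: int_a x Bochner_Integration.integrable_diff)
      ultimately show ?thesis by (auto simp: N.prob_space abs_le_iff)
    qed
    interpret V: interval_bounded_random_variable N "\<lambda>a. F (x(i := a)) - G x" "-c" c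
      using meas_a[OF x] bd by unfold_locales auto
    have "(\<integral>a. F (x(i := a)) - G x \<partial>N) = 0"
      using int_a[OF x] by (simp add: G_def N.prob_space)
    from V.Hoeffdings_lemma_nn_integral_0[OF \<open>s > 0\<close> this] show ?thesis
      by (simp add: power2_eq_square field_simps)
  qed
  have "(\<integral>\<^sup>+x. exp (s * (F x - (\<integral>x. F x \<partial>PiM (insert i I) (\<lambda>_. N)))) \<partial>PiM (insert i I) (\<lambda>_. N))
      = (\<integral>\<^sup>+x. (\<integral>\<^sup>+a. exp (s * (F (x(i := a)) - ?m)) \<partial>N) \<partial>PiM I (\<lambda>_. N))"
    unfolding EG by (rule P.product_nn_integral_insert[OF insert(1,2)]) measurable
  also have "\<dots> = (\<integral>\<^sup>+x. (\<integral>\<^sup>+a. ennreal (exp (s * (G x - ?m))) * exp (s * (F (x(i := a)) - G x)) \<partial>N) \<partial>PiM I (\<lambda>_. N))"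
    by (simp flip: ennreal_mult exp_add add: algebra_simps)
  also have "\<dots> = (\<integral>\<^sup>+x. ennreal (exp (s * (G x - ?m))) * (\<integral>\<^sup>+a. exp (s * (F (x(i := a)) - G x)) \<partial>N) \<partial>PiM I (\<lambda>_. N))"
    using meas_a by (intro nn_integral_cong nn_integral_cmult) measurable
  also have "\<dots> \<le> (\<integral>\<^sup>+x. ennreal (exp (s * (G x - ?m))) * ennreal (exp (s\<^sup>2 * c\<^sup>2 / 2)) \<partial>PiM I (\<lambda>_. N))"
    by (intro nn_integral_mono mult_left_mono inner) auto
  also have "\<dots> = (\<integral>\<^sup>+x. ennreal (exp (s * (G x - ?m))) \<partial>PiM I (\<lambda>_. N)) * ennreal (exp (s\<^sup>2 * c\<^sup>2 / 2))"
    by (rule nn_integral_multc) measurable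
  also have "\<dots> \<le> ennreal (exp (real (card I) * (s\<^sup>2 * c\<^sup>2 / 2))) * ennreal (exp (s\<^sup>2 * c\<^sup>2 / 2))"
    by (intro mult_right_mono IH) auto
  also have "\<dots> = ennreal (exp (real (card (insert i I)) * (s\<^sup>2 * c\<^sup>2 / 2)))"
    using insert(1,2) by (simp flip: ennreal_mult exp_add add: algebra_simps)
  finally show ?case .
qed

lemma mcdiarmid_upper:
  fixes N :: "'a measure" and F :: "('i \<Rightarrow> 'a) \<Rightarrow> real"
  assumes "prob_space N" "finite I" "I \<noteq> {}" "t > 0" "c > 0"
    and F: "F \<in> borel_measurable (PiM I (\<lambda>_. N))"
    and "\<And>x i a. x \<in> space (PiM I (\<lambda>_. N)) \<Longrightarrow> i \<in> I \<Longrightarrow> a \<in> space N \<Longrightarrow> \<bar>F (x(i := a)) - F x\<bar> \<le> c"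
    and "\<And>x. x \<in> space (PiM I (\<lambda>_. N)) \<Longrightarrow> \<bar>F x\<bar> \<le> b"
  shows "measure (PiM I (\<lambda>_. N)) {x \<in> space (PiM I (\<lambda>_. N)). F x - (\<integral>x. F x \<partial>PiM I (\<lambda>_. N)) \<ge> t}
           \<le> exp (- t\<^sup>2 / (2 * real (card I) * c\<^sup>2))"
proof -
  interpret P: prob_space "PiM I (\<lambda>_. N)" by (rule prob_space_PiM) (rule assms(1))
  note [measurable] = F
  let ?P = "PiM I (\<lambda>_. N)"
  define m where "m = (\<integral>x. F x \<partial>PiM I (\<lambda>_. N))"
  \<comment> \<open>The minimiser of the Chernoff exponent
    \<open>- s * t + card I * s\<^sup>2 * c\<^sup>2 / 2\<close>.\<close>
  define s where "s = t / (real (card I) * c\<^sup>2)"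
  have card: "real (card I) > 0" using assms(2,3) by (simp add: card_gt_0_iff)
  then have s: "s > 0" using assms by (simp add: s_def)
  have "emeasure ?P {x \<in> space ?P. F x - m \<ge> t} =
      emeasure ?P {x \<in> space ?P. 1 \<le> ennreal (exp (- s * t)) * ennreal (exp (s * (F x - m)))}"
    using s by (intro arg_cong2[where f=emeasure] Collect_cong conj_cong refl)
      (auto simp flip: ennreal_mult exp_add simp: right_diff_distrib[symmetric] zero_le_mult_iff)
  also have "\<dots> \<le> ennreal (exp (- s * t)) * (\<integral>\<^sup>+x. ennreal (exp (s * (F x - m))) \<partial>?P)"
    using nn_integral_Markov_inequality[where u="\<lambda>x. ennreal (exp (s * (F x - m)))" and c="ennreal (exp (- s * t))" and A="space ?P" and M="?P"]
    by simp
  also have "\<dots> \<le> ennreal (exp (- s * t)) * ennreal (exp (real (card I) * (s\<^sup>2 * c\<^sup>2 / 2)))"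
    unfolding m_def using assms s by (intro mult_left_mono mcdiarmid_mgf[where b=b]) auto
  also have "\<dots> = ennreal (exp (- t\<^sup>2 / (2 * real (card I) * c\<^sup>2)))"
    using card \<open>c > 0\<close>
    by (simp flip: ennreal_mult exp_add add: s_def power2_eq_square field_simps)
  finally show ?thesis
    by (simp add: m_def P.emeasure_eq_measure)
qed

lemma mcdiarmid:
  fixes N :: "'a measure" and F :: "('i \<Rightarrow> 'a) \<Rightarrow> real"
  assumes "prob_space N" "finite I" "I \<noteq> {}" "t > 0" "c > 0"
    and F: "F \<in> borel_measurable (PiM I (\<lambda>_. N))"
    and diff: "\<And>x i a. x \<in> space (PiM I (\<lambda>_. N)) \<Longrightarrow> i \<in> I \<Longrightarrow> a \<in> space N \<Longrightarrow> \<bar>F (x(i := a)) - F x\<bar> \<le> c"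
    and bd: "\<And>x. x \<in> space (PiM I (\<lambda>_. N)) \<Longrightarrow> \<bar>F x\<bar> \<le> b"
  shows "measure (PiM I (\<lambda>_. N)) {x \<in> space (PiM I (\<lambda>_. N)). \<bar>F x - (\<integral>x. F x \<partial>PiM I (\<lambda>_. N))\<bar> \<ge> t}
           \<le> 2 * exp (- t\<^sup>2 / (2 * real (card I) * c\<^sup>2))"
proof -
  interpret P: prob_space "PiM I (\<lambda>_. N)" by (rule prob_space_PiM) (rule assms(1))
  note [measurable] = F
  let ?P = "PiM I (\<lambda>_. N)"
  define m where "m = (\<integral>x. F x \<partial>PiM I (\<lambda>_. N))"
  have "measure ?P {x \<in> space ?P. \<bar>F x - m\<bar> \<ge> t}
      \<le> measure ?P ({x \<in> space ?P. F x - m \<ge> t} \<union> {x \<in> space ?P. (- F x) - (\<integral>x. - F x \<partial>?P) \<ge> t})"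
    by (rule P.finite_measure_mono) (auto simp: m_def)
  also have "\<dots> \<le> measure ?P {x \<in> space ?P. F x - m \<ge> t} + measure ?P {x \<in> space ?P. (- F x) - (\<integral>x. - F x \<partial>?P) \<ge> t}"
    by (rule measure_Un_le) measurable
  also have "\<dots> \<le> exp (- t\<^sup>2 / (2 * real (card I) * c\<^sup>2)) + exp (- t\<^sup>2 / (2 * real (card I) * c\<^sup>2))"
    unfolding m_def
  proof (intro add_mono mcdiarmid_upper[where b=b] assms)
    fix x i a assume "x \<in> space ?P" "i \<in> I" "a \<in> space N"
    from diff[OF this] show "\<bar>- F (x(i := a)) - - F x\<bar> \<le> c" by linarith
  qed (use bd in auto)
  finally show ?thesis by (simp add: m_def)
qed

section \<open>Isomorphism with a fixed digraph\<close>

definition arc_rel :: "('v, 'e) pre_digraph \<Rightarrow> 'v \<Rightarrow> 'v \<Rightarrow> bool" where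
  "arc_rel T u v \<longleftrightarrow> (\<exists>e\<in>arcs T. tail T e = u \<and> head T e = v)"

text \<open>Isomorphism expressed by adjacency alone. Without arc maps it becomes, for finite sets,
  a finite disjunction over bijections, hence an event.\<close>

definition rel_iso :: "'v set \<Rightarrow> ('v \<Rightarrow> 'v \<Rightarrow> bool) \<Rightarrow> 'i set \<Rightarrow> ('i \<Rightarrow> 'i \<Rightarrow> bool) \<Rightarrow> bool" where
  "rel_iso V E W R \<longleftrightarrow> (\<exists>g. bij_betw g W V \<and> (\<forall>i\<in>W. \<forall>j\<in>W. R i j \<longleftrightarrow> E (g i) (g j)))"

text \<open>In a digraph without parallel arcs, a bijection of the vertices that preserves adjacency
  extends to the arcs in exactly one way.\<close>

lemma digraph_iso_iff_rel_iso:
  assumes "digraph T" and A: "A \<subseteq> I \<times> I"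
  shows "digraph_iso \<lparr>verts = I, arcs = A, tail = fst, head = snd\<rparr> T \<longleftrightarrow>
    rel_iso (verts T) (arc_rel T) I (\<lambda>i j. (i, j) \<in> A)" (is "digraph_iso ?G T \<longleftrightarrow> _")
proof
  interpret T: digraph T by fact
  assume "digraph_iso ?G T"
  then obtain h where h: "pre_digraph.digraph_isomorphism ?G h" and T: "T = app_iso h ?G"
    by (auto simp: digraph_iso_def)
  have inj: "inj_on (iso_verts h) I"
    and ends: "\<And>a. a \<in> A \<Longrightarrow> iso_verts h (fst a) = iso_tail h (iso_arcs h a) \<and>
      iso_verts h (snd a) = iso_head h (iso_arcs h a)"
    using h by (auto simp: pre_digraph.digraph_isomorphism_def)
  have T_simps: "verts T = iso_verts h ` I" "arcs T = iso_arcs h ` A" "tail T = iso_tail h" "head T = iso_head h"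
    by (subst T, simp)+
  show "rel_iso (verts T) (arc_rel T) I (\<lambda>i j. (i, j) \<in> A)"
    unfolding rel_iso_def
  proof (intro exI[of _ "iso_verts h"] conjI ballI iffI)
    show "bij_betw (iso_verts h) I (verts T)"
      using inj by (simp add: bij_betw_def T_simps)
  next
    fix i j assume "(i, j) \<in> A"
    then show "arc_rel T (iso_verts h i) (iso_verts h j)"
      using ends[of "(i, j)"] unfolding arc_rel_def T_simps by (auto intro!: bexI[of _ "(i, j)"])
  next
    fix i j assume ij: "i \<in> I" "j \<in> I" and "arc_rel T (iso_verts h i) (iso_verts h j)"
    then obtain a where a: "a \<in> A" "iso_tail h (iso_arcs h a) = iso_verts h i" "iso_head h (iso_arcs h a) = iso_verts h j"
      unfolding arc_rel_def T_simps by auto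
    then have "iso_verts h (fst a) = iso_verts h i" "iso_verts h (snd a) = iso_verts h j"
      using ends[OF a(1)] by auto
    moreover have "fst a \<in> I" "snd a \<in> I" using a(1) A by auto
    ultimately have "fst a = i" "snd a = j" using inj ij by (auto dest: inj_onD)
    then show "(i, j) \<in> A" using a(1) by auto
  qed
next
  interpret T: digraph T by fact
  assume "rel_iso (verts T) (arc_rel T) I (\<lambda>i j. (i, j) \<in> A)"
  then obtain g where g: "bij_betw g I (verts T)"
    and gA: "\<And>i j. i \<in> I \<Longrightarrow> j \<in> I \<Longrightarrow> (i, j) \<in> A \<longleftrightarrow> arc_rel T (g i) (g j)"
    by (auto simp: rel_iso_def)
  have inj: "inj_on g I" and im: "g ` I = verts T" using g by (auto simp: bij_betw_def)
  \<comment> \<open>The absence of multiple arcs makes this choice the only candidate, which is what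
    shows below that every arc of \<open>T\<close> is hit.\<close>
  define arc where "arc = (\<lambda>a. SOME e. e \<in> arcs T \<and> tail T e = g (fst a) \<and> head T e = g (snd a))"
  have arc: "arc a \<in> arcs T \<and> tail T (arc a) = g (fst a) \<and> head T (arc a) = g (snd a)" if "a \<in> A" for a
    unfolding arc_def
  proof (rule someI_ex)
    have "fst a \<in> I" "snd a \<in> I" "(fst a, snd a) \<in> A" using that A by auto
    then show "\<exists>e. e \<in> arcs T \<and> tail T e = g (fst a) \<and> head T e = g (snd a)"
      using gA[of "fst a" "snd a"] by (auto simp: arc_rel_def)
  qed
  \<comment> \<open>\<open>digraph_iso\<close> demands that \<open>T\<close> equal the image as a
    record, so the tail and head functions must be those of \<open>T\<close> everywhere, not only on
    its arcs.\<close>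
  define h where "h = \<lparr>iso_verts = g, iso_arcs = arc, iso_head = head T, iso_tail = tail T\<rparr>"
  have inj_arc: "inj_on arc A"
  proof (rule inj_onI)
    fix a b assume ab: "a \<in> A" "b \<in> A" "arc a = arc b"
    then have "g (fst a) = g (fst b)" "g (snd a) = g (snd b)" using arc[OF ab(1)] arc[OF ab(2)] by auto
    moreover have "fst a \<in> I" "snd a \<in> I" "fst b \<in> I" "snd b \<in> I" using ab A by auto
    ultimately show "a = b" using inj by (auto dest: inj_onD intro: prod_eqI)
  qed
  have arcs: "arcs T = arc ` A"
  proof (intro equalityI subsetI)
    fix e assume e: "e \<in> arcs T"
    then have "tail T e \<in> g ` I" "head T e \<in> g ` I" by (simp_all add: im)
    then obtain i j where ij: "i \<in> I" "j \<in> I" "tail T e = g i" "head T e = g j" by auto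
    with e have "(i, j) \<in> A" using gA[OF ij(1,2)] by (auto simp: arc_rel_def)
    moreover have "arc (i, j) = e"
      using arc[OF \<open>(i, j) \<in> A\<close>] e ij T.no_multi_arcs by (fastforce simp: arc_to_ends_def)
    ultimately show "e \<in> arc ` A" by (auto intro: rev_image_eqI)
  qed (use arc in auto)
  have "wf_digraph ?G" by unfold_locales (use A in auto)
  then have "pre_digraph.digraph_isomorphism ?G h"
    unfolding pre_digraph.digraph_isomorphism_def using inj inj_arc arc by (auto simp: h_def)
  moreover have "T = app_iso h ?G"
    by (rule pre_digraph.equality) (simp_all add: h_def im arcs)
  ultimately show "digraph_iso ?G T" unfolding digraph_iso_def by blast
qed

section \<open>Isolated copies in sector digraphs, in terms of adjacency\<close>

lemma sector_digraph_iso_iff: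
  assumes "digraph T"
  shows "digraph_iso (sector_digraph \<alpha> I x y r) T \<longleftrightarrow>
    rel_iso (verts T) (arc_rel T) I (\<lambda>i j. i \<noteq> j \<and> x j \<in> sector \<alpha> (x i) (y i) r)"
proof -
  have "digraph_iso (sector_digraph \<alpha> I x y r) T \<longleftrightarrow>
    rel_iso (verts T) (arc_rel T) I (\<lambda>i j. (i, j) \<in> {(i, j). i \<in> I \<and> j \<in> I \<and> i \<noteq> j \<and> x j \<in> sector \<alpha> (x i) (y i) r})"
    unfolding sector_digraph_def by (rule digraph_iso_iff_rel_iso[OF assms]) auto
  also have "\<dots> \<longleftrightarrow> rel_iso (verts T) (arc_rel T) I (\<lambda>i j. i \<noteq> j \<and> x j \<in> sector \<alpha> (x i) (y i) r)"
    unfolding rel_iso_def by simp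
  finally show ?thesis .
qed

lemma induce_sector_digraph:
  assumes "W \<subseteq> I"
  shows "sector_digraph \<alpha> I x y r \<restriction> W = sector_digraph \<alpha> W x y r"
  using assms unfolding sector_digraph_def induce_subgraph_def by auto

lemma isolated_sector_digraph_iff:
  assumes "W \<subseteq> I"
  shows "isolated_subgraph (sector_digraph \<alpha> I x y r \<restriction> W) (sector_digraph \<alpha> I x y r) \<longleftrightarrow>
    (\<forall>i\<in>W. \<forall>j\<in>I - W. x j \<notin> sector \<alpha> (x i) (y i) r)"
proof -
  let ?G = "sector_digraph \<alpha> I x y r"
  have "wf_digraph ?G" by unfold_locales (auto simp: sector_digraph_def)
  then have "induced_subgraph (?G \<restriction> W) ?G"
    by (rule wf_digraph.induced_induce) (use assms in \<open>simp add: sector_digraph_def\<close>)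
  then show ?thesis
    using assms unfolding isolated_subgraph_def by (auto simp: sector_digraph_def)
qed

lemma num_isolated_sector_digraph:
  assumes "digraph T"
  shows "num_isolated (sector_digraph \<alpha> I x y r) T = card {W. W \<subseteq> I \<and> card W = card (verts T) \<and>
    (\<forall>i\<in>W. \<forall>j\<in>I - W. x j \<notin> sector \<alpha> (x i) (y i) r) \<and>
    rel_iso (verts T) (arc_rel T) W (\<lambda>i j. i \<noteq> j \<and> x j \<in> sector \<alpha> (x i) (y i) r)}"
proof -
  have v: "verts (sector_digraph \<alpha> I x y r) = I" by (simp add: sector_digraph_def)
  show ?thesis
    unfolding num_isolated_def v
    by (intro arg_cong[where f=card] Collect_cong conj_cong refl isolated_sector_digraph_iff)
       (simp_all add: induce_sector_digraph sector_digraph_iso_iff[OF assms])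
qed

text \<open>Connectedness is strong connectedness of the symmetrised digraph, so a path may traverse
  arcs of \<open>T\<close> in either direction. The path yields the diameter bound.\<close>

lemma connected_imp_rtrancl:
  assumes "digraph T" "Digraph_Component.connected T" "u \<in> verts T" "v \<in> verts T"
  shows "(u, v) \<in> {(a, b). a \<in> verts T \<and> b \<in> verts T \<and> (arc_rel T a b \<or> arc_rel T b a)}\<^sup>*"
proof -
  interpret T: digraph T by fact
  let ?S = "{(a, b). a \<in> verts T \<and> b \<in> verts T \<and> (arc_rel T a b \<or> arc_rel T b a)}"
  have "(u, v) \<in> rtrancl_on (verts T) (parcs (mk_symmetric T))"
    using assms unfolding connected_def strongly_connected_def reachable_def by auto
  then show ?thesis
  proof (induction rule: rtrancl_on_induct)
    case (step y z)
    then have "(y, z) \<in> ?S" by (auto simp: parcs_mk_symmetric arc_rel_def)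
    then show ?case using step by (meson rtrancl.rtrancl_into_rtrancl)
  qed simp
qed

text \<open>Renaming vertices moves a copy on an arbitrary vertex set to the index set
  \<open>{1..k}\<close>.\<close>

lemma rel_iso_reindex:
  assumes "bij_betw \<sigma> W' W" "\<And>i j. i \<in> W' \<Longrightarrow> j \<in> W' \<Longrightarrow> R' i j = R (\<sigma> i) (\<sigma> j)"
  shows "rel_iso V E W R \<longleftrightarrow> rel_iso V E W' R'"
proof
  assume "rel_iso V E W R"
  then obtain g where g: "bij_betw g W V" "\<And>i j. i \<in> W \<Longrightarrow> j \<in> W \<Longrightarrow> R i j \<longleftrightarrow> E (g i) (g j)"
    by (auto simp: rel_iso_def)
  have "bij_betw (g \<circ> \<sigma>) W' V" using assms(1) g(1) by (rule bij_betw_trans)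
  moreover have "\<sigma> i \<in> W" if "i \<in> W'" for i using assms(1) that by (auto simp: bij_betw_def)
  ultimately show "rel_iso V E W' R'" unfolding rel_iso_def using g(2) assms(2) by (intro exI[of _ "g \<circ> \<sigma>"]) auto
next
  assume "rel_iso V E W' R'"
  then obtain g where g: "bij_betw g W' V" "\<And>i j. i \<in> W' \<Longrightarrow> j \<in> W' \<Longrightarrow> R' i j \<longleftrightarrow> E (g i) (g j)"
    by (auto simp: rel_iso_def)
  let ?\<tau> = "the_inv_into W' \<sigma>"
  have \<tau>: "bij_betw ?\<tau> W W'" using assms(1) by (rule bij_betw_the_inv_into)
  have s: "\<sigma> (?\<tau> i) = i" "?\<tau> i \<in> W'" if "i \<in> W" for i
    using that assms(1) \<tau> by (auto simp: f_the_inv_into_f_bij_betw bij_betw_def)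
  show "rel_iso V E W R"
    unfolding rel_iso_def
  proof (intro exI[of _ "g \<circ> ?\<tau>"] conjI ballI)
    show "bij_betw (g \<circ> ?\<tau>) W V" using \<tau> g(1) by (rule bij_betw_trans)
    fix i j assume "i \<in> W" "j \<in> W"
    then show "R i j = E ((g \<circ> ?\<tau>) i) ((g \<circ> ?\<tau>) j)"
      using g(2)[of "?\<tau> i" "?\<tau> j"] assms(2)[of "?\<tau> i" "?\<tau> j"] s[of i] s[of j] by simp
  qed
qed

section \<open>Truncation by grid cells\<close>

text \<open>A mark is a position together with an inclination. For \<alpha> \<ge> 0 and
  \<open>r > 0\<close> every index sees itself, so \<open>copy\<close> has to exclude
  \<open>i = j\<close>.\<close>

definition sees :: "real \<Rightarrow> real \<Rightarrow> ('i \<Rightarrow> (real^2) \<times> real) \<Rightarrow> 'i \<Rightarrow> 'i \<Rightarrow> bool" where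
  "sees \<alpha> r z i j \<longleftrightarrow> fst (z j) \<in> sector \<alpha> (fst (z i)) (snd (z i)) r"

definition grid_cell :: "real \<Rightarrow> real^2 \<Rightarrow> int \<times> int" where
  "grid_cell r x = (\<lfloor>x $ 1 / r\<rfloor>, \<lfloor>x $ 2 / r\<rfloor>)"

definition crowd :: "real \<Rightarrow> 'i set \<Rightarrow> ('i \<Rightarrow> (real^2) \<times> real) \<Rightarrow> 'i \<Rightarrow> nat" where
  "crowd r I z i = card {j \<in> I. grid_cell r (fst (z j)) = grid_cell r (fst (z i))}"

definition cell_box :: "int \<Rightarrow> int \<times> int \<Rightarrow> (int \<times> int) set" where
  "cell_box m c = {fst c - m..fst c + m} \<times> {snd c - m..snd c + m}"

lemma card_cell_box: "m \<ge> 0 \<Longrightarrow> card (cell_box m c) = (nat (2 * m + 1))\<^sup>2"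
  by (simp add: cell_box_def card_cartesian_product power2_eq_square)

lemma floor_dist_le:
  fixes a b :: real
  assumes "\<bar>a - b\<bar> \<le> of_int m"
  shows "\<bar>\<lfloor>a\<rfloor> - \<lfloor>b\<rfloor>\<bar> \<le> m"
proof -
  have "a \<le> b + of_int m" "b \<le> a + of_int m" using assms by auto
  then have "\<lfloor>a\<rfloor> \<le> \<lfloor>b + of_int m\<rfloor>" "\<lfloor>b\<rfloor> \<le> \<lfloor>a + of_int m\<rfloor>" by (blast intro: floor_mono)+
  then show ?thesis by simp
qed

lemma grid_cell_in_box:
  assumes "r > 0" "dist x u \<le> of_int m * r"
  shows "grid_cell r x \<in> cell_box m (grid_cell r u)"
proof -
  have "\<bar>x$i / r - u$i / r\<bar> \<le> of_int m" for i
  proof -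
    have "\<bar>x$i - u$i\<bar> \<le> of_int m * r"
      using component_le_norm_cart[of "x - u" i] assms(2) by (simp add: dist_norm)
    then show ?thesis
      using assms(1) by (simp add: diff_divide_distrib[symmetric] abs_divide divide_le_eq)
  qed
  from floor_dist_le[OF this[of 1]] floor_dist_le[OF this[of 2]] show ?thesis
    by (auto simp: grid_cell_def cell_box_def abs_le_iff)
qed

text \<open>The digraph \<open>T\<close> enters the geometric argument only as a finite vertex set
  with an adjacency relation, and its connectedness only through a bound \<open>D\<close> on
  distances in the underlying undirected graph.\<close>

locale pattern =
  fixes \<alpha> :: real and V :: "'v set" and E :: "'v \<Rightarrow> 'v \<Rightarrow> bool" and D :: nat
  assumes finite_V: "finite V" and V_nonempty: "V \<noteq> {}"
    and diam: "\<And>u v. u \<in> V \<Longrightarrow> v \<in> V \<Longrightarrow>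
      \<exists>m\<le>D. (u, v) \<in> {(a, b). a \<in> V \<and> b \<in> V \<and> (E a b \<or> E b a)} ^^ m"
begin

definition copy :: "real \<Rightarrow> 'i set \<Rightarrow> ('i \<Rightarrow> (real^2) \<times> real) \<Rightarrow> bool" where
  "copy r W z \<longleftrightarrow> rel_iso V E W (\<lambda>i j. i \<noteq> j \<and> sees \<alpha> r z i j)"

definition iso_copy :: "real \<Rightarrow> 'i set \<Rightarrow> 'i set \<Rightarrow> ('i \<Rightarrow> (real^2) \<times> real) \<Rightarrow> bool" where
  "iso_copy r I W z \<longleftrightarrow> copy r W z \<and> (\<forall>i\<in>W. \<forall>j\<in>I - W. \<not> sees \<alpha> r z i j)"

definition iso_copies :: "real \<Rightarrow> 'i set \<Rightarrow> ('i \<Rightarrow> (real^2) \<times> real) \<Rightarrow> 'i set set" where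
  "iso_copies r I z = {W. W \<subseteq> I \<and> card W = card V \<and> iso_copy r I W z}"

definition sparse_copies :: "nat \<Rightarrow> real \<Rightarrow> 'i set \<Rightarrow> ('i \<Rightarrow> (real^2) \<times> real) \<Rightarrow> 'i set set" where
  "sparse_copies K r I z = {W \<in> iso_copies r I z. \<forall>i\<in>W. crowd r I z i \<le> K}"

lemma card_V_pos: "card V > 0"
  using finite_V V_nonempty by (simp add: card_gt_0_iff)

lemma finite_iso_copies: "finite I \<Longrightarrow> finite (iso_copies r I z)"
  by (rule finite_subset[of _ "Pow I"]) (auto simp: iso_copies_def)

lemma finite_sparse_copies: "finite I \<Longrightarrow> finite (sparse_copies K r I z)"
  by (rule finite_subset[OF _ finite_iso_copies]) (auto simp: sparse_copies_def)

lemma binomial_le_power: "n choose m \<le> n ^ m"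
  by (cases "m \<le> n") (simp_all add: binomial_le_pow binomial_eq_0)

lemma card_iso_copies_le: 
  assumes "finite I"
  shows "card (iso_copies r I z) \<le> card I ^ card V"
proof -
  have "card (iso_copies r I z) \<le> card {W. W \<subseteq> I \<and> card W = card V}"
    using assms by (intro card_mono) (auto simp: iso_copies_def)
  also have "\<dots> = card I choose card V" using assms by (rule n_subsets)
  finally show ?thesis using binomial_le_power order_trans by blast
qed

text \<open>Adjacent vertices of a copy are at distance at most \<open>r\<close>, whichever way the
  arc points; add this up along a path of at most \<open>D\<close> edges.\<close>

lemma copy_dist:
  assumes "copy r W z" "i \<in> W" "j \<in> W" "r > 0"
  shows "dist (fst (z i)) (fst (z j)) \<le> of_int (int D) * r"
proof -
  let ?S = "{(a, b). a \<in> V \<and> b \<in> V \<and> (E a b \<or> E b a)}"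
  obtain g where g: "bij_betw g W V" "\<And>i j. i \<in> W \<Longrightarrow> j \<in> W \<Longrightarrow> (i \<noteq> j \<and> sees \<alpha> r z i j) \<longleftrightarrow> E (g i) (g j)"
    using assms(1) by (auto simp: copy_def rel_iso_def)
  have inj: "inj_on g W" and im: "g ` W = V" using g(1) by (auto simp: bij_betw_def)
  have step: "dist (fst (z i)) (fst (z j)) \<le> r" if "i \<in> W" "j \<in> W" "(g i, g j) \<in> ?S" for i j
  proof -
    have "sees \<alpha> r z i j \<or> sees \<alpha> r z j i" using that g(2) by auto
    then show ?thesis by (auto simp: sees_def dist_commute dest: sector_dist)
  qed
  have chain: "dist (fst (z i)) (fst (z j)) \<le> real m * r" if "j \<in> W" "(g i, g j) \<in> ?S ^^ m" for j m
    using that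
  proof (induction m arbitrary: j)
    case 0
    then have "j = i" using inj assms(2) by (auto dest: inj_onD)
    then show ?case by simp
  next
    case (Suc m)
    then obtain v where v: "(g i, v) \<in> ?S ^^ m" "(v, g j) \<in> ?S" by auto
    then have "v \<in> V" by auto
    then obtain l where l: "l \<in> W" "v = g l" using im by auto
    have "dist (fst (z i)) (fst (z j)) \<le> dist (fst (z i)) (fst (z l)) + dist (fst (z l)) (fst (z j))"
      by (rule dist_triangle)
    also have "\<dots> \<le> real m * r + r"
      using Suc.IH[of l] step[of l j] v l Suc.prems(1) by (intro add_mono) simp_all
    finally show ?case by (simp add: algebra_simps)
  qed
  have "g i \<in> V" "g j \<in> V" using assms(2,3) im by auto
  from diam[OF this] obtain m where m: "m \<le> D" "(g i, g j) \<in> ?S ^^ m" by blast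
  have "real m * r \<le> real D * r" using m(1) assms(4) by (intro mult_right_mono) auto
  then show ?thesis using chain[OF assms(3) m(2)] by simp
qed

text \<open>A copy affected by the move of a point lies in the cells of two boxes of side
  \<open>2 * D + 3\<close>, around the old and the new cell of that point. Each cell offers at most
  \<open>K\<close> admissible vertices, and a copy is a \<open>k\<close>-subset of all of
  these.\<close>

definition diff_bound :: "nat \<Rightarrow> nat" where
  "diff_bound K = (2 * (2 * D + 3)\<^sup>2 * K) ^ card V"

text \<open>A copy lost when \<open>p\<close> moves to \<open>a\<close> contains \<open>p\<close>,
  or sees the new position, or has a vertex in a cell that \<open>a\<close> makes too crowded. In
  each case one of its vertices is near the old or the new position, so by the diameter bound the
  whole copy is.\<close>

lemma sparse_copies_update_subset:
  assumes fin: "finite I" and p: "p \<in> I" and r: "r > 0"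
  shows "card (sparse_copies K r I z) \<le> card (sparse_copies K r I (z(p := a))) + diff_bound K"
proof -
  define z' where "z' = z(p := a)"
  \<comment> \<open>\<open>D\<close> for the diameter of the copy and \<open>1\<close> for an arc
    from the copy to the moved point.\<close>
  define m where "m = int D + 1"
  define cell where "cell i = grid_cell r (fst (z i))" for i
  define B where "B = cell_box m (cell p) \<union> cell_box m (grid_cell r (fst a))"
  \<comment> \<open>Cells and crowding refer to the old configuration, since that is where the lost
    copy was sparse.\<close>
  define N where "N = {i \<in> I. crowd r I z i \<le> K \<and> cell i \<in> B}"
  have finN: "finite N" using fin by (simp add: N_def)
  have finB: "finite B" by (simp add: B_def cell_box_def)
  have cardB: "card B \<le> 2 * (2 * D + 3)\<^sup>2"
  proof -
    have "card B \<le> card (cell_box m (cell p)) + card (cell_box m (grid_cell r (fst a)))"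
      unfolding B_def by (rule card_Un_le)
    also have "\<dots> = 2 * (nat (2 * m + 1))\<^sup>2" by (simp add: card_cell_box m_def)
    also have "nat (2 * m + 1) = 2 * D + 3" by (simp add: m_def nat_add_distrib nat_mult_distrib)
    finally show ?thesis .
  qed
  \<comment> \<open>A cell in the box may be crowded, but then none of its points belongs to
    \<open>N\<close>; otherwise any one point of \<open>N\<close> in it certifies that it holds at
    most \<open>K\<close> points.\<close>
  have "N \<subseteq> (\<Union>c\<in>B. {i \<in> I. cell i = c \<and> crowd r I z i \<le> K})" by (auto simp: N_def)
  then have "card N \<le> card (\<Union>c\<in>B. {i \<in> I. cell i = c \<and> crowd r I z i \<le> K})"
    using fin finB by (intro card_mono) auto
  also have "\<dots> \<le> (\<Sum>c\<in>B. card {i \<in> I. cell i = c \<and> crowd r I z i \<le> K})"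
    by (rule card_UN_le[OF finB])
  also have "\<dots> \<le> (\<Sum>c\<in>B. K)"
  proof (rule sum_mono)
    fix c
    show "card {i \<in> I. cell i = c \<and> crowd r I z i \<le> K} \<le> K"
    proof (cases "{i \<in> I. cell i = c \<and> crowd r I z i \<le> K} = {}")
      case False
      then obtain i where i: "cell i = c" "crowd r I z i \<le> K" by auto
      have "card {i \<in> I. cell i = c \<and> crowd r I z i \<le> K} \<le> crowd r I z i"
        unfolding crowd_def using fin i(1) by (intro card_mono) (auto simp: cell_def)
      then show ?thesis using i(2) by simp
    qed (simp only: card.empty zero_le)
  qed
  also have "\<dots> \<le> 2 * (2 * D + 3)\<^sup>2 * K" using cardB by simp
  finally have cardN: "card N \<le> 2 * (2 * D + 3)\<^sup>2 * K" .
  have sub: "sparse_copies K r I z \<subseteq> sparse_copies K r I z' \<union> {W. W \<subseteq> N \<and> card W = card V}"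
  proof
    fix W assume W: "W \<in> sparse_copies K r I z"
    then have WI: "W \<subseteq> I" "card W = card V" and cp: "copy r W z"
      and iso: "\<And>i j. i \<in> W \<Longrightarrow> j \<in> I - W \<Longrightarrow> \<not> sees \<alpha> r z i j"
      and cr: "\<And>i. i \<in> W \<Longrightarrow> crowd r I z i \<le> K"
      by (auto simp: sparse_copies_def iso_copies_def iso_copy_def)
    show "W \<in> sparse_copies K r I z' \<union> {W. W \<subseteq> N \<and> card W = card V}"
    proof (cases "W \<in> sparse_copies K r I z'")
      case False
      have "\<exists>q\<in>W. \<exists>u\<in>{fst (z p), fst a}. dist (fst (z q)) u \<le> r \<or> grid_cell r u = cell q"
      proof (cases "p \<in> W")
        case True
        then show ?thesis by (auto simp: cell_def)
      next
        case pW: False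
        then have same: "z' i = z i" if "i \<in> W" for i using that by (auto simp: z'_def)
        have "copy r W z'"
          using cp same unfolding copy_def rel_iso_def sees_def by simp
        then consider i j where "i \<in> W" "j \<in> I - W" "sees \<alpha> r z' i j"
          | i where "i \<in> W" "crowd r I z' i > K"
          using False WI by (force simp: sparse_copies_def iso_copies_def iso_copy_def not_le)
        then show ?thesis
        proof cases
          case (1 i j)
          \<comment> \<open>No vertex of \<open>W\<close> moves here, so an arc leaving
            \<open>W\<close> can only be new if it ends in the moved point.\<close>
          then have "j = p" using iso[of i j] same[of i] by (auto simp: z'_def sees_def split: if_splits)
          then have "fst a \<in> sector \<alpha> (fst (z i)) (snd (z i)) r"
            using 1 same[of i] by (simp add: sees_def z'_def)
          then show ?thesis using 1(1) sector_dist by blast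
        next
          case (2 i)
          \<comment> \<open>The occupation of a cell that the moved point does not enter can only
            decrease.\<close>
          have "grid_cell r (fst a) = cell i"
          proof (rule ccontr)
            assume "grid_cell r (fst a) \<noteq> cell i"
            then have "{j \<in> I. grid_cell r (fst (z' j)) = grid_cell r (fst (z' i))}
                \<subseteq> {j \<in> I. grid_cell r (fst (z j)) = grid_cell r (fst (z i))}"
              using same[OF 2(1)] by (auto simp: z'_def cell_def)
            then have "crowd r I z' i \<le> crowd r I z i"
              unfolding crowd_def using fin by (intro card_mono) auto
            then show False using cr[OF 2(1)] 2(2) by simp
          qed
          then show ?thesis using 2(1) by blast
        qed
      qed
      then obtain q u where q: "q \<in> W" and u: "u \<in> {fst (z p), fst a}"
        and qu: "dist (fst (z q)) u \<le> r \<or> grid_cell r u = cell q" by blast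
      have "W \<subseteq> N"
      proof
        fix i assume i: "i \<in> W"
        have d: "dist (fst (z i)) (fst (z q)) \<le> of_int (int D) * r"
          by (rule copy_dist[OF cp i q r])
        have "cell i \<in> cell_box m (grid_cell r u)"
          using qu
        proof
          assume "dist (fst (z q)) u \<le> r"
          then have "dist (fst (z i)) u \<le> of_int m * r"
            using d dist_triangle[of "fst (z i)" u "fst (z q)"] by (simp add: m_def algebra_simps)
          then show ?thesis unfolding cell_def by (rule grid_cell_in_box[OF r])
        next
          assume e: "grid_cell r u = cell q"
          have "dist (fst (z i)) (fst (z q)) \<le> of_int m * r"
            using d r by (simp add: m_def algebra_simps)
          then show ?thesis unfolding e unfolding cell_def by (rule grid_cell_in_box[OF r])
        qed
        then have "cell i \<in> B" using u by (auto simp: B_def cell_def)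
        then show "i \<in> N" using cr[OF i] i WI by (auto simp: N_def)
      qed
      then show ?thesis using WI by blast
    qed blast
  qed
  have "card (sparse_copies K r I z) \<le> card (sparse_copies K r I z' \<union> {W. W \<subseteq> N \<and> card W = card V})"
    using sub finN fin by (intro card_mono) (auto simp: finite_sparse_copies)
  also have "\<dots> \<le> card (sparse_copies K r I z') + card {W. W \<subseteq> N \<and> card W = card V}"
    by (rule card_Un_le)
  also have "card {W. W \<subseteq> N \<and> card W = card V} = card N choose card V"
    using finN by (rule n_subsets)
  also have "\<dots> \<le> card N ^ card V" by (rule binomial_le_power)
  also have "\<dots> \<le> diff_bound K"
    unfolding diff_bound_def using cardN by (rule power_mono) simp
  finally show ?thesis unfolding z'_def by (simp only: add_left_mono)
qed

text \<open>The other direction comes from moving \<open>p\<close> back to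
  \<open>z p\<close>.\<close>

lemma sparse_copies_bounded_diff:
  assumes "finite I" "p \<in> I" "r > 0"
  shows "\<bar>real (card (sparse_copies K r I (z(p := a)))) - real (card (sparse_copies K r I z))\<bar> \<le> real (diff_bound K)"
  using sparse_copies_update_subset[OF assms, of K z a]
    sparse_copies_update_subset[OF assms, of K "z(p := a)" "z p"] by simp

lemma sparse_copies_eq:
  assumes "\<And>i. i \<in> I \<Longrightarrow> crowd r I z i \<le> K"
  shows "sparse_copies K r I z = iso_copies r I z"
  using assms by (auto simp: sparse_copies_def iso_copies_def)

end

section \<open>Crowded cells are unlikely\<close>

text \<open>Restricting a bijection to \<open>W\<close> turns the existential quantifier into one
  over the finite set \<open>PiE W (\<lambda>_. V)\<close>.\<close>

lemma pred_rel_iso: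
  assumes "finite W" "finite V"
    and [measurable]: "\<And>i j. i \<in> W \<Longrightarrow> j \<in> W \<Longrightarrow> Measurable.pred M (\<lambda>\<omega>. R \<omega> i j)"
  shows "Measurable.pred M (\<lambda>\<omega>. rel_iso V E W (R \<omega>))"
proof -
  have eq: "rel_iso V E W (R \<omega>) \<longleftrightarrow> (\<exists>g\<in>PiE W (\<lambda>_. V). bij_betw g W V \<and> (\<forall>i\<in>W. \<forall>j\<in>W. R \<omega> i j \<longleftrightarrow> E (g i) (g j)))" for \<omega>
  proof
    assume "rel_iso V E W (R \<omega>)"
    then obtain g where g: "bij_betw g W V" "\<forall>i\<in>W. \<forall>j\<in>W. R \<omega> i j \<longleftrightarrow> E (g i) (g j)"
      by (auto simp: rel_iso_def)
    have "bij_betw (restrict g W) W V" using g(1) by (simp cong: bij_betw_cong)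
    moreover have "restrict g W \<in> PiE W (\<lambda>_. V)" using g(1) by (auto simp: bij_betw_def)
    ultimately show "\<exists>g\<in>PiE W (\<lambda>_. V). bij_betw g W V \<and> (\<forall>i\<in>W. \<forall>j\<in>W. R \<omega> i j \<longleftrightarrow> E (g i) (g j))"
      using g(2) by (intro bexI[of _ "restrict g W"]) auto
  qed (auto simp: rel_iso_def)
  have "finite (PiE W (\<lambda>_. V))" using assms by (intro finite_PiE)
  with assms(1) show ?thesis unfolding eq by (intro pred_intros_finite pred_intros_logic) auto
qed

lemma borel_measurable_vec_nth [measurable (raw)]:
  fixes x :: "'a \<Rightarrow> real^'n"
  assumes "x \<in> borel_measurable M"
  shows "(\<lambda>\<omega>. x \<omega> $ i) \<in> borel_measurable M"
  using assms by (rule borel_measurable_continuous_on[rotated]) (intro continuous_intros)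

lemma pred_grid_cell_eq [measurable (raw)]:
  assumes [measurable]: "x \<in> borel_measurable M" "y \<in> borel_measurable M"
  shows "Measurable.pred M (\<lambda>\<omega>. grid_cell r (x \<omega>) = grid_cell r (y \<omega>))"
proof -
  have pred_eq: "Measurable.pred M (\<lambda>\<omega>. u \<omega> = v \<omega>)"
    if [measurable]: "u \<in> borel_measurable M" "v \<in> borel_measurable M" for u v :: "'a \<Rightarrow> real"
    by measurable
  have *: "grid_cell r a = grid_cell r b \<longleftrightarrow> real_of_int \<lfloor>a $ 1 / r\<rfloor> = real_of_int \<lfloor>b $ 1 / r\<rfloor> \<and>
      real_of_int \<lfloor>a $ 2 / r\<rfloor> = real_of_int \<lfloor>b $ 2 / r\<rfloor>" for a b
    by (simp add: grid_cell_def)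
  show ?thesis unfolding * by (intro pred_intros_logic pred_eq) measurable
qed

section \<open>Law of a marked point\<close>

definition angle_law :: "real measure" where
  "angle_law = density lborel (\<lambda>y. ennreal (indicator {0..<2*pi} y / (2*pi)))"

lemma sets_angle_law [measurable_cong, simp]: "sets angle_law = sets borel"
  by (simp add: angle_law_def)

lemma space_angle_law [simp]: "space angle_law = UNIV"
  by (simp add: angle_law_def)

text \<open>The angles of the model live on the half-open interval, whereas \<open>phi\<close>
  integrates over the closed one; the endpoint is a null set.\<close>

lemma nn_integral_angle_law:
  assumes [measurable]: "g \<in> borel_measurable borel"
  shows "(\<integral>\<^sup>+y. g y \<partial>angle_law) = (\<integral>\<^sup>+y. ennreal (indicator {0..2*pi} y / (2*pi)) * g y \<partial>lborel)"
proof -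
  have "(\<integral>\<^sup>+y. g y \<partial>angle_law) = (\<integral>\<^sup>+y. ennreal (indicator {0..<2*pi} y / (2*pi)) * g y \<partial>lborel)"
    unfolding angle_law_def by (rule nn_integral_density) measurable
  also have "\<dots> = (\<integral>\<^sup>+y. ennreal (indicator {0..2*pi} y / (2*pi)) * g y \<partial>lborel)"
    by (rule nn_integral_cong_AE, rule eventually_mono[OF AE_lborel_singleton[of "2*pi"]])
       (auto simp: indicator_def)
  finally show ?thesis .
qed

lemma prob_space_angle_law: "prob_space angle_law"
proof
  have "emeasure angle_law (space angle_law) = (\<integral>\<^sup>+y. 1 \<partial>angle_law)" by simp
  also have "\<dots> = (\<integral>\<^sup>+y. ennreal (1 / (2*pi)) * indicator {0..2*pi} y \<partial>lborel)"
    by (subst nn_integral_angle_law) (auto intro!: nn_integral_cong simp: indicator_def)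
  also have "\<dots> = 1"
    by (subst nn_integral_cmult_indicator) (auto simp flip: ennreal_mult ennreal_1)
  finally show "emeasure angle_law (space angle_law) = 1" .
qed

locale sector_density =
  fixes f :: "real^2 \<Rightarrow> real" and B :: real
  assumes f_measurable [measurable]: "f \<in> borel_measurable borel"
    and f_nonneg: "\<And>x. 0 \<le> f x" and f_le: "\<And>x. f x \<le> B"
    and prob_f: "prob_space (density lborel (\<lambda>x. ennreal (f x)))"
begin

definition point_law :: "(real^2) measure" where
  "point_law = density lborel (\<lambda>x. ennreal (f x))"

definition mark_law :: "((real^2) \<times> real) measure" where
  "mark_law = point_law \<Otimes>\<^sub>M angle_law"

abbreviation marks :: "'i set \<Rightarrow> ('i \<Rightarrow> (real^2) \<times> real) measure" where
  "marks I \<equiv> PiM I (\<lambda>_. mark_law)"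

lemma sets_point_law [measurable_cong, simp]: "sets point_law = sets borel"
  by (simp add: point_law_def)

lemma space_point_law [simp]: "space point_law = UNIV"
  by (simp add: point_law_def)

lemma sets_mark_law [measurable_cong]: "sets mark_law = sets (borel \<Otimes>\<^sub>M borel)"
  unfolding mark_law_def by (rule sets_pair_measure_cong) simp_all

lemma space_mark_law [simp]: "space mark_law = UNIV"
  by (simp add: mark_law_def space_pair_measure)

sublocale point: prob_space point_law
  unfolding point_law_def by (rule prob_f)

sublocale angle: prob_space angle_law
  by (rule prob_space_angle_law)

sublocale pa: pair_prob_space point_law angle_law ..

sublocale mark: prob_space mark_law
  unfolding mark_law_def by (rule pa.prob_space_axioms)

lemma B_nonneg: "0 \<le> B"
  using f_nonneg f_le order_trans by blast

lemma nn_integral_point_law: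
  assumes "g \<in> borel_measurable borel"
  shows "(\<integral>\<^sup>+x. g x \<partial>point_law) = (\<integral>\<^sup>+x. ennreal (f x) * g x \<partial>lborel)"
  unfolding point_law_def using assms by (intro nn_integral_density) simp_all

lemma emeasure_mark_law_fst:
  assumes "A \<in> sets borel"
  shows "emeasure mark_law {w. fst w \<in> A} = emeasure point_law A"
proof -
  have "{w :: (real^2) \<times> real. fst w \<in> A} = A \<times> UNIV" by auto
  then show ?thesis
    using assms angle.emeasure_space_1 unfolding mark_law_def
    by (simp add: angle.emeasure_pair_measure_Times)
qed

lemma emeasure_point_law_cell_le:
  assumes "r > 0"
  shows "emeasure point_law {x. grid_cell r x = c} \<le> ennreal (B * r\<^sup>2)"
proof -
  obtain a b where c: "c = (a, b)" by (cases c)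
  let ?lo = "vector [of_int a * r, of_int b * r] :: real^2" and ?hi = "vector [of_int a * r + r, of_int b * r + r] :: real^2"
  let ?C = "{x. grid_cell r x = c}"
  have sub: "?C \<subseteq> cbox ?lo ?hi"
    using assms by (auto simp: c grid_cell_def mem_box_cart forall_2 floor_eq_iff field_simps)
  have [measurable]: "?C \<in> sets borel"
  proof -
    have "?C = {x. real_of_int \<lfloor>x $ 1 / r\<rfloor> = of_int a \<and> real_of_int \<lfloor>x $ 2 / r\<rfloor> = of_int b}"
      by (auto simp: grid_cell_def c)
    also have "\<dots> \<in> sets borel" by measurable
    finally show ?thesis .
  qed
  have "emeasure lborel (cbox ?lo ?hi) = ennreal (r\<^sup>2)"
    using assms by (subst emeasure_lborel_cbox_eq)
      (auto simp: Basis_vec_def UNIV_2 axis_eq_axis inner_axis power2_eq_square)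
  have "emeasure point_law ?C = (\<integral>\<^sup>+x. ennreal (f x) * indicator ?C x \<partial>lborel)"
    unfolding point_law_def by (subst emeasure_density) auto
  also have "\<dots> \<le> (\<integral>\<^sup>+x. ennreal B * indicator (cbox ?lo ?hi) x \<partial>lborel)"
    using sub f_le by (intro nn_integral_mono mult_mono) (auto simp: indicator_def intro: ennreal_leI)
  also have "\<dots> = ennreal (B * r\<^sup>2)"
    using \<open>emeasure lborel (cbox ?lo ?hi) = ennreal (r\<^sup>2)\<close> B_nonneg
    by (simp add: nn_integral_cmult_indicator ennreal_mult)
  finally show ?thesis .
qed

section \<open>Chernoff bound for the occupation of a cell\<close>

lemma crowd_eq_sum:
  assumes "finite I"
  shows "crowd r I z i = (\<Sum>j\<in>I. if grid_cell r (fst (z j)) = grid_cell r (fst (z i)) then 1 else 0)"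
  using assms by (simp add: crowd_def sum.If_cases Int_def)

lemma pred_crowd:
  assumes "finite I" "i \<in> I"
  shows "Measurable.pred (marks I) (\<lambda>z. crowd r I z i \<le> K)"
proof -
  have "crowd r I z i \<le> K \<longleftrightarrow>
    (\<Sum>j\<in>I. if grid_cell r (fst (z j)) = grid_cell r (fst (z i)) then 1 else 0) \<le> real K" for z
  proof -
    have "crowd r I z i \<le> K \<longleftrightarrow> real (crowd r I z i) \<le> real K" by simp
    also have "real (crowd r I z i) = (\<Sum>j\<in>I. if grid_cell r (fst (z j)) = grid_cell r (fst (z i)) then 1 else 0)"
      unfolding crowd_eq_sum[OF assms(1)] of_nat_sum by (intro sum.cong) auto
    finally show ?thesis .
  qed
  moreover have "Measurable.pred (marks I) (\<lambda>z.
    (\<Sum>j\<in>I. if grid_cell r (fst (z j)) = grid_cell r (fst (z i)) then 1 else 0) \<le> real K)"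
    using assms by measurable
  ultimately show ?thesis by simp
qed

lemma borel_measurable_two_power_crowd:
  assumes "finite I" "i \<in> I"
  shows "(\<lambda>z. ennreal (2 ^ crowd r I z i)) \<in> borel_measurable (marks I)"
proof -
  have "(\<lambda>z. ennreal (2 ^ crowd r I z i)) = (\<lambda>z. \<Prod>j\<in>I. ennreal (if grid_cell r (fst (z j)) = grid_cell r (fst (z i)) then 2 else 1))"
    using assms(1) by (auto simp: crowd_eq_sum power_sum prod_ennreal intro!: arg_cong[where f=ennreal] prod.cong)
  then show ?thesis using assms(2) by simp
qed

text \<open>Fix the mark of \<open>i\<close>. Then \<open>2 ^ crowd\<close> is \<open>2\<close>, the
  contribution of \<open>i\<close> itself, times independent factors that equal \<open>2\<close> if
  another point falls into the cell of \<open>i\<close> and \<open>1\<close> otherwise. Each factor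
  has mean at most \<open>1 + B * r\<^sup>2\<close>, which is at most
  \<open>exp (B * r\<^sup>2)\<close>.\<close>

lemma nn_integral_crowd_le:
  fixes I :: "'a set"
  assumes "finite I" and "i \<in> I" and "r > 0"
  shows "(\<integral>\<^sup>+z. ennreal (2 ^ crowd r I z i) \<partial>marks I) \<le> ennreal (2 * exp (real (card I) * (B * r\<^sup>2)))"
proof -
  interpret P: product_sigma_finite "\<lambda>_. mark_law" ..
  define J where "J = I - {i}"
  have J: "finite J" "i \<notin> J" "I = insert i J" using assms by (auto simp: J_def)
  define e where "e z j = (if grid_cell r (fst (z j)) = grid_cell r (fst (z i)) then 2 else (1::ennreal))" for z :: "'a \<Rightarrow> (real^2) \<times> real" and j
  have crowd: "ennreal (2 ^ crowd r I z i) = 2 * (\<Prod>j\<in>J. e z j)" for z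
  proof -
    have "crowd r I z i = 1 + (\<Sum>j\<in>J. if grid_cell r (fst (z j)) = grid_cell r (fst (z i)) then 1 else 0)"
      using J(1,2) by (subst crowd_eq_sum[OF assms(1)], subst J(3)) simp
    then have "(2::ennreal) ^ crowd r I z i = 2 * (\<Prod>j\<in>J. 2 ^ (if grid_cell r (fst (z j)) = grid_cell r (fst (z i)) then 1 else 0))"
      by (simp add: power_add power_sum)
    also have "\<dots> = 2 * (\<Prod>j\<in>J. e z j)"
      by (intro arg_cong2[where f="(*)"] prod.cong refl) (simp add: e_def)
    finally show ?thesis by (simp flip: ennreal_power)
  qed
  note borel_measurable_two_power_crowd[OF assms(1,2), measurable]
  have "(\<integral>\<^sup>+z. ennreal (2 ^ crowd r I z i) \<partial>marks I)
     = (\<integral>\<^sup>+y. (\<integral>\<^sup>+x. ennreal (2 ^ crowd r I (x(i := y)) i) \<partial>marks J) \<partial>mark_law)"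
    unfolding J(3) by (rule P.product_nn_integral_insert_rev[OF J(1,2)]) (unfold J(3)[symmetric], measurable)
  also have "\<dots> = (\<integral>\<^sup>+y. (\<integral>\<^sup>+x. 2 * (\<Prod>j\<in>J. (if grid_cell r (fst (x j)) = grid_cell r (fst y) then 2 else (1::ennreal))) \<partial>marks J) \<partial>mark_law)"
    using J(2) unfolding crowd
    by (intro nn_integral_cong arg_cong2[where f="(*)"] prod.cong refl) (auto simp: e_def)
  also have "\<dots> = (\<integral>\<^sup>+y. 2 * (\<integral>\<^sup>+x. (\<Prod>j\<in>J. (if grid_cell r (fst (x j)) = grid_cell r (fst y) then 2 else (1::ennreal))) \<partial>marks J) \<partial>mark_law)"
    by (intro nn_integral_cong nn_integral_cmult) measurable
  also have "\<dots> = (\<integral>\<^sup>+y. 2 * (\<Prod>j\<in>J. \<integral>\<^sup>+x. (if grid_cell r (fst x) = grid_cell r (fst y) then 2 else (1::ennreal)) \<partial>mark_law) \<partial>mark_law)"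
    by (intro nn_integral_cong arg_cong2[where f="(*)"] refl P.product_nn_integral_prod J(1)) measurable
  also have "\<dots> \<le> (\<integral>\<^sup>+y. 2 * (\<Prod>j\<in>J. ennreal (1 + B * r\<^sup>2)) \<partial>mark_law)"
  proof (intro nn_integral_mono mult_left_mono prod_mono_ennreal)
    fix y :: "(real^2) \<times> real"
    have C: "{x. grid_cell r x = grid_cell r (fst y)} \<in> sets borel"
    proof -
      have "Measurable.pred borel (\<lambda>x. grid_cell r x = grid_cell r (fst y))" by measurable
      then show ?thesis by (simp add: pred_def)
    qed
    then have C': "{x \<in> space mark_law. grid_cell r (fst x) = grid_cell r (fst y)} \<in> sets mark_law" by measurable
    have "(\<integral>\<^sup>+x. (if grid_cell r (fst x) = grid_cell r (fst y) then 2 else (1::ennreal)) \<partial>mark_law)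
       = (\<integral>\<^sup>+x. 1 + indicator {x. grid_cell r (fst x) = grid_cell r (fst y)} x \<partial>mark_law)"
      by (intro nn_integral_cong) (auto simp: indicator_def)
    also have "\<dots> = 1 + emeasure mark_law {x. grid_cell r (fst x) = grid_cell r (fst y)}"
      using C' mark.emeasure_space_1 by (subst nn_integral_add) auto
    also have "\<dots> = 1 + emeasure point_law {x. grid_cell r x = grid_cell r (fst y)}"
      using emeasure_mark_law_fst[OF C] by simp
    also have "\<dots> \<le> 1 + ennreal (B * r\<^sup>2)"
      using assms by (intro add_left_mono emeasure_point_law_cell_le)
    also have "\<dots> = ennreal (1 + B * r\<^sup>2)" using B_nonneg by (simp add: ennreal_plus)
    finally show "(\<integral>\<^sup>+x. (if grid_cell r (fst x) = grid_cell r (fst y) then 2 else (1::ennreal)) \<partial>mark_law) \<le> ennreal (1 + B * r\<^sup>2)" .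
  qed auto
  also have "\<dots> = ennreal (2 * (1 + B * r\<^sup>2) ^ card J)"
    using B_nonneg mark.emeasure_space_1 by (simp add: ennreal_power ennreal_mult del: ennreal_plus)
  also have "\<dots> \<le> ennreal (2 * exp (real (card I) * (B * r\<^sup>2)))"
  proof (intro ennreal_leI mult_left_mono)
    have "(1 + B * r\<^sup>2) ^ card J \<le> exp (B * r\<^sup>2) ^ card J"
      using B_nonneg by (intro power_mono) auto
    also have "\<dots> = exp (real (card J) * (B * r\<^sup>2))" by (simp add: exp_of_nat_mult)
    also have "\<dots> \<le> exp (real (card I) * (B * r\<^sup>2))"
      using J B_nonneg by (auto intro!: mult_right_mono)
    finally show "(1 + B * r\<^sup>2) ^ card J \<le> exp (real (card I) * (B * r\<^sup>2))" .
  qed simp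
  finally show ?thesis .
qed

text \<open>Exceeding \<open>K\<close> means reaching \<open>K + 1\<close>, so Markov's inequality
  is applied at \<open>2 ^ (K + 1)\<close>; this cancels the factor \<open>2\<close> of the moment
  bound.\<close>

lemma prob_crowd_le:
  assumes "finite I" "i \<in> I" "r > 0"
  shows "measure (marks I) {z \<in> space (marks I). \<not> crowd r I z i \<le> K}
    \<le> exp (real (card I) * (B * r\<^sup>2)) / 2 ^ K"
proof -
  let ?P = "marks I"
  interpret P: prob_space ?P by (rule prob_space_PiM) (rule mark.prob_space_axioms)
  note borel_measurable_two_power_crowd[OF assms(1,2), measurable]
  have "emeasure ?P {z \<in> space ?P. \<not> crowd r I z i \<le> K}
     \<le> emeasure ?P {z \<in> space ?P. 1 \<le> ennreal (1 / 2 ^ (K + 1)) * ennreal (2 ^ crowd r I z i)}"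
  proof (rule emeasure_mono)
    show "{z \<in> space ?P. \<not> crowd r I z i \<le> K} \<subseteq> {z \<in> space ?P. 1 \<le> ennreal (1 / 2 ^ (K + 1)) * ennreal (2 ^ crowd r I z i)}"
    proof (intro subsetI CollectI conjI; clarsimp)
      fix z assume "\<not> crowd r I z i \<le> K"
      then have "(2::real) ^ (K + 1) \<le> 2 ^ crowd r I z i" by (intro power_increasing) auto
      then show "1 \<le> ennreal (1 / (2 * 2 ^ K)) * ennreal (2 ^ crowd r I z i)"
        by (simp flip: ennreal_mult ennreal_1 add: field_simps)
    qed
  qed measurable
  also have "\<dots> \<le> ennreal (1 / 2 ^ (K + 1)) * (\<integral>\<^sup>+z. ennreal (2 ^ crowd r I z i) \<partial>?P)"
    using nn_integral_Markov_inequality[where u="\<lambda>z. ennreal (2 ^ crowd r I z i)" and c="ennreal (1 / 2 ^ (K + 1))" and A="space ?P" and M="?P"]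
    by simp
  also have "\<dots> \<le> ennreal (1 / 2 ^ (K + 1)) * ennreal (2 * exp (real (card I) * (B * r\<^sup>2)))"
    by (intro mult_left_mono nn_integral_crowd_le assms) simp
  also have "\<dots> = ennreal (exp (real (card I) * (B * r\<^sup>2)) / 2 ^ K)"
    by (simp flip: ennreal_mult)
  finally show ?thesis by (simp add: P.emeasure_eq_measure)
qed

end

section \<open>Expected number of isolated copies\<close>

lemma ball_commute: "(\<forall>i\<in>A. \<forall>j\<in>B. P i j) \<longleftrightarrow> (\<forall>j\<in>B. \<forall>i\<in>A. P i j)"
  by blast

lemma indicator_Collect_measurable:
  assumes [measurable]: "Measurable.pred M P"
  shows "(\<lambda>z. indicator {z. P z} z :: ennreal) \<in> borel_measurable M"
proof -
  have "(\<lambda>z. indicator {z. P z} z :: ennreal) = (\<lambda>z. if P z then 1 else 0)"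
    by (simp add: indicator_def fun_eq_iff)
  then show ?thesis by simp
qed

lemma nn_integral_indicator_Collect:
  assumes [measurable]: "Measurable.pred M P"
  shows "(\<integral>\<^sup>+z. indicator {z. P z} z \<partial>M) = emeasure M {z \<in> space M. P z}"
proof -
  have "(\<integral>\<^sup>+z. indicator {z. P z} z \<partial>M) = (\<integral>\<^sup>+z. indicator {z \<in> space M. P z} z \<partial>M)"
    by (rule nn_integral_cong) (simp add: indicator_def)
  also have "\<dots> = emeasure M {z \<in> space M. P z}"
    by (rule nn_integral_indicator) measurable
  finally show ?thesis .
qed

lemma pred_sees [measurable (raw)]:
  assumes "r > 0"
    and [measurable]: "(\<lambda>\<omega>. Z \<omega> i) \<in> M \<rightarrow>\<^sub>M borel \<Otimes>\<^sub>M borel" "(\<lambda>\<omega>. Z \<omega> j) \<in> M \<rightarrow>\<^sub>M borel \<Otimes>\<^sub>M borel"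
  shows "Measurable.pred M (\<lambda>\<omega>. sees \<alpha> r (Z \<omega>) i j)"
  unfolding sees_def using assms(1) by measurable

definition reach :: "real \<Rightarrow> real \<Rightarrow> 'i set \<Rightarrow> ('i \<Rightarrow> (real^2) \<times> real) \<Rightarrow> (real^2) set" where
  "reach \<alpha> r W z = (\<Union>i\<in>W. sector \<alpha> (fst (z i)) (snd (z i)) r)"

lemma reach_measurable [measurable]: "finite W \<Longrightarrow> reach \<alpha> r W z \<in> sets borel"
  unfolding reach_def by (intro sets.finite_UN) auto

lemma pred_reach:
  assumes "r > 0" "finite W"
    and [measurable]: "\<And>i. i \<in> W \<Longrightarrow> (\<lambda>\<omega>. Z \<omega> i) \<in> M \<rightarrow>\<^sub>M borel \<Otimes>\<^sub>M borel" "w \<in> borel_measurable M"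
  shows "Measurable.pred M (\<lambda>\<omega>. w \<omega> \<in> reach \<alpha> r W (Z \<omega>))"
proof -
  have "Measurable.pred M (\<lambda>\<omega>. \<exists>i\<in>W. w \<omega> \<in> sector \<alpha> (fst (Z \<omega> i)) (snd (Z \<omega> i)) r)"
    using assms(1,2) by measurable
  then show ?thesis by (simp add: reach_def)
qed

text \<open>The random set is a section of a jointly measurable set, so its measure is measurable.
  \<open>Q\<close> is the law of a point in the conditional isolation probability and Lebesgue
  measure in the limit.\<close>

lemma borel_measurable_measure_reach:
  assumes Q: "sigma_finite_measure Q" "sets Q = sets borel" and "r > 0" "finite W"
    and [measurable]: "\<And>i. i \<in> W \<Longrightarrow> (\<lambda>\<omega>. Z \<omega> i) \<in> M \<rightarrow>\<^sub>M borel \<Otimes>\<^sub>M borel"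
  shows "(\<lambda>\<omega>. measure Q (reach \<alpha> r W (Z \<omega>))) \<in> borel_measurable M"
proof -
  interpret Q: sigma_finite_measure Q by fact
  let ?S = "{p \<in> space (M \<Otimes>\<^sub>M Q). snd p \<in> reach \<alpha> r W (Z (fst p))}"
  have spQ: "space Q = UNIV" using sets_eq_imp_space_eq[OF Q(2)] by simp
  have "snd \<in> M \<Otimes>\<^sub>M Q \<rightarrow>\<^sub>M borel" using Q(2) measurable_snd by (simp cong: measurable_cong_sets)
  then have "?S \<in> sets (M \<Otimes>\<^sub>M Q)"
    using assms(3,4) by (intro predE pred_reach measurable_compose[OF measurable_fst assms(5)])
  then have "(\<lambda>\<omega>. emeasure Q (Pair \<omega> -` ?S)) \<in> borel_measurable M"
    by (rule Q.measurable_emeasure_Pair)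
  moreover have "Pair \<omega> -` ?S = reach \<alpha> r W (Z \<omega>)" if "\<omega> \<in> space M" for \<omega>
    using that by (simp add: space_pair_measure spQ vimage_def)
  ultimately have "(\<lambda>\<omega>. emeasure Q (reach \<alpha> r W (Z \<omega>))) \<in> borel_measurable M"
    by (simp cong: measurable_cong)
  then show ?thesis unfolding measure_def by measurable
qed

lemma (in pattern) pred_copy:
  assumes "r > 0" "finite W"
    and "\<And>i. i \<in> W \<Longrightarrow> (\<lambda>\<omega>. Z \<omega> i) \<in> M \<rightarrow>\<^sub>M borel \<Otimes>\<^sub>M borel"
  shows "Measurable.pred M (\<lambda>\<omega>. copy r W (Z \<omega>))"
  unfolding copy_def using assms finite_V
  by (intro pred_rel_iso pred_intros_logic pred_sees) auto

locale sector_process = pattern \<alpha> V E D + sector_density f B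
  for \<alpha> :: real and V :: "'v set" and E D f B
begin

lemma component_mark [measurable]:
  "i \<in> I \<Longrightarrow> (\<lambda>z. z i) \<in> marks I \<rightarrow>\<^sub>M borel \<Otimes>\<^sub>M borel"
  using measurable_component_singleton[of i I "\<lambda>_. mark_law"]
  by (simp cong: measurable_cong_sets add: sets_mark_law)

lemma fst_mark_law [measurable]: "fst \<in> borel_measurable mark_law"
proof -
  have "fst \<in> (borel \<Otimes>\<^sub>M borel :: ((real^2) \<times> real) measure) \<rightarrow>\<^sub>M borel" by (rule measurable_fst)
  then show ?thesis by (simp cong: measurable_cong_sets add: sets_mark_law)
qed

lemma pred_iso_copy:
  assumes "r > 0" "finite I" "W \<subseteq> I"
  shows "Measurable.pred (marks I) (\<lambda>z. iso_copy r I W z)"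
proof -
  have "finite W" using assms(3,2) by (rule finite_subset)
  then show ?thesis
    unfolding iso_copy_def using assms
    by (intro pred_intros_logic pred_intros_finite pred_copy pred_sees component_mark) auto
qed

text \<open>
  The conditional probability that \<open>W\<close> is an isolated copy, given the marks of its points, when
  there are \<open>l\<close> further points.
\<close>

definition copy_weight :: "real \<Rightarrow> nat \<Rightarrow> 'i set \<Rightarrow> ('i \<Rightarrow> (real^2) \<times> real) \<Rightarrow> real" where
  "copy_weight r l W z = (if copy r W z then (1 - measure point_law (reach \<alpha> r W z)) ^ l else 0)"

text \<open>Fubini with the marks on \<open>W\<close> outside. Once these are fixed, whether
  \<open>W\<close> is a copy is decided, and isolation says that each remaining point independently
  avoids the reach of \<open>W\<close>; the inclinations of the remaining points have no
  influence.\<close>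

lemma emeasure_iso_copy:
  fixes I :: "'i set"
  assumes r: "r > 0" and fin: "finite I" and W: "W \<subseteq> I"
  shows "emeasure (marks I) {z \<in> space (marks I). iso_copy r I W z}
    = (\<integral>\<^sup>+x. ennreal (copy_weight r (card I - card W) W x) \<partial>marks W)"
proof -
  interpret P: product_sigma_finite "\<lambda>_. mark_law" ..
  define J where "J = I - W"
  have finW: "finite W" using W fin by (rule finite_subset)
  have J: "W \<inter> J = {}" "finite J" "W \<union> J = I"
    using fin W by (auto simp: J_def)
  have "emeasure (marks I) {z \<in> space (marks I). iso_copy r I W z}
     = (\<integral>\<^sup>+z. indicator {z. iso_copy r I W z} z \<partial>marks I)"
    by (rule nn_integral_indicator_Collect[OF pred_iso_copy[OF r fin W], symmetric])
  also have "\<dots> = (\<integral>\<^sup>+x. \<integral>\<^sup>+y. indicator {z. iso_copy r I W z} (merge W J (x, y)) \<partial>marks J \<partial>marks W)"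
    using P.product_nn_integral_fold[OF J(1) finW J(2), unfolded J(3),
        OF indicator_Collect_measurable[OF pred_iso_copy[OF r fin W]]] .
  also have "\<dots> = (\<integral>\<^sup>+x. ennreal (copy_weight r (card I - card W) W x) \<partial>marks W)"
  proof (rule nn_integral_cong)
    fix x :: "'i \<Rightarrow> (real^2) \<times> real"
    let ?R = "reach \<alpha> r W x"
    have m: "merge W J (x, y) i = x i" if "i \<in> W" for i and y :: "'i \<Rightarrow> (real^2) \<times> real"
      using that J by (simp add: merge_def)
    have m': "merge W J (x, y) j = y j" if "j \<in> J" for j and y :: "'i \<Rightarrow> (real^2) \<times> real"
      using that J by (auto simp: merge_def)
    have "copy r W (merge W J (x, y)) = copy r W x" for y
      unfolding copy_def rel_iso_def sees_def by (simp add: m)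
    moreover have "(\<forall>i\<in>W. \<forall>j\<in>J. \<not> sees \<alpha> r (merge W J (x, y)) i j) \<longleftrightarrow> (\<forall>j\<in>J. fst (y j) \<notin> ?R)" for y
    proof -
      have "(\<forall>i\<in>W. \<forall>j\<in>J. \<not> sees \<alpha> r (merge W J (x, y)) i j) \<longleftrightarrow>
          (\<forall>i\<in>W. \<forall>j\<in>J. fst (y j) \<notin> sector \<alpha> (fst (x i)) (snd (x i)) r)"
        by (intro ball_cong refl) (simp add: sees_def m m')
      also have "\<dots> \<longleftrightarrow> (\<forall>j\<in>J. fst (y j) \<notin> ?R)"
        by (subst ball_commute) (simp add: reach_def)
      finally show ?thesis .
    qed
    ultimately have iso: "iso_copy r I W (merge W J (x, y)) \<longleftrightarrow> copy r W x \<and> (\<forall>j\<in>J. fst (y j) \<notin> ?R)" for y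
      unfolding iso_copy_def J_def[symmetric] by simp
    have R [measurable]: "?R \<in> sets borel" using finW by simp
    have one: "(\<integral>\<^sup>+w. indicator (- ?R) (fst w) \<partial>mark_law) = ennreal (1 - measure point_law ?R)"
    proof -
      have "(\<integral>\<^sup>+w. indicator (- ?R) (fst w) \<partial>mark_law) = (\<integral>\<^sup>+w. indicator {w. fst w \<in> - ?R} w \<partial>mark_law)"
        by (intro nn_integral_cong) (auto simp: indicator_def)
      also have "\<dots> = emeasure mark_law {w. fst w \<in> - ?R}"
      proof (rule nn_integral_indicator)
        show "{w. fst w \<in> - ?R} \<in> sets mark_law"
          using measurable_sets[OF fst_mark_law, of "- ?R"] finW by (simp add: vimage_def)
      qed
      also have "\<dots> = emeasure point_law (- ?R)" by (rule emeasure_mark_law_fst) simp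
      also have "\<dots> = ennreal (1 - measure point_law ?R)"
        using point.prob_compl[of ?R] by (simp add: point.emeasure_eq_measure Compl_eq_Diff_UNIV)
      finally show ?thesis .
    qed
    have prod_ind: "(\<Prod>j\<in>J. indicator (- ?R) (fst (y j)) :: ennreal) = (if \<forall>j\<in>J. fst (y j) \<notin> ?R then 1 else 0)"
      for y :: "'i \<Rightarrow> (real^2) \<times> real"
    proof (cases "\<forall>j\<in>J. fst (y j) \<notin> ?R")
      case False
      then obtain j where j: "j \<in> J" "fst (y j) \<in> ?R" by blast
      have "(\<Prod>j\<in>J. indicator (- ?R) (fst (y j)) :: ennreal) = 0"
        by (rule prod_zero[OF J(2)], rule bexI[OF _ j(1)]) (simp add: j(2))
      then show ?thesis using False by simp
    qed (simp add: prod.neutral)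
    show "(\<integral>\<^sup>+y. indicator {z. iso_copy r I W z} (merge W J (x, y)) \<partial>marks J)
       = ennreal (copy_weight r (card I - card W) W x)"
    proof (cases "copy r W x")
      case True
      have "(\<integral>\<^sup>+y. indicator {z. iso_copy r I W z} (merge W J (x, y)) \<partial>marks J)
        = (\<integral>\<^sup>+y. (\<Prod>j\<in>J. indicator (- ?R) (fst (y j))) \<partial>marks J)"
        using True by (intro nn_integral_cong) (simp add: prod_ind indicator_def[of "Collect _"] iso)
      also have "\<dots> = (\<Prod>j\<in>J. \<integral>\<^sup>+w. indicator (- ?R) (fst w) \<partial>mark_law)"
        by (rule P.product_nn_integral_prod[OF J(2)])
           (rule measurable_compose[OF fst_mark_law borel_measurable_indicator], use finW in simp)
      also have "\<dots> = ennreal ((1 - measure point_law ?R) ^ card J)"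
        unfolding one by (simp add: ennreal_power point.prob_le_1)
      also have "card J = card I - card W"
        unfolding J_def using finW W by (rule card_Diff_subset)
      finally show ?thesis using True by (simp add: copy_weight_def)
    next
      case False
      then show ?thesis by (simp add: iso copy_weight_def)
    qed
  qed
  finally show ?thesis .
qed

lemma copy_weight_measurable:
  assumes "r > 0" "finite W"
  shows "copy_weight r l W \<in> borel_measurable (marks W)"
proof -
  have [measurable]: "Measurable.pred (marks W) (\<lambda>z. copy r W z)"
    using assms by (intro pred_copy component_mark)
  have [measurable]: "(\<lambda>z. measure point_law (reach \<alpha> r W z)) \<in> borel_measurable (marks W)"
    using assms by (intro borel_measurable_measure_reach component_mark point.sigma_finite_measure_axioms sets_point_law)
  show ?thesis unfolding copy_weight_def by measurable
qed

section \<open>Exchangeability and the first moment\<close>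

lemma copy_weight_reindex:
  assumes "bij_betw \<sigma> W' W"
  shows "copy_weight r l W z = copy_weight r l W' (\<lambda>n\<in>W'. z (\<sigma> n))"
proof -
  have inj: "inj_on \<sigma> W'" and im: "\<sigma> ` W' = W" using assms by (auto simp: bij_betw_def)
  have "copy r W z \<longleftrightarrow> copy r W' (\<lambda>n\<in>W'. z (\<sigma> n))"
    unfolding copy_def
    by (rule rel_iso_reindex[OF assms]) (auto simp: sees_def inj_on_eq_iff[OF inj])
  moreover have "reach \<alpha> r W z = reach \<alpha> r W' (\<lambda>n\<in>W'. z (\<sigma> n))"
    unfolding reach_def im[symmetric] by simp
  ultimately show ?thesis by (simp add: copy_weight_def)
qed

text \<open>The marks are identically distributed, so only the number of vertices matters. This is
  why all \<open>k\<close>-subsets contribute equally to the mean.\<close>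

lemma nn_integral_copy_weight_reindex:
  assumes \<sigma>: "bij_betw \<sigma> W' W" and "finite W" "finite W'" "r > 0"
  shows "(\<integral>\<^sup>+x. ennreal (copy_weight r l W x) \<partial>marks W)
     = (\<integral>\<^sup>+x. ennreal (copy_weight r l W' x) \<partial>marks W')"
proof -
  have "distr (marks W) (marks W') (\<lambda>z. \<lambda>n\<in>W'. z (\<sigma> n)) = marks W'"
    using \<sigma> by (intro distr_PiM_reindex mark.prob_space_axioms) (auto simp: bij_betw_def)
  moreover have "(\<integral>\<^sup>+x. ennreal (copy_weight r l W' x) \<partial>distr (marks W) (marks W') (\<lambda>z. \<lambda>n\<in>W'. z (\<sigma> n)))
     = (\<integral>\<^sup>+z. ennreal (copy_weight r l W' (\<lambda>n\<in>W'. z (\<sigma> n))) \<partial>marks W)"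
  proof (rule nn_integral_distr)
    have "\<sigma> n \<in> W" if "n \<in> W'" for n using \<sigma> that by (auto simp: bij_betw_def)
    then show "(\<lambda>z. \<lambda>n\<in>W'. z (\<sigma> n)) \<in> marks W \<rightarrow>\<^sub>M marks W'"
      by (intro measurable_restrict measurable_component_singleton)
    show "(\<lambda>x. ennreal (copy_weight r l W' x)) \<in> borel_measurable
        (distr (marks W) (marks W') (\<lambda>z. \<lambda>n\<in>W'. z (\<sigma> n)))"
      using copy_weight_measurable[OF assms(4,3), of l] by simp
  qed
  ultimately show ?thesis by (simp add: copy_weight_reindex[OF \<sigma>])
qed

lemma iso_copies_measurable:
  assumes "r > 0" "finite I"
  shows "(\<lambda>z. real (card (iso_copies r I z))) \<in> borel_measurable (marks I)"
    and "(\<lambda>z. real (card (sparse_copies K r I z))) \<in> borel_measurable (marks I)"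
proof -
  let ?S = "{W. W \<subseteq> I \<and> card W = card V}"
  have fin: "finite ?S" using assms(2) by auto
  have [measurable]: "Measurable.pred (marks I) (\<lambda>z. iso_copy r I W z)" if "W \<in> ?S" for W
    using that assms by (intro pred_iso_copy) auto
  have [measurable]: "Measurable.pred (marks I) (\<lambda>z. \<forall>i\<in>W. crowd r I z i \<le> K)" if "W \<in> ?S" for W
    using that assms finite_subset[OF _ assms(2), of W] by (intro pred_intros_finite pred_crowd) auto
  have eq: "real (card {W \<in> ?S. P W}) = (\<Sum>W\<in>?S. if P W then 1 else 0)" for P
    using fin by (simp add: sum.If_cases Int_def)
  have "iso_copies r I z = {W \<in> ?S. iso_copy r I W z}" for z by (auto simp: iso_copies_def)
  then have 1: "real (card (iso_copies r I z)) = (\<Sum>W\<in>?S. if iso_copy r I W z then 1 else 0)" for z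
    by (simp only: eq)
  have "sparse_copies K r I z = {W \<in> ?S. iso_copy r I W z \<and> (\<forall>i\<in>W. crowd r I z i \<le> K)}" for z
    by (auto simp: iso_copies_def sparse_copies_def)
  then have 2: "real (card (sparse_copies K r I z)) = (\<Sum>W\<in>?S. if iso_copy r I W z \<and> (\<forall>i\<in>W. crowd r I z i \<le> K) then 1 else 0)" for z
    by (simp only: eq)
  show "(\<lambda>z. real (card (iso_copies r I z))) \<in> borel_measurable (marks I)"
    unfolding 1 by measurable
  show "(\<lambda>z. real (card (sparse_copies K r I z))) \<in> borel_measurable (marks I)"
    unfolding 2 by measurable
qed

lemma nn_integral_iso_copies:
  assumes r: "r > 0" and fin: "finite I"
  shows "(\<integral>\<^sup>+z. ennreal (real (card (iso_copies r I z))) \<partial>marks I)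
    = of_nat (card I choose card V) *
      (\<integral>\<^sup>+x. ennreal (copy_weight r (card I - card V) {1..card V} x) \<partial>marks {1..card V})"
proof -
  let ?S = "{W. W \<subseteq> I \<and> card W = card V}" and ?P = "marks I"
  have finS: "finite ?S" using fin by auto
  have [measurable]: "Measurable.pred ?P (\<lambda>z. iso_copy r I W z)" if "W \<in> ?S" for W
    using that assms by (intro pred_iso_copy) auto
  have "iso_copies r I z = {W \<in> ?S. iso_copy r I W z}" for z by (auto simp: iso_copies_def)
  then have "ennreal (real (card (iso_copies r I z))) = (\<Sum>W\<in>?S. indicator {z. iso_copy r I W z} z)" for z
    using finS by (simp add: sum.If_cases Int_def indicator_def flip: ennreal_of_nat_eq_real_of_nat)
  then have "(\<integral>\<^sup>+z. ennreal (real (card (iso_copies r I z))) \<partial>?P) = (\<Sum>W\<in>?S. \<integral>\<^sup>+z. indicator {z. iso_copy r I W z} z \<partial>?P)"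
    by (simp add: nn_integral_sum indicator_Collect_measurable)
  also have "\<dots> = (\<Sum>W\<in>?S. \<integral>\<^sup>+x. ennreal (copy_weight r (card I - card V) {1..card V} x) \<partial>marks {1..card V})"
  proof (rule sum.cong)
    fix W assume W: "W \<in> ?S"
    then have finW: "finite W" using finite_subset[OF _ fin] by simp
    obtain \<sigma> where "bij_betw \<sigma> {0..<card W} W" using ex_bij_betw_nat_finite[OF finW] by blast
    \<comment> \<open>The enumeration at hand starts at \<open>0\<close>, while \<open>phi\<close>
      numbers the vertices from \<open>1\<close>.\<close>
    moreover have "bij_betw (\<lambda>n. n - 1) {1..card W} {0..<card W}"
      by (rule bij_betwI[of _ _ _ Suc]) auto
    ultimately have bij: "bij_betw (\<sigma> \<circ> (\<lambda>n. n - 1)) {1..card V} W"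
      using W by (auto intro: bij_betw_trans)
    have "(\<integral>\<^sup>+z. indicator {z. iso_copy r I W z} z \<partial>?P) = emeasure ?P {z \<in> space ?P. iso_copy r I W z}"
      using W by (intro nn_integral_indicator_Collect) measurable
    also have "\<dots> = (\<integral>\<^sup>+x. ennreal (copy_weight r (card I - card W) W x) \<partial>marks W)"
      using W by (intro emeasure_iso_copy r fin) auto
    also have "\<dots> = (\<integral>\<^sup>+x. ennreal (copy_weight r (card I - card W) {1..card V} x) \<partial>marks {1..card V})"
      by (rule nn_integral_copy_weight_reindex[OF bij finW _ r]) simp
    finally show "(\<integral>\<^sup>+z. indicator {z. iso_copy r I W z} z \<partial>?P)
      = (\<integral>\<^sup>+x. ennreal (copy_weight r (card I - card V) {1..card V} x) \<partial>marks {1..card V})"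
      using W by simp
  qed simp
  also have "\<dots> = of_nat (card I choose card V) *
      (\<integral>\<^sup>+x. ennreal (copy_weight r (card I - card V) {1..card V} x) \<partial>marks {1..card V})"
    using n_subsets[OF fin, of "card V"] by simp
  finally show ?thesis .
qed

end

section \<open>Change of variables\<close>

text \<open>Separates a product over marks into all inclinations and all positions, so that
  positions can be transformed while the inclinations are held fixed.\<close>

lemma nn_integral_PiM_pair:
  fixes A :: "'a measure" and B :: "'b measure"
  assumes A: "sigma_finite_measure A" and B: "sigma_finite_measure B" and "finite I"
    and "G \<in> borel_measurable (PiM I (\<lambda>_. A \<Otimes>\<^sub>M B))"
  shows "(\<integral>\<^sup>+p. G p \<partial>PiM I (\<lambda>_. A \<Otimes>\<^sub>M B))
    = (\<integral>\<^sup>+y. \<integral>\<^sup>+x. G (\<lambda>i\<in>I. (x i, y i)) \<partial>PiM I (\<lambda>_. A) \<partial>PiM I (\<lambda>_. B))"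
  using assms(3,4)
proof (induction I arbitrary: G rule: finite_induct)
  case empty
  show ?case by (simp add: PiM_empty nn_integral_count_space_finite)
next
  case (insert i I)
  interpret A: sigma_finite_measure A by fact
  interpret B: sigma_finite_measure B by fact
  interpret AB: pair_sigma_finite A B ..
  interpret PA: product_sigma_finite "\<lambda>_. A" ..
  interpret PB: product_sigma_finite "\<lambda>_. B" ..
  interpret PAB: product_sigma_finite "\<lambda>_. A \<Otimes>\<^sub>M B" ..
  interpret FA: finite_product_sigma_finite "\<lambda>_. A" I by standard fact
  interpret FA': finite_product_sigma_finite "\<lambda>_. A" "insert i I" by standard (simp add: insert.hyps)
  interpret F: pair_sigma_finite "PiM I (\<lambda>_. A)" B ..
  note [measurable] = insert.prems
  have eq: "(\<lambda>j\<in>I. (x j, y j))(i := (a, b)) = (\<lambda>j\<in>insert i I. ((x(i := a)) j, (y(i := b)) j))" for x y a b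
    using insert.hyps by (auto simp: fun_eq_iff restrict_def)
  have upd [measurable]: "(\<lambda>(p, q). p(i := q)) \<in> PiM I (\<lambda>_. A \<Otimes>\<^sub>M B) \<Otimes>\<^sub>M (A \<Otimes>\<^sub>M B) \<rightarrow>\<^sub>M PiM (insert i I) (\<lambda>_. A \<Otimes>\<^sub>M B)"
    by (rule measurable_add_dim)
  have Gp: "(\<lambda>q. G (p(i := q))) \<in> borel_measurable (A \<Otimes>\<^sub>M B)" if "p \<in> space (PiM I (\<lambda>_. A \<Otimes>\<^sub>M B))" for p
    using that by measurable
  have conf [measurable]: "(\<lambda>(x, y). \<lambda>j\<in>I. (x j, y j)) \<in> PiM I (\<lambda>_. A) \<Otimes>\<^sub>M PiM I (\<lambda>_. B) \<rightarrow>\<^sub>M PiM I (\<lambda>_. A \<Otimes>\<^sub>M B)"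
    by (auto simp: case_prod_unfold intro!: measurable_restrict)
  have "(\<integral>\<^sup>+p. G p \<partial>PiM (insert i I) (\<lambda>_. A \<Otimes>\<^sub>M B)) = (\<integral>\<^sup>+p. \<integral>\<^sup>+q. G (p(i := q)) \<partial>(A \<Otimes>\<^sub>M B) \<partial>PiM I (\<lambda>_. A \<Otimes>\<^sub>M B))"
    by (rule PAB.product_nn_integral_insert) (use insert in auto)
  also have "\<dots> = (\<integral>\<^sup>+p. \<integral>\<^sup>+b. \<integral>\<^sup>+a. G (p(i := (a, b))) \<partial>A \<partial>B \<partial>PiM I (\<lambda>_. A \<Otimes>\<^sub>M B))"
    by (intro nn_integral_cong AB.nn_integral_snd[symmetric] Gp)
  also have "\<dots> = (\<integral>\<^sup>+y. \<integral>\<^sup>+x. \<integral>\<^sup>+b. \<integral>\<^sup>+a. G ((\<lambda>j\<in>I. (x j, y j))(i := (a, b))) \<partial>A \<partial>B \<partial>PiM I (\<lambda>_. A) \<partial>PiM I (\<lambda>_. B))"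
    by (rule insert.IH) measurable
  \<comment> \<open>The new angle moves past the old positions, which brings the new coordinate of
    each kind next to the old ones.\<close>
  also have "\<dots> = (\<integral>\<^sup>+y. \<integral>\<^sup>+b. \<integral>\<^sup>+x. \<integral>\<^sup>+a. G ((\<lambda>j\<in>I. (x j, y j))(i := (a, b))) \<partial>A \<partial>PiM I (\<lambda>_. A) \<partial>B \<partial>PiM I (\<lambda>_. B))"
    by (intro nn_integral_cong F.Fubini'[symmetric]) measurable
  also have "\<dots> = (\<integral>\<^sup>+y. \<integral>\<^sup>+b. \<integral>\<^sup>+x. G (\<lambda>j\<in>insert i I. (x j, (y(i := b)) j)) \<partial>PiM (insert i I) (\<lambda>_. A) \<partial>B \<partial>PiM I (\<lambda>_. B))"
    unfolding eq
    by (intro nn_integral_cong PA.product_nn_integral_insert[symmetric]) (use insert.hyps in measurable)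
  also have "\<dots> = (\<integral>\<^sup>+y. \<integral>\<^sup>+x. G (\<lambda>j\<in>insert i I. (x j, y j)) \<partial>PiM (insert i I) (\<lambda>_. A) \<partial>PiM (insert i I) (\<lambda>_. B))"
    by (rule PB.product_nn_integral_insert[symmetric]) (use insert.hyps in measurable)
  finally show ?case .
qed

text \<open>Lifts a change of variables with density \<open>h\<close> from one coordinate to a
  finite product. It serves twice: with an affine map for the positions, and with the identity map
  to pass from the law of the angles to its density.\<close>

lemma nn_integral_PiM_change:
  fixes A :: "'a measure" and L :: "'b measure" and h :: "'b \<Rightarrow> ennreal"
  assumes A: "sigma_finite_measure A" and L: "sigma_finite_measure L" and "finite I"
    and [measurable]: "h \<in> borel_measurable L" "T \<in> L \<rightarrow>\<^sub>M A"
    and single: "\<And>g. g \<in> borel_measurable A \<Longrightarrow> (\<integral>\<^sup>+x. g x \<partial>A) = (\<integral>\<^sup>+z. h z * g (T z) \<partial>L)"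
    and "G \<in> borel_measurable (PiM I (\<lambda>_. A))"
  shows "(\<integral>\<^sup>+x. G x \<partial>PiM I (\<lambda>_. A)) = (\<integral>\<^sup>+z. (\<Prod>i\<in>I. h (z i)) * G (\<lambda>i\<in>I. T (z i)) \<partial>PiM I (\<lambda>_. L))"
  using assms(3,7)
proof (induction I arbitrary: G rule: finite_induct)
  case empty
  show ?case by (simp add: PiM_empty nn_integral_count_space_finite)
next
  case (insert i I)
  interpret A: sigma_finite_measure A by fact
  interpret L: sigma_finite_measure L by fact
  interpret PA: product_sigma_finite "\<lambda>_. A" ..
  interpret PL: product_sigma_finite "\<lambda>_. L" ..
  note [measurable] = insert.prems
  have eq: "(\<lambda>j\<in>I. T (z j))(i := T a) = (\<lambda>j\<in>insert i I. T ((z(i := a)) j))" for z a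
    using insert.hyps by (auto simp: fun_eq_iff restrict_def)
  have upd [measurable]: "(\<lambda>(p, q). p(i := q)) \<in> PiM I (\<lambda>_. A) \<Otimes>\<^sub>M A \<rightarrow>\<^sub>M PiM (insert i I) (\<lambda>_. A)"
    by (rule measurable_add_dim)
  have conf [measurable]: "(\<lambda>z. \<lambda>j\<in>I. T (z j)) \<in> PiM I (\<lambda>_. L) \<rightarrow>\<^sub>M PiM I (\<lambda>_. A)"
    by (auto intro!: measurable_restrict)
  have "(\<integral>\<^sup>+x. G x \<partial>PiM (insert i I) (\<lambda>_. A)) = (\<integral>\<^sup>+x. \<integral>\<^sup>+a. G (x(i := a)) \<partial>A \<partial>PiM I (\<lambda>_. A))"
    by (rule PA.product_nn_integral_insert) (use insert in auto)
  also have "\<dots> = (\<integral>\<^sup>+x. \<integral>\<^sup>+a. h a * G (x(i := T a)) \<partial>L \<partial>PiM I (\<lambda>_. A))"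
    by (intro nn_integral_cong single) measurable
  also have "\<dots> = (\<integral>\<^sup>+z. (\<Prod>j\<in>I. h (z j)) * (\<integral>\<^sup>+a. h a * G ((\<lambda>j\<in>I. T (z j))(i := T a)) \<partial>L) \<partial>PiM I (\<lambda>_. L))"
    by (rule insert.IH) measurable
  also have "\<dots> = (\<integral>\<^sup>+z. \<integral>\<^sup>+a. (\<Prod>j\<in>I. h (z j)) * (h a * G ((\<lambda>j\<in>I. T (z j))(i := T a))) \<partial>L \<partial>PiM I (\<lambda>_. L))"
    by (intro nn_integral_cong nn_integral_cmult[symmetric]) measurable
  also have "\<dots> = (\<integral>\<^sup>+z. \<integral>\<^sup>+a. (\<Prod>j\<in>insert i I. h ((z(i := a)) j)) * G (\<lambda>j\<in>insert i I. T ((z(i := a)) j)) \<partial>L \<partial>PiM I (\<lambda>_. L))"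
  proof (intro nn_integral_cong)
    fix z a
    have "(\<Prod>j\<in>insert i I. h ((z(i := a)) j)) = h a * (\<Prod>j\<in>I. h ((z(i := a)) j))"
      using insert.hyps by simp
    also have "(\<Prod>j\<in>I. h ((z(i := a)) j)) = (\<Prod>j\<in>I. h (z j))"
      using insert.hyps by (intro prod.cong) auto
    finally show "(\<Prod>j\<in>I. h (z j)) * (h a * G ((\<lambda>j\<in>I. T (z j))(i := T a)))
        = (\<Prod>j\<in>insert i I. h ((z(i := a)) j)) * G (\<lambda>j\<in>insert i I. T ((z(i := a)) j))"
      unfolding eq by (simp only: mult_ac)
  qed
  also have "\<dots> = (\<integral>\<^sup>+z. (\<Prod>j\<in>insert i I. h (z j)) * G (\<lambda>j\<in>insert i I. T (z j)) \<partial>PiM (insert i I) (\<lambda>_. L))"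
    by (rule PL.product_nn_integral_insert[symmetric]) (use insert.hyps in measurable)
  finally show ?case .
qed

lemma nn_integral_lborel_affine:
  fixes u :: "'a::euclidean_space"
  assumes "r > 0" and [measurable]: "g \<in> borel_measurable borel"
  shows "(\<integral>\<^sup>+x. g x \<partial>lborel) = (\<integral>\<^sup>+z. ennreal (r ^ DIM('a)) * g (u + r *\<^sub>R z) \<partial>lborel)"
proof -
  have "(\<integral>\<^sup>+x. g x \<partial>lborel) = (\<integral>\<^sup>+x. g x \<partial>density (distr lborel borel (\<lambda>x. u + r *\<^sub>R x)) (\<lambda>_. \<bar>r\<bar> ^ DIM('a)))"
    using assms(1) by (subst lborel_affine[of r u]) auto
  also have "\<dots> = (\<integral>\<^sup>+z. ennreal (r ^ DIM('a)) * g (u + r *\<^sub>R z) \<partial>lborel)"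
    using assms(1) by (simp add: nn_integral_density nn_integral_distr)
  finally show ?thesis .
qed

text \<open>For small \<open>p\<close> the logarithm of \<open>1 - p\<close> lies between
  \<open>- p - 2 * p\<^sup>2\<close> and \<open>- p\<close>. Multiplied by \<open>n - k\<close>, the
  gap is of order \<open>n * p * p\<close> and vanishes because \<open>n * p\<close> converges,
  which also forces \<open>p\<close> to tend to \<open>0\<close>; the fixed \<open>k\<close> is
  negligible for the same reason.\<close>

lemma tendsto_one_minus_power:
  fixes p :: "nat \<Rightarrow> real"
  assumes lim: "(\<lambda>n. real n * p n) \<longlonglongrightarrow> a" and p: "\<And>n. 0 \<le> p n"
  shows "(\<lambda>n. (1 - p n) ^ (n - k)) \<longlonglongrightarrow> exp (- a)"
proof -
  have "(\<lambda>n. (real n * p n) * (1 / real n)) \<longlonglongrightarrow> a * 0"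
    by (intro tendsto_mult lim lim_1_over_n)
  moreover have "\<forall>\<^sub>F n in sequentially. (real n * p n) * (1 / real n) = p n"
    by (rule eventually_mono[OF eventually_gt_at_top[of 0]]) simp
  ultimately have "p \<longlonglongrightarrow> a * 0"
    by (rule Lim_transform_eventually)
  then have p0: "p \<longlonglongrightarrow> 0" by simp
  have "(\<lambda>n. real n * p n - real k * p n) \<longlonglongrightarrow> a - real k * 0"
    by (intro tendsto_intros lim p0)
  moreover have "\<forall>\<^sub>F n in sequentially. real n * p n - real k * p n = real (n - k) * p n"
    by (rule eventually_mono[OF eventually_ge_at_top[of k]]) (simp add: of_nat_diff algebra_simps)
  ultimately have "(\<lambda>n. real (n - k) * p n) \<longlonglongrightarrow> a - real k * 0"
    by (rule Lim_transform_eventually)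
  then have lim': "(\<lambda>n. real (n - k) * p n) \<longlonglongrightarrow> a" by simp
  have up: "(\<lambda>n. exp (- (real (n - k) * p n))) \<longlonglongrightarrow> exp (- a)"
    by (intro tendsto_intros lim')
  have "(\<lambda>n. exp (- (real (n - k) * p n) - 2 * (real (n - k) * p n) * p n)) \<longlonglongrightarrow> exp (- a - 2 * a * 0)"
    by (intro tendsto_intros lim' p0)
  then have low: "(\<lambda>n. exp (- (real (n - k) * p n) - 2 * (real (n - k) * p n) * p n)) \<longlonglongrightarrow> exp (- a)"
    by simp
  have ev: "\<forall>\<^sub>F n in sequentially. p n < 1 / 2"
    using p0 by (rule order_tendstoD) simp
  have pow: "(1 - p n) ^ (n - k) = exp (real (n - k) * ln (1 - p n))" if "p n < 1 / 2" for n
    using that by (simp add: exp_of_nat_mult)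
  show ?thesis
  proof (rule tendsto_sandwich[OF _ _ low up])
    show "\<forall>\<^sub>F n in sequentially. exp (- (real (n - k) * p n) - 2 * (real (n - k) * p n) * p n) \<le> (1 - p n) ^ (n - k)"
      using ev
    proof eventually_elim
      case (elim n)
      have "- p n - 2 * (p n)\<^sup>2 \<le> ln (1 - p n)"
        using elim p by (intro ln_one_minus_pos_lower_bound) auto
      then have "real (n - k) * (- p n - 2 * (p n)\<^sup>2) \<le> real (n - k) * ln (1 - p n)"
        by (rule mult_left_mono) simp
      then show ?case unfolding pow[OF elim] by (simp add: power2_eq_square algebra_simps)
    qed
    show "\<forall>\<^sub>F n in sequentially. (1 - p n) ^ (n - k) \<le> exp (- (real (n - k) * p n))"
      using ev
    proof eventually_elim
      case (elim n)
      have "ln (1 - p n) \<le> - p n" using ln_le_minus_one[of "1 - p n"] elim by simp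
      then have "real (n - k) * ln (1 - p n) \<le> real (n - k) * (- p n)"
        by (rule mult_left_mono) simp
      then show ?case unfolding pow[OF elim] by simp
    qed
  qed
qed

section \<open>Coordinates for a copy: base point, angles and offsets\<close>

definition angle_density :: "real \<Rightarrow> real" where
  "angle_density y = indicator {0..2*pi} y / (2*pi)"

lemma angle_density_nonneg [simp]: "0 \<le> angle_density y"
  by (simp add: angle_density_def)

lemma angle_density_measurable [measurable]: "angle_density \<in> borel_measurable borel"
  unfolding angle_density_def by measurable

lemma nn_integral_angle_density: "(\<integral>\<^sup>+y. ennreal (angle_density y) \<partial>lborel) = 1"
  using nn_integral_angle_law[of "\<lambda>_. 1"] prob_space.emeasure_space_1[OF prob_space_angle_law]
  by (simp add: angle_density_def)

context sector_process
begin

abbreviation k :: nat where "k \<equiv> card V"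

text \<open>Vertex \<open>1\<close> is the base point \<open>u\<close> and the others have offsets
  \<open>z i\<close> in units of \<open>r\<close>. The tuple \<open>z\<close> carries no information
  at \<open>1\<close>; the update \<open>z(1 := 0)\<close> is the one used in
  \<open>phi\<close>.\<close>

definition placed :: "real^2 \<Rightarrow> real \<Rightarrow> (nat \<Rightarrow> real) \<Rightarrow> (nat \<Rightarrow> real^2) \<Rightarrow> nat \<Rightarrow> (real^2) \<times> real" where
  "placed u r y z = (\<lambda>i\<in>{1..k}. (u + r *\<^sub>R (z(1 := 0)) i, y i))"

abbreviation angles :: "(nat \<Rightarrow> real) measure" where "angles \<equiv> PiM {1..k} (\<lambda>_. lborel)"
abbreviation angle_prod :: "(nat \<Rightarrow> real) \<Rightarrow> real" where
  "angle_prod y \<equiv> \<Prod>i\<in>{1..k}. angle_density (y i)"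
abbreviation offsets :: "(nat \<Rightarrow> real^2) measure" where "offsets \<equiv> PiM {2..k} (\<lambda>_. lborel)"
abbreviation shapes :: "((nat \<Rightarrow> real) \<times> (nat \<Rightarrow> real^2)) measure" where "shapes \<equiv> angles \<Otimes>\<^sub>M offsets"

abbreviation full :: "((real^2) \<times> (nat \<Rightarrow> real) \<times> (nat \<Rightarrow> real^2)) measure" where
  "full \<equiv> lborel \<Otimes>\<^sub>M shapes"

sublocale angles: finite_product_sigma_finite "\<lambda>_. lborel :: real measure" "{1..k}"
  by standard simp

sublocale offsets: finite_product_sigma_finite "\<lambda>_. lborel :: (real^2) measure" "{2..k}"
  by standard simp

sublocale shapes: pair_sigma_finite angles offsets ..

sublocale full: pair_sigma_finite "lborel :: (real^2) measure" shapes ..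

lemma nn_integral_point_law_affine:
  assumes "r > 0" "g \<in> borel_measurable point_law"
  shows "(\<integral>\<^sup>+x. g x \<partial>point_law) = (\<integral>\<^sup>+z. ennreal (r\<^sup>2 * f (u + r *\<^sub>R z)) * g (u + r *\<^sub>R z) \<partial>lborel)"
proof -
  have [measurable]: "g \<in> borel_measurable borel"
    using assms(2) by (simp cong: measurable_cong_sets)
  have "(\<integral>\<^sup>+x. g x \<partial>point_law) = (\<integral>\<^sup>+x. ennreal (f x) * g x \<partial>lborel)"
    by (rule nn_integral_point_law) simp
  also have "\<dots> = (\<integral>\<^sup>+z. ennreal (r ^ DIM(real^2)) * (ennreal (f (u + r *\<^sub>R z)) * g (u + r *\<^sub>R z)) \<partial>lborel)"
    by (rule nn_integral_lborel_affine[OF assms(1)]) measurable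
  also have "\<dots> = (\<integral>\<^sup>+z. ennreal (r\<^sup>2 * f (u + r *\<^sub>R z)) * g (u + r *\<^sub>R z) \<partial>lborel)"
    using f_nonneg by (simp add: ennreal_mult mult.assoc)
  finally show ?thesis .
qed

lemma insert_1_k: "{1..k} = insert 1 {2..k}"
  using card_V_pos by auto

lemma full_component_measurable:
  shows "fst \<in> full \<rightarrow>\<^sub>M borel"
    and "i \<in> {1..k} \<Longrightarrow> (\<lambda>p. fst (snd p) i) \<in> full \<rightarrow>\<^sub>M borel"
    and "j \<in> {2..k} \<Longrightarrow> (\<lambda>p. snd (snd p) j) \<in> full \<rightarrow>\<^sub>M borel"
proof -
  show "fst \<in> full \<rightarrow>\<^sub>M borel"
    using measurable_fst[of "lborel :: (real^2) measure" "shapes"] by (simp cong: measurable_cong_sets)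
  show "(\<lambda>p. fst (snd p) i) \<in> full \<rightarrow>\<^sub>M borel" if "i \<in> {1..k}"
    using measurable_compose[OF measurable_compose[OF measurable_snd measurable_fst]
        measurable_component_singleton[OF that, of "\<lambda>_. lborel :: real measure"],
        of "lborel :: (real^2) measure" offsets]
    by (simp cong: measurable_cong_sets)
  show "(\<lambda>p. snd (snd p) j) \<in> full \<rightarrow>\<^sub>M borel" if "j \<in> {2..k}"
    using measurable_compose[OF measurable_compose[OF measurable_snd measurable_snd]
        measurable_component_singleton[OF that, of "\<lambda>_. lborel :: (real^2) measure"],
        of "lborel :: (real^2) measure" angles]
    by (simp cong: measurable_cong_sets)
qed

lemma placed_measurable [measurable]:
  "(\<lambda>(u, y, z). placed u r y z) \<in> full \<rightarrow>\<^sub>M marks {1..k}"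
proof -
  have x: "(\<lambda>p. fst p + r *\<^sub>R ((snd (snd p))(1 := 0)) i) \<in> full \<rightarrow>\<^sub>M borel" if "i \<in> {1..k}" for i
  proof (cases "i = 1")
    case False
    then have "i \<in> {2..k}" using that by auto
    then show ?thesis using False full_component_measurable(1,3) by (simp add: borel_measurable_add borel_measurable_scaleR)
  qed (simp add: full_component_measurable)
  have mark: "measurable full mark_law = measurable full (borel \<Otimes>\<^sub>M borel)"
    by (rule measurable_cong_sets) (simp_all add: sets_mark_law)
  show ?thesis
    unfolding placed_def case_prod_unfold
    by (rule measurable_restrict, unfold mark) (intro measurable_Pair x full_component_measurable; assumption)
qed

text \<open>Base point, angles and offsets are arbitrary measurable maps here, so that one lemma
  serves every order of integration occurring below.\<close>

lemma placed_weight_measurable: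
  assumes G: "G \<in> borel_measurable (marks {1..k})"
    and a: "a \<in> N \<rightarrow>\<^sub>M lborel" and b: "b \<in> N \<rightarrow>\<^sub>M angles" and c: "c \<in> N \<rightarrow>\<^sub>M offsets"
  shows "(\<lambda>p. (\<Prod>i\<in>{2..k}. ennreal (r\<^sup>2 * f (a p + r *\<^sub>R c p i))) * G (placed (a p) r (b p) (c p)))
    \<in> borel_measurable N"
proof (intro borel_measurable_times_ennreal borel_measurable_prod_ennreal)
  show "(\<lambda>p. G (placed (a p) r (b p) (c p))) \<in> borel_measurable N"
    using measurable_compose[OF measurable_Pair[OF a measurable_Pair[OF b c]]
        measurable_compose[OF placed_measurable G]]
    by simp
next
  fix i assume "i \<in> {2..k}"
  then have "(\<lambda>p. c p i) \<in> N \<rightarrow>\<^sub>M lborel"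
    by (rule measurable_compose[OF c measurable_component_singleton])
  with a show "(\<lambda>p. ennreal (r\<^sup>2 * f (a p + r *\<^sub>R c p i))) \<in> borel_measurable N"
    by simp
qed

text \<open>Split off vertex \<open>1\<close> as base point and express the other
  \<open>k - 1\<close> vertices by offsets, each with a Jacobian \<open>r\<^sup>2\<close>. The base
  point ends up outermost because it is the variable in which the limit holds almost
  everywhere.\<close>

lemma nn_integral_marks:
  assumes r: "r > 0" and G [measurable]: "G \<in> borel_measurable (marks {1..k})"
  shows "(\<integral>\<^sup>+x. G x \<partial>marks {1..k}) =
    (\<integral>\<^sup>+u. \<integral>\<^sup>+y. \<integral>\<^sup>+z. ennreal (f u) * (\<Prod>i\<in>{1..k}. ennreal (angle_density (y i))) *
      ((\<Prod>i\<in>{2..k}. ennreal (r\<^sup>2 * f (u + r *\<^sub>R z i))) * G (placed u r y z)) \<partial>offsets \<partial>angles \<partial>lborel)"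
proof -
  interpret PP: product_sigma_finite "\<lambda>_. point_law" ..
  interpret PL: product_sigma_finite "\<lambda>_. lborel :: real measure" ..
  interpret PL2: product_sigma_finite "\<lambda>_. lborel :: (real^2) measure" ..
  interpret AL: pair_sigma_finite angles "lborel :: (real^2) measure" ..
  let ?W = "\<lambda>y. \<Prod>i\<in>{1..k}. ennreal (angle_density (y i))"
  let ?R = "\<lambda>u z. \<Prod>i\<in>{2..k}. ennreal (r\<^sup>2 * f (u + r *\<^sub>R z i))"
  have conf [measurable]: "(\<lambda>(x, y). \<lambda>j\<in>{1..k}. (x j, y j)) \<in> PiM {1..k} (\<lambda>_. point_law) \<Otimes>\<^sub>M PiM {1..k} (\<lambda>_. angle_law) \<rightarrow>\<^sub>M marks {1..k}"
    unfolding mark_law_def by (auto simp: case_prod_unfold intro!: measurable_restrict)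
  have placed_eq: "(\<lambda>j\<in>{1..k}. (((\<lambda>i\<in>{2..k}. u + r *\<^sub>R z i)(1 := u)) j, y j)) = placed u r y z" for u y z
    by (auto simp: placed_def fun_eq_iff)
  have points: "(\<integral>\<^sup>+x. G (\<lambda>j\<in>{1..k}. (x j, y j)) \<partial>PiM {1..k} (\<lambda>_. point_law))
      = (\<integral>\<^sup>+u. ennreal (f u) * (\<integral>\<^sup>+z. ?R u z * G (placed u r y z) \<partial>offsets) \<partial>lborel)"
    if y: "y \<in> space (PiM {1..k} (\<lambda>_. angle_law))" for y
  proof -
    have H [measurable]: "(\<lambda>x. G (\<lambda>j\<in>{1..k}. (x j, y j))) \<in> borel_measurable (PiM {1..k} (\<lambda>_. point_law))"
      using y by measurable
    then have H' [measurable]: "(\<lambda>x. G (\<lambda>j\<in>{1..k}. (x j, y j))) \<in> borel_measurable (PiM (insert 1 {2..k}) (\<lambda>_. point_law))"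
      by (simp only: insert_1_k[symmetric])
    have upd [measurable]: "(\<lambda>(p, q). p(1 := q)) \<in> PiM {2..k} (\<lambda>_. point_law) \<Otimes>\<^sub>M point_law \<rightarrow>\<^sub>M PiM (insert 1 {2..k}) (\<lambda>_. point_law)"
      by (rule measurable_add_dim)
    have "(\<integral>\<^sup>+x. G (\<lambda>j\<in>{1..k}. (x j, y j)) \<partial>PiM {1..k} (\<lambda>_. point_law))
      = (\<integral>\<^sup>+x. G (\<lambda>j\<in>{1..k}. (x j, y j)) \<partial>PiM (insert 1 {2..k}) (\<lambda>_. point_law))"
      by (simp only: insert_1_k[symmetric])
    also have "\<dots> = (\<integral>\<^sup>+u. \<integral>\<^sup>+x. G (\<lambda>j\<in>{1..k}. ((x(1 := u)) j, y j)) \<partial>PiM {2..k} (\<lambda>_. point_law) \<partial>point_law)"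
      by (rule PP.product_nn_integral_insert_rev[OF _ _ H']) auto
    also have "\<dots> = (\<integral>\<^sup>+u. \<integral>\<^sup>+z. ?R u z * G (placed u r y z) \<partial>offsets \<partial>point_law)"
    proof (rule nn_integral_cong)
      fix u assume "u \<in> space point_law"
      have "(\<integral>\<^sup>+x. G (\<lambda>j\<in>{1..k}. ((x(1 := u)) j, y j)) \<partial>PiM {2..k} (\<lambda>_. point_law))
        = (\<integral>\<^sup>+z. ?R u z * G (\<lambda>j\<in>{1..k}. (((\<lambda>i\<in>{2..k}. u + r *\<^sub>R z i)(1 := u)) j, y j)) \<partial>offsets)"
      proof (rule nn_integral_PiM_change)
        show "(\<integral>\<^sup>+x. g x \<partial>point_law) = (\<integral>\<^sup>+z. ennreal (r\<^sup>2 * f (u + r *\<^sub>R z)) * g (u + r *\<^sub>R z) \<partial>lborel)"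
          if "g \<in> borel_measurable point_law" for g
          by (rule nn_integral_point_law_affine[OF r that])
        have "(\<lambda>x. x(1 := u)) \<in> PiM {2..k} (\<lambda>_. point_law) \<rightarrow>\<^sub>M PiM (insert 1 {2..k}) (\<lambda>_. point_law)"
          using \<open>u \<in> space point_law\<close> by measurable
        from measurable_compose[OF this H']
        show "(\<lambda>x. G (\<lambda>j\<in>{1..k}. ((x(1 := u)) j, y j))) \<in> borel_measurable (PiM {2..k} (\<lambda>_. point_law))" .
      qed (auto intro: point.sigma_finite_measure_axioms lborel.sigma_finite_measure_axioms)
      then show "(\<integral>\<^sup>+x. G (\<lambda>j\<in>{1..k}. ((x(1 := u)) j, y j)) \<partial>PiM {2..k} (\<lambda>_. point_law))
        = (\<integral>\<^sup>+z. ?R u z * G (placed u r y z) \<partial>offsets)"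
        unfolding placed_eq .
    qed
    also have "\<dots> = (\<integral>\<^sup>+u. ennreal (f u) * (\<integral>\<^sup>+z. ?R u z * G (placed u r y z) \<partial>offsets) \<partial>lborel)"
    proof (rule nn_integral_point_law)
      have "y \<in> space angles" using y by (simp add: space_PiM)
      then have "(\<lambda>p. ?R (fst p) (snd p) * G (placed (fst p) r y (snd p))) \<in> borel_measurable (borel \<Otimes>\<^sub>M offsets)"
        by (intro placed_weight_measurable[OF G] measurable_const) (simp_all cong: measurable_cong_sets)
      then have "(\<lambda>(u, z). ?R u z * G (placed u r y z)) \<in> borel_measurable (borel \<Otimes>\<^sub>M offsets)"
        by (simp only: case_prod_unfold)
      then show "(\<lambda>u. \<integral>\<^sup>+z. ?R u z * G (placed u r y z) \<partial>offsets) \<in> borel_measurable borel"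
        by (rule offsets.borel_measurable_nn_integral)
    qed
    finally show ?thesis .
  qed
  \<comment> \<open>Changing variables by the identity map still leaves a restricted tuple, which
    \<open>placed\<close> absorbs.\<close>
  have placed_restrict: "placed u r (\<lambda>i\<in>{1..k}. y i) z = placed u r y z" for u y z
    by (simp add: placed_def fun_eq_iff restrict_def)
  have meas2 [measurable]: "(\<lambda>(y, u). \<integral>\<^sup>+z. ?R u z * G (placed u r y z) \<partial>offsets) \<in> borel_measurable (angles \<Otimes>\<^sub>M lborel)"
  proof -
    have "(\<lambda>p. ?R (snd (fst p)) (snd p) * G (placed (snd (fst p)) r (fst (fst p)) (snd p))) \<in> borel_measurable ((angles \<Otimes>\<^sub>M lborel) \<Otimes>\<^sub>M offsets)"
      by (intro placed_weight_measurable[OF G] measurable_snd measurable_compose[OF measurable_fst measurable_snd] measurable_compose[OF measurable_fst measurable_fst])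
    then have "(\<lambda>(p, z). ?R (snd p) z * G (placed (snd p) r (fst p) z)) \<in> borel_measurable ((angles \<Otimes>\<^sub>M lborel) \<Otimes>\<^sub>M offsets)"
      by (simp only: case_prod_unfold)
    from offsets.borel_measurable_nn_integral[OF this] show ?thesis by (simp only: case_prod_unfold)
  qed
  have "(\<integral>\<^sup>+x. G x \<partial>marks {1..k}) =
      (\<integral>\<^sup>+y. \<integral>\<^sup>+x. G (\<lambda>j\<in>{1..k}. (x j, y j)) \<partial>PiM {1..k} (\<lambda>_. point_law) \<partial>PiM {1..k} (\<lambda>_. angle_law))"
    unfolding mark_law_def
    using point.sigma_finite_measure_axioms angle.sigma_finite_measure_axioms G
    by (intro nn_integral_PiM_pair) (auto simp: mark_law_def)
  also have "\<dots> = (\<integral>\<^sup>+y. \<integral>\<^sup>+u. ennreal (f u) * (\<integral>\<^sup>+z. ?R u z * G (placed u r y z) \<partial>offsets) \<partial>lborel \<partial>PiM {1..k} (\<lambda>_. angle_law))"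
    by (intro nn_integral_cong points)
  also have "\<dots> = (\<integral>\<^sup>+y. ?W y * (\<integral>\<^sup>+u. ennreal (f u) * (\<integral>\<^sup>+z. ?R u z * G (placed u r (\<lambda>i\<in>{1..k}. y i) z) \<partial>offsets) \<partial>lborel) \<partial>angles)"
  proof (rule nn_integral_PiM_change)
    show "(\<integral>\<^sup>+x. g x \<partial>angle_law) = (\<integral>\<^sup>+z. ennreal (angle_density z) * g z \<partial>lborel)"
      if "g \<in> borel_measurable angle_law" for g
      using that unfolding angle_density_def
      by (intro nn_integral_angle_law) (simp cong: measurable_cong_sets)
    have "(\<lambda>y. \<integral>\<^sup>+u. ennreal (f u) * (\<integral>\<^sup>+z. ?R u z * G (placed u r y z) \<partial>offsets) \<partial>lborel) \<in> borel_measurable angles"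
      by measurable
    moreover have "sets angles = sets (PiM {1..k} (\<lambda>_. angle_law))" by (intro sets_PiM_cong) auto
    ultimately show "(\<lambda>y. \<integral>\<^sup>+u. ennreal (f u) * (\<integral>\<^sup>+z. ?R u z * G (placed u r y z) \<partial>offsets) \<partial>lborel)
        \<in> borel_measurable (PiM {1..k} (\<lambda>_. angle_law))"
      by (simp cong: measurable_cong_sets)
  qed (auto intro: angle.sigma_finite_measure_axioms lborel.sigma_finite_measure_axioms)
  also have "\<dots> = (\<integral>\<^sup>+y. \<integral>\<^sup>+u. ?W y * (ennreal (f u) * (\<integral>\<^sup>+z. ?R u z * G (placed u r y z) \<partial>offsets)) \<partial>lborel \<partial>angles)"
    unfolding placed_restrict by (intro nn_integral_cong nn_integral_cmult[symmetric]) measurable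
  also have "\<dots> = (\<integral>\<^sup>+u. \<integral>\<^sup>+y. ?W y * (ennreal (f u) * (\<integral>\<^sup>+z. ?R u z * G (placed u r y z) \<partial>offsets)) \<partial>angles \<partial>lborel)"
    by (rule AL.Fubini'[symmetric]) measurable
  also have "\<dots> = (\<integral>\<^sup>+u. \<integral>\<^sup>+y. \<integral>\<^sup>+z. ennreal (f u) * ?W y * (?R u z * G (placed u r y z)) \<partial>offsets \<partial>angles \<partial>lborel)"
  proof (intro nn_integral_cong)
    fix u y assume [measurable]: "u \<in> space (lborel :: (real^2) measure)" "y \<in> space angles"
    have "(\<lambda>z. ?R u z * G (placed u r y z)) \<in> borel_measurable offsets"
      by (intro placed_weight_measurable[OF G] measurable_const measurable_ident_sets) (use \<open>u \<in> _\<close> \<open>y \<in> _\<close> in auto)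
    then have "(\<integral>\<^sup>+z. ennreal (f u) * ?W y * (?R u z * G (placed u r y z)) \<partial>offsets)
        = ennreal (f u) * ?W y * (\<integral>\<^sup>+z. ?R u z * G (placed u r y z) \<partial>offsets)"
      by (rule nn_integral_cmult)
    then show "?W y * (ennreal (f u) * (\<integral>\<^sup>+z. ?R u z * G (placed u r y z) \<partial>offsets))
        = (\<integral>\<^sup>+z. ennreal (f u) * ?W y * (?R u z * G (placed u r y z)) \<partial>offsets)"
      by (simp only: mult_ac)
  qed
  finally show ?thesis .
qed

end

section \<open>The limit of the mean\<close>

text \<open>Transfers the continuity of \<open>f\<close> at almost every base point to the full
  product space.\<close>

lemma AE_pair_fst:
  assumes "sigma_finite_measure M2" "AE x in M1. P x"
  shows "AE p in M1 \<Otimes>\<^sub>M M2. P (fst p)"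
proof -
  interpret M2: sigma_finite_measure M2 by fact
  obtain N where N: "{x \<in> space M1. \<not> P x} \<subseteq> N" "emeasure M1 N = 0" "N \<in> sets M1"
    using AE_E[OF assms(2)] by blast
  have "N \<times> space M2 \<in> null_sets (M1 \<Otimes>\<^sub>M M2)"
    using N by (intro null_setsI) (simp_all add: M2.emeasure_pair_measure_Times)
  moreover have "{p \<in> space (M1 \<Otimes>\<^sub>M M2). \<not> P (fst p)} \<subseteq> N \<times> space M2"
    using N(1) by (auto simp: space_pair_measure)
  ultimately show ?thesis by (rule AE_I')
qed

lemma reach_compact: "finite W \<Longrightarrow> compact (reach \<alpha> r W z)"
  unfolding reach_def by (intro compact_UN compact_sector)

context sector_process
begin

text \<open>The integrand of the mean in the new coordinates, without the Jacobian
  \<open>r ^ (2 * (k - 1))\<close>, which cancels against the growth of the binomial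
  coefficient.\<close>

definition kern :: "real \<Rightarrow> nat \<Rightarrow> (real^2) \<times> (nat \<Rightarrow> real) \<times> (nat \<Rightarrow> real^2) \<Rightarrow> real" where
  "kern r l = (\<lambda>(u, y, z). f u * angle_prod y * (\<Prod>i\<in>{2..k}. f (u + r *\<^sub>R z i)) *
     copy_weight r l {1..k} (placed u r y z))"

definition exp_weight :: "real \<Rightarrow> (nat \<Rightarrow> real) \<Rightarrow> (nat \<Rightarrow> real^2) \<Rightarrow> real" where
  "exp_weight t y z = (if copy 1 {1..k} (placed 0 1 y z)
     then exp (- t * measure lborel (reach \<alpha> 1 {1..k} (placed 0 1 y z))) else 0)"

definition lim_kern :: "real \<Rightarrow> (real^2) \<times> (nat \<Rightarrow> real) \<times> (nat \<Rightarrow> real^2) \<Rightarrow> real" where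
  "lim_kern \<Lambda> = (\<lambda>(u, y, z). f u * angle_prod y * f u ^ (k - 1) * exp_weight (\<Lambda> * f u) y z)"

text \<open>The majorant for dominated convergence. The offsets of a copy lie within
  \<open>D\<close> of vertex \<open>1\<close>, where \<open>f\<close> is replaced by
  \<open>B\<close>; the single factor \<open>f u\<close> keeps the integral over the base point
  finite.\<close>

definition dom_kern :: "(real^2) \<times> (nat \<Rightarrow> real) \<times> (nat \<Rightarrow> real^2) \<Rightarrow> real" where
  "dom_kern = (\<lambda>(u, y, z). f u * angle_prod y * (\<Prod>i\<in>{2..k}. B * indicator (cball 0 (real D)) (z i)))"

lemma copy_weight_bounds: "0 \<le> copy_weight r l W z" "copy_weight r l W z \<le> 1"
  by (auto simp: copy_weight_def point.prob_le_1 power_le_one)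

section \<open>Scaling a copy to unit radius\<close>

lemma sees_placed:
  assumes "r > 0" "i \<in> {1..k}" "j \<in> {1..k}"
  shows "sees \<alpha> r (placed u r y z) i j \<longleftrightarrow> sees \<alpha> 1 (placed 0 1 y z) i j"
proof -
  have "(1 / r) *\<^sub>R (u + r *\<^sub>R a - (u + r *\<^sub>R b)) = (1 / 1) *\<^sub>R (0 + 1 *\<^sub>R a - (0 + 1 *\<^sub>R b))" for a b :: "real^2"
    using assms(1) by (simp add: scaleR_diff_right)
  then show ?thesis
    using assms unfolding sees_def
    by (subst sector_iff[OF assms(1)], subst sector_iff[of 1]) (simp_all add: placed_def)
qed

lemma copy_placed:
  assumes "r > 0"
  shows "copy r {1..k} (placed u r y z) \<longleftrightarrow> copy 1 {1..k} (placed 0 1 y z)"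
  unfolding copy_def rel_iso_def using sees_placed[OF assms] by simp

lemma reach_placed:
  assumes "r > 0"
  shows "u + r *\<^sub>R w \<in> reach \<alpha> r {1..k} (placed u r y z) \<longleftrightarrow> w \<in> reach \<alpha> 1 {1..k} (placed 0 1 y z)"
proof -
  have "(1 / r) *\<^sub>R (u + r *\<^sub>R w - (u + r *\<^sub>R b)) = (1 / 1) *\<^sub>R (w - (0 + 1 *\<^sub>R b))" for b :: "real^2"
    using assms(1) by (simp add: scaleR_diff_right)
  then have "u + r *\<^sub>R w \<in> sector \<alpha> (u + r *\<^sub>R b) t r \<longleftrightarrow> w \<in> sector \<alpha> (0 + 1 *\<^sub>R b) t 1" for b t
    by (subst sector_iff[OF assms(1)], subst sector_iff[of 1]) simp_all
  then show ?thesis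
    unfolding reach_def by (simp add: placed_def)
qed

text \<open>The mass that \<open>f\<close> gives to the set \<open>u + r S\<close>, divided by
  \<open>r\<^sup>2\<close>.\<close>

definition hit :: "real \<Rightarrow> real^2 \<Rightarrow> (real^2) set \<Rightarrow> real" where
  "hit r u S = (\<integral>w. indicator S w * f (u + r *\<^sub>R w) \<partial>lborel)"

lemma measure_point_law_reach:
  assumes r: "r > 0"
  shows "measure point_law (reach \<alpha> r {1..k} (placed u r y z)) = r\<^sup>2 * hit r u (reach \<alpha> 1 {1..k} (placed 0 1 y z))"
proof -
  let ?R = "reach \<alpha> r {1..k} (placed u r y z)" and ?S = "reach \<alpha> 1 {1..k} (placed 0 1 y z)"
  have S: "compact ?S" and [measurable]: "?S \<in> sets borel" "?R \<in> sets borel"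
    by (simp_all add: reach_compact)
  have int: "integrable lborel (\<lambda>w. indicator ?S w * f (u + r *\<^sub>R w))"
  proof (rule Bochner_Integration.integrable_bound)
    show "integrable lborel (\<lambda>w. B * indicator ?S w)"
      using emeasure_compact_finite[OF S] by (intro integrable_mult_right integrable_real_indicator) auto
    show "AE w in lborel. norm (indicator ?S w * f (u + r *\<^sub>R w)) \<le> norm (B * indicator ?S w)"
      using f_nonneg f_le B_nonneg by (intro AE_I2) (auto simp: indicator_def)
  qed measurable
  have "emeasure point_law ?R = (\<integral>\<^sup>+x. indicator ?R x \<partial>point_law)" by simp
  also have "\<dots> = (\<integral>\<^sup>+w. ennreal (r\<^sup>2 * f (u + r *\<^sub>R w)) * indicator ?R (u + r *\<^sub>R w) \<partial>lborel)"
    by (rule nn_integral_point_law_affine[OF r]) simp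
  also have "\<dots> = (\<integral>\<^sup>+w. ennreal (r\<^sup>2 * (indicator ?S w * f (u + r *\<^sub>R w))) \<partial>lborel)"
  proof (rule nn_integral_cong)
    fix w
    show "ennreal (r\<^sup>2 * f (u + r *\<^sub>R w)) * indicator ?R (u + r *\<^sub>R w) = ennreal (r\<^sup>2 * (indicator ?S w * f (u + r *\<^sub>R w)))"
      using reach_placed[OF r, of u w y z] by (cases "w \<in> ?S") simp_all
  qed
  also have "\<dots> = ennreal (\<integral>w. r\<^sup>2 * (indicator ?S w * f (u + r *\<^sub>R w)) \<partial>lborel)"
    using int f_nonneg by (intro nn_integral_eq_integral integrable_mult_right AE_I2) auto
  also have "(\<integral>w. r\<^sup>2 * (indicator ?S w * f (u + r *\<^sub>R w)) \<partial>lborel) = r\<^sup>2 * hit r u ?S"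
    unfolding hit_def by (rule integral_mult_right_zero)
  finally have "ennreal (measure point_law ?R) = ennreal (r\<^sup>2 * hit r u ?S)"
    by (simp add: point.emeasure_eq_measure)
  moreover have "0 \<le> r\<^sup>2 * hit r u ?S"
    unfolding hit_def using f_nonneg by (intro mult_nonneg_nonneg Bochner_Integration.integral_nonneg) auto
  ultimately show ?thesis by simp
qed

text \<open>Continuity at the one point \<open>u\<close> makes the integrand converge at every
  \<open>w\<close>, and \<open>B\<close> on the compact set \<open>S\<close> is a majorant.\<close>

lemma hit_tendsto:
  assumes S: "compact S" and "isCont f u" "r \<longlonglongrightarrow> 0"
  shows "(\<lambda>n. hit (r n) u S) \<longlonglongrightarrow> f u * measure lborel S"
proof -
  have [measurable]: "S \<in> sets borel" using S by (intro borel_closed compact_imp_closed)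
  have "(\<lambda>n. \<integral>w. indicator S w * f (u + r n *\<^sub>R w) \<partial>lborel) \<longlonglongrightarrow> (\<integral>w. indicator S w * f u \<partial>lborel)"
  proof (rule integral_dominated_convergence[where w="\<lambda>w. B * indicator S w"])
    show "integrable lborel (\<lambda>w. B * indicator S w)"
      using emeasure_compact_finite[OF S] by (intro integrable_mult_right integrable_real_indicator) auto
    show "AE w in lborel. (\<lambda>n. indicator S w * f (u + r n *\<^sub>R w)) \<longlonglongrightarrow> indicator S w * f u"
    proof (intro AE_I2 tendsto_mult tendsto_const)
      fix w
      have "(\<lambda>n. u + r n *\<^sub>R w) \<longlonglongrightarrow> u + 0 *\<^sub>R w" by (intro tendsto_intros assms)
      then show "(\<lambda>n. f (u + r n *\<^sub>R w)) \<longlonglongrightarrow> f u"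
        using isCont_tendsto_compose[OF assms(2)] by simp
    qed
    show "AE w in lborel. norm (indicator S w * f (u + r n *\<^sub>R w)) \<le> B * indicator S w" for n
      using f_nonneg f_le B_nonneg by (intro AE_I2) (auto simp: indicator_def)
  qed measurable
  then show ?thesis by (simp add: hit_def mult.commute)
qed

text \<open>If \<open>p\<close> is the mass of the reach, then \<open>n * p\<close> is
  \<open>n * r\<^sup>2\<close> times \<open>hit\<close> and converges to
  \<open>\<Lambda> * f u\<close> times the area of the unit reach; so the probability that all other
  points avoid the reach becomes an exponential.\<close>

lemma kern_tendsto:
  assumes r: "\<And>n. r n > 0" "r \<longlonglongrightarrow> 0" and \<Lambda>: "(\<lambda>n. real n * (r n)\<^sup>2) \<longlonglongrightarrow> \<Lambda>"
    and cont: "isCont f u"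
  shows "(\<lambda>n. kern (r n) (n - k) (u, y, z)) \<longlonglongrightarrow> lim_kern \<Lambda> (u, y, z)"
proof -
  let ?S = "reach \<alpha> 1 {1..k} (placed 0 1 y z)"
  have f_lim: "(\<lambda>n. f (u + r n *\<^sub>R w)) \<longlonglongrightarrow> f u" for w
  proof -
    have "(\<lambda>n. u + r n *\<^sub>R w) \<longlonglongrightarrow> u + 0 *\<^sub>R w" by (intro tendsto_intros r)
    then show ?thesis using isCont_tendsto_compose[OF cont] by simp
  qed
  have prod: "(\<lambda>n. \<Prod>i\<in>{2..k}. f (u + r n *\<^sub>R z i)) \<longlonglongrightarrow> f u ^ (k - 1)"
  proof -
    have "(\<lambda>n. \<Prod>i\<in>{2..k}. f (u + r n *\<^sub>R z i)) \<longlonglongrightarrow> (\<Prod>i\<in>{2..k}. f u)"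
      by (intro tendsto_prod f_lim)
    moreover have "card {2..k} = k - 1" by simp
    ultimately show ?thesis by (simp only: prod_constant)
  qed
  have weight: "(\<lambda>n. copy_weight (r n) (n - k) {1..k} (placed u (r n) y z)) \<longlonglongrightarrow> exp_weight (\<Lambda> * f u) y z"
  proof (cases "copy 1 {1..k} (placed 0 1 y z)")
    case True
    have "(\<lambda>n. (real n * (r n)\<^sup>2) * hit (r n) u ?S) \<longlonglongrightarrow> \<Lambda> * (f u * measure lborel ?S)"
      by (intro tendsto_mult \<Lambda> hit_tendsto cont r reach_compact) simp
    then have "(\<lambda>n. real n * measure point_law (reach \<alpha> (r n) {1..k} (placed u (r n) y z))) \<longlonglongrightarrow> \<Lambda> * f u * measure lborel ?S"
      unfolding measure_point_law_reach[OF r(1)] by (simp only: mult.assoc)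
    from tendsto_one_minus_power[OF this measure_nonneg, of k] show ?thesis
      unfolding copy_weight_def exp_weight_def copy_placed[OF r(1)] if_P[OF True] by (simp only: mult_minus_left)
  next
    case False
    then show ?thesis
      unfolding copy_weight_def exp_weight_def copy_placed[OF r(1)] if_not_P[OF False] by (intro tendsto_const)
  qed
  show ?thesis
    unfolding kern_def lim_kern_def prod.case
    by (intro tendsto_mult tendsto_const prod weight)
qed

lemma kern_nonneg: "0 \<le> kern r l p"
  unfolding kern_def case_prod_unfold
  by (intro mult_nonneg_nonneg prod_nonneg ballI f_nonneg angle_density_nonneg copy_weight_bounds)

lemma copy_placed_cball:
  assumes "copy 1 {1..k} (placed 0 1 y z)" "i \<in> {2..k}"
  shows "z i \<in> cball 0 (real D)"
proof -
  have "i \<in> {1..k}" "1 \<in> {1..k}" using assms(2) by auto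
  then have "dist (fst (placed 0 1 y z 1)) (fst (placed 0 1 y z i)) \<le> of_int (int D) * 1"
    by (intro copy_dist[OF assms(1)]) auto
  then show ?thesis using assms(2) by (simp add: placed_def)
qed

lemma kern_le_dom:
  assumes r: "r > 0"
  shows "kern r l (u, y, z) \<le> dom_kern (u, y, z)"
proof -
  have "(\<Prod>i\<in>{2..k}. f (u + r *\<^sub>R z i)) * copy_weight r l {1..k} (placed u r y z)
      \<le> (\<Prod>i\<in>{2..k}. B * indicator (cball 0 (real D)) (z i))"
  proof (cases "copy 1 {1..k} (placed 0 1 y z)")
    case True
    note zD = copy_placed_cball[OF True]
    have "(\<Prod>i\<in>{2..k}. f (u + r *\<^sub>R z i)) * copy_weight r l {1..k} (placed u r y z)
       \<le> (\<Prod>i\<in>{2..k}. f (u + r *\<^sub>R z i)) * 1"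
      by (intro mult_left_mono copy_weight_bounds prod_nonneg ballI f_nonneg)
    also have "\<dots> \<le> (\<Prod>i\<in>{2..k}. B * indicator (cball 0 (real D)) (z i))"
      unfolding mult_1_right using zD f_nonneg f_le by (intro prod_mono conjI) simp_all
    finally show ?thesis .
  next
    case False
    then show ?thesis
      unfolding copy_weight_def copy_placed[OF r] if_not_P[OF False]
      using B_nonneg by (simp add: prod_nonneg)
  qed
  then have "f u * angle_prod y * ((\<Prod>i\<in>{2..k}. f (u + r *\<^sub>R z i)) * copy_weight r l {1..k} (placed u r y z))
     \<le> f u * angle_prod y * (\<Prod>i\<in>{2..k}. B * indicator (cball 0 (real D)) (z i))"
    by (rule mult_left_mono) (intro mult_nonneg_nonneg prod_nonneg ballI f_nonneg angle_density_nonneg)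
  then show ?thesis by (simp add: kern_def dom_kern_def mult.assoc)
qed

lemma placed_component_measurable:
  assumes "i \<in> {1..k}"
  shows "(\<lambda>p. placed (fst p) r (fst (snd p)) (snd (snd p)) i) \<in> full \<rightarrow>\<^sub>M borel \<Otimes>\<^sub>M borel"
  using measurable_compose[OF placed_measurable component_mark[OF assms]]
  by (simp only: case_prod_unfold)

lemma placed0_component_measurable:
  assumes "i \<in> {1..k}"
  shows "(\<lambda>q. placed 0 1 (fst q) (snd q) i) \<in> shapes \<rightarrow>\<^sub>M borel \<Otimes>\<^sub>M borel"
proof -
  have "(\<lambda>q. (0, q)) \<in> shapes \<rightarrow>\<^sub>M full"
    by (rule measurable_Pair1') simp
  from measurable_compose[OF this placed_component_measurable[OF assms]] show ?thesis
    by (simp only: fst_conv snd_conv)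
qed

lemma full_factor_measurable:
  "(\<lambda>p. f (fst p)) \<in> borel_measurable full"
  "(\<lambda>p. angle_prod (fst (snd p))) \<in> borel_measurable full"
  by (intro borel_measurable_prod measurable_compose[OF full_component_measurable(1) f_measurable]
      measurable_compose[OF full_component_measurable(2) angle_density_measurable]; assumption)+

lemma kern_measurable:
  assumes "r > 0"
  shows "kern r l \<in> borel_measurable full"
proof -
  have cw: "(\<lambda>p. copy_weight r l {1..k} (placed (fst p) r (fst (snd p)) (snd (snd p)))) \<in> borel_measurable full"
    using measurable_compose[OF placed_measurable copy_weight_measurable[OF assms finite_atLeastAtMost, of l]]
    by (simp only: case_prod_unfold)
  have 3: "(\<lambda>p. \<Prod>i\<in>{2..k}. f (fst p + r *\<^sub>R snd (snd p) i)) \<in> borel_measurable full"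
    by (intro borel_measurable_prod measurable_compose[OF _ f_measurable] borel_measurable_add borel_measurable_scaleR
        full_component_measurable borel_measurable_const)
  show ?thesis
    unfolding kern_def case_prod_unfold by (intro borel_measurable_times full_factor_measurable 3 cw)
qed

lemma exp_weight_measurable:
  assumes t: "t \<in> borel_measurable full"
  shows "(\<lambda>p. exp_weight (t p) (fst (snd p)) (snd (snd p))) \<in> borel_measurable full"
proof -
  have c: "(\<lambda>p. placed 0 1 (fst (snd p)) (snd (snd p)) i) \<in> full \<rightarrow>\<^sub>M borel \<Otimes>\<^sub>M borel" if "i \<in> {1..k}" for i
    using measurable_compose[OF measurable_snd placed0_component_measurable[OF that]] .
  have cp: "Measurable.pred full (\<lambda>p. copy 1 {1..k} (placed 0 1 (fst (snd p)) (snd (snd p))))"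
    by (rule pred_copy[OF zero_less_one finite_atLeastAtMost c])
  have re: "(\<lambda>p. measure lborel (reach \<alpha> 1 {1..k} (placed 0 1 (fst (snd p)) (snd (snd p))))) \<in> borel_measurable full"
    by (rule borel_measurable_measure_reach[OF lborel.sigma_finite_measure_axioms sets_lborel zero_less_one finite_atLeastAtMost c])
  show ?thesis
    unfolding exp_weight_def
    by (rule measurable_If[OF _ _ predE[OF cp]])
       (intro measurable_compose[OF _ borel_measurable_exp] borel_measurable_times borel_measurable_uminus t re borel_measurable_const)+
qed

lemma lim_kern_measurable: "lim_kern \<Lambda> \<in> borel_measurable full"
proof -
  show ?thesis
    unfolding lim_kern_def case_prod_unfold
    by (intro borel_measurable_times borel_measurable_power full_factor_measurable exp_weight_measurable borel_measurable_const)
qed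

lemma dom_kern_integrable: "integrable full dom_kern"
proof -
  interpret PL: product_sigma_finite "\<lambda>_. lborel :: real measure" ..
  interpret PL2: product_sigma_finite "\<lambda>_. lborel :: (real^2) measure" ..
  let ?a = "\<lambda>y. \<Prod>i\<in>{1..k}. angle_density (y i)" and ?b = "\<lambda>z. \<Prod>i\<in>{2..k}. B * indicator (cball 0 (real D)) (z i)"
  have cb [measurable]: "cball (0 :: real^2) (real D) \<in> sets borel"
    by (intro borel_closed closed_cball)
  have 3: "(\<lambda>p. ?b (snd (snd p))) \<in> borel_measurable full"
    by (intro borel_measurable_prod borel_measurable_times borel_measurable_const
        measurable_compose[OF full_component_measurable(3) borel_measurable_indicator] cb)
  have meas: "dom_kern \<in> borel_measurable full"
    unfolding dom_kern_def case_prod_unfold by (intro borel_measurable_times full_factor_measurable 3)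
  have a: "(\<lambda>y. ennreal (?a y)) \<in> borel_measurable angles"
    by (intro measurable_compose[OF _ measurable_ennreal] borel_measurable_prod
        measurable_compose[OF measurable_component_singleton]) simp_all
  have b: "(\<lambda>z. ennreal (?b z)) \<in> borel_measurable offsets"
    by (intro measurable_compose[OF _ measurable_ennreal] borel_measurable_prod borel_measurable_times borel_measurable_const
        measurable_compose[OF measurable_component_singleton borel_measurable_indicator]) (simp_all add: cb)
  have a_int: "(\<integral>\<^sup>+y. ennreal (?a y) \<partial>angles) = 1"
  proof -
    have "(\<integral>\<^sup>+y. ennreal (?a y) \<partial>angles) = (\<integral>\<^sup>+y. (\<Prod>i\<in>{1..k}. ennreal (angle_density (y i))) \<partial>angles)"
      by (simp add: prod_ennreal)
    also have "\<dots> = 1"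
      by (subst PL.product_nn_integral_prod) (simp_all add: nn_integral_angle_density)
    finally show ?thesis .
  qed
  have b_int: "(\<integral>\<^sup>+z. ennreal (?b z) \<partial>offsets) < \<infinity>"
  proof -
    have "(\<integral>\<^sup>+z. ennreal (?b z) \<partial>offsets) = (\<integral>\<^sup>+z. (\<Prod>i\<in>{2..k}. ennreal B * indicator (cball 0 (real D)) (z i)) \<partial>offsets)"
      using B_nonneg by (intro nn_integral_cong) (auto simp: prod_ennreal[symmetric] ennreal_mult ennreal_indicator)
    also have "\<dots> = (\<Prod>i\<in>{2..k}. (\<integral>\<^sup>+z. ennreal B * indicator (cball 0 (real D)) z \<partial>(lborel :: (real^2) measure)))"
      by (rule PL2.product_nn_integral_prod) (simp_all add: cb)
    also have "\<dots> < \<infinity>"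
      using emeasure_compact_finite[OF compact_cball[of "0 :: real^2" "real D"]]
      by (simp add: nn_integral_cmult_indicator ennreal_mult_less_top power_less_top_ennreal)
    finally show ?thesis .
  qed
  have f_int: "(\<integral>\<^sup>+u. ennreal (f u) \<partial>lborel) = 1"
    using point.emeasure_space_1 by (simp add: point_law_def emeasure_density)
  have "(\<integral>\<^sup>+p. ennreal (dom_kern p) \<partial>full) = (\<integral>\<^sup>+u. \<integral>\<^sup>+q. ennreal (dom_kern (u, q)) \<partial>shapes \<partial>lborel)"
    by (rule shapes.nn_integral_fst[symmetric]) (rule measurable_compose[OF meas measurable_ennreal])
  also have "\<dots> = (\<integral>\<^sup>+u. ennreal (f u) * (\<integral>\<^sup>+z. ennreal (?b z) \<partial>offsets) \<partial>lborel)"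
  proof (rule nn_integral_cong)
    fix u
    have "(\<integral>\<^sup>+q. ennreal (dom_kern (u, q)) \<partial>shapes) = (\<integral>\<^sup>+y. \<integral>\<^sup>+z. ennreal (dom_kern (u, y, z)) \<partial>offsets \<partial>angles)"
    proof (rule offsets.nn_integral_fst[symmetric])
      have "(\<lambda>q. (u, q)) \<in> shapes \<rightarrow>\<^sub>M full" by (rule measurable_Pair1') simp
      then show "(\<lambda>q. ennreal (dom_kern (u, q))) \<in> borel_measurable shapes"
        by (rule measurable_compose[OF _ measurable_compose[OF meas measurable_ennreal]])
    qed
    also have "\<dots> = (\<integral>\<^sup>+y. \<integral>\<^sup>+z. ennreal (f u) * ennreal (?a y) * ennreal (?b z) \<partial>offsets \<partial>angles)"
      using f_nonneg B_nonneg by (simp add: dom_kern_def ennreal_mult prod_nonneg)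
    also have "\<dots> = (\<integral>\<^sup>+y. ennreal (f u) * ennreal (?a y) * (\<integral>\<^sup>+z. ennreal (?b z) \<partial>offsets) \<partial>angles)"
      by (intro nn_integral_cong nn_integral_cmult b)
    also have "\<dots> = (\<integral>\<^sup>+y. ennreal (f u) * ennreal (?a y) \<partial>angles) * (\<integral>\<^sup>+z. ennreal (?b z) \<partial>offsets)"
      using a by (intro nn_integral_multc) simp
    also have "\<dots> = ennreal (f u) * (\<integral>\<^sup>+z. ennreal (?b z) \<partial>offsets)"
      by (simp only: nn_integral_cmult[OF a] a_int mult_1_right)
    finally show "(\<integral>\<^sup>+q. ennreal (dom_kern (u, q)) \<partial>shapes) = ennreal (f u) * (\<integral>\<^sup>+z. ennreal (?b z) \<partial>offsets)" .
  qed
  also have "\<dots> = (\<integral>\<^sup>+z. ennreal (?b z) \<partial>offsets)"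
    by (subst nn_integral_multc) (simp_all add: f_int)
  finally have fin: "(\<integral>\<^sup>+p. ennreal (dom_kern p) \<partial>full) < \<infinity>" using b_int by simp
  have "0 \<le> dom_kern p" for p
    unfolding dom_kern_def case_prod_unfold
    using B_nonneg by (intro mult_nonneg_nonneg prod_nonneg ballI f_nonneg angle_density_nonneg) simp_all
  then show ?thesis using fin by (intro integrableI_bounded meas) simp
qed

lemma kern_integrable:
  assumes "r > 0"
  shows "integrable full (kern r l)"
proof (rule Bochner_Integration.integrable_bound[OF dom_kern_integrable kern_measurable[OF assms]])
  show "AE p in full. norm (kern r l p) \<le> norm (dom_kern p)"
    using kern_le_dom[OF assms] kern_nonneg[of r l]
    by (intro AE_I2) (auto simp: abs_of_nonneg intro: order_trans[OF _ abs_ge_self])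
qed

lemma kern_lim:
  assumes r: "\<And>n. r n > 0" "r \<longlonglongrightarrow> 0" and \<Lambda>: "(\<lambda>n. real n * (r n)\<^sup>2) \<longlonglongrightarrow> \<Lambda>"
    and cont: "AE u in lborel. isCont f u"
  shows "integrable full (lim_kern \<Lambda>)"
    and "(\<lambda>n. \<integral>p. kern (r n) (n - k) p \<partial>full) \<longlonglongrightarrow> (\<integral>p. lim_kern \<Lambda> p \<partial>full)"
proof -
  have "AE p in full. isCont f (fst p)"
    by (rule AE_pair_fst[OF shapes.sigma_finite_measure_axioms cont])
  then have lim: "AE p in full. (\<lambda>n. kern (r n) (n - k) p) \<longlonglongrightarrow> lim_kern \<Lambda> p"
  proof eventually_elim
    case (elim p)
    from kern_tendsto[OF r \<Lambda> elim, of "fst (snd p)" "snd (snd p)"] show ?case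
      by (simp only: prod.collapse)
  qed
  have bound: "AE p in full. norm (kern (r n) (n - k) p) \<le> dom_kern p" for n
  proof (rule AE_I2)
    fix p
    have "kern (r n) (n - k) p \<le> dom_kern p"
      using kern_le_dom[OF r(1), of n "n - k" "fst p" "fst (snd p)" "snd (snd p)"] by (simp only: prod.collapse)
    then show "norm (kern (r n) (n - k) p) \<le> dom_kern p"
      using kern_nonneg[of "r n" "n - k" p] by simp
  qed
  note dct = lim_kern_measurable kern_measurable[OF r(1)] dom_kern_integrable lim bound
  show "integrable full (lim_kern \<Lambda>)"
    by (rule integrable_dominated_convergence[OF dct])
  show "(\<lambda>n. \<integral>p. kern (r n) (n - k) p \<partial>full) \<longlonglongrightarrow> (\<integral>p. lim_kern \<Lambda> p \<partial>full)"
    by (rule integral_dominated_convergence[OF dct])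
qed

end

section \<open>Assembling the limit of the mean\<close>

lemma tendsto_binomial_div_power:
  "(\<lambda>n. real (n choose k) / real n ^ k) \<longlonglongrightarrow> 1 / fact k"
proof -
  have "(\<lambda>n. (\<Prod>i\<in>{0..<k}. 1 - real i * (1 / real n)) / fact k) \<longlonglongrightarrow> (\<Prod>i\<in>{0..<k}. 1 - real i * 0) / fact k"
    by (intro tendsto_intros lim_1_over_n) simp
  moreover have "\<forall>\<^sub>F n in sequentially. (\<Prod>i\<in>{0..<k}. 1 - real i * (1 / real n)) / fact k = real (n choose k) / real n ^ k"
  proof (rule eventually_mono[OF eventually_gt_at_top[of 0]])
    fix n :: nat assume n: "0 < n"
    have "real (n choose k) = (\<Prod>i\<in>{0..<k}. real n - real i) / fact k"
      by (simp add: binomial_gbinomial gbinomial_prod_rev)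
    also have "(\<Prod>i\<in>{0..<k}. real n - real i) = (\<Prod>i\<in>{0..<k}. real n * (1 - real i * (1 / real n)))"
      using n by (intro prod.cong) (auto simp: field_simps)
    also have "\<dots> = real n ^ k * (\<Prod>i\<in>{0..<k}. 1 - real i * (1 / real n))"
      by (simp add: prod.distrib)
    finally show "(\<Prod>i\<in>{0..<k}. 1 - real i * (1 / real n)) / fact k = real (n choose k) / real n ^ k"
      using n by simp
  qed
  ultimately have "(\<lambda>n. real (n choose k) / real n ^ k) \<longlonglongrightarrow> (\<Prod>i\<in>{0..<k}. 1 - real i * 0) / fact k"
    by (rule Lim_transform_eventually)
  then show ?thesis by simp
qed

context sector_process
begin

lemma nn_integral_copy_weight:
  assumes r: "r > 0"
  shows "(\<integral>\<^sup>+x. ennreal (copy_weight r l {1..k} x) \<partial>marks {1..k})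
    = ennreal (r ^ (2 * (k - 1)) * (\<integral>p. kern r l p \<partial>full))"
proof -
  let ?c = "r ^ (2 * (k - 1))"
  have pt: "ennreal (f u) * (\<Prod>i\<in>{1..k}. ennreal (angle_density (y i))) *
      ((\<Prod>i\<in>{2..k}. ennreal (r\<^sup>2 * f (u + r *\<^sub>R z i))) * ennreal (copy_weight r l {1..k} (placed u r y z)))
      = ennreal (?c * kern r l (u, y, z))" for u y z
  proof -
    have a: "(\<Prod>i\<in>{1..k}. ennreal (angle_density (y i))) = ennreal (angle_prod y)"
      by (rule prod_ennreal) simp
    have "(\<Prod>i\<in>{2..k}. ennreal (r\<^sup>2 * f (u + r *\<^sub>R z i))) = ennreal (\<Prod>i\<in>{2..k}. r\<^sup>2 * f (u + r *\<^sub>R z i))"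
      by (rule prod_ennreal) (simp add: f_nonneg)
    also have "(\<Prod>i\<in>{2..k}. r\<^sup>2 * f (u + r *\<^sub>R z i)) = ?c * (\<Prod>i\<in>{2..k}. f (u + r *\<^sub>R z i))"
      by (simp add: prod.distrib power_mult)
    finally have b: "(\<Prod>i\<in>{2..k}. ennreal (r\<^sup>2 * f (u + r *\<^sub>R z i))) = ennreal (?c * (\<Prod>i\<in>{2..k}. f (u + r *\<^sub>R z i)))" .
    have nn: "0 \<le> f u" "0 \<le> (angle_prod y)" "0 \<le> ?c * (\<Prod>i\<in>{2..k}. f (u + r *\<^sub>R z i))"
      "0 \<le> copy_weight r l {1..k} (placed u r y z)"
      using r f_nonneg copy_weight_bounds by (auto intro!: prod_nonneg mult_nonneg_nonneg)
    show ?thesis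
      unfolding a b kern_def prod.case
      by (simp only: ennreal_mult[symmetric] nn mult_nonneg_nonneg) (simp only: mult_ac)
  qed
  have meas: "(\<lambda>p. ennreal (?c * kern r l p)) \<in> borel_measurable full"
    by (intro measurable_compose[OF _ measurable_ennreal] borel_measurable_times borel_measurable_const kern_measurable r)
  have "(\<integral>\<^sup>+x. ennreal (copy_weight r l {1..k} x) \<partial>marks {1..k})
    = (\<integral>\<^sup>+u. \<integral>\<^sup>+y. \<integral>\<^sup>+z. ennreal (?c * kern r l (u, y, z)) \<partial>offsets \<partial>angles \<partial>lborel)"
    unfolding pt[symmetric]
    by (rule nn_integral_marks[OF r])
       (rule measurable_compose[OF copy_weight_measurable[OF r finite_atLeastAtMost] measurable_ennreal])
  also have "\<dots> = (\<integral>\<^sup>+u. \<integral>\<^sup>+q. ennreal (?c * kern r l (u, q)) \<partial>shapes \<partial>lborel)"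
  proof (intro nn_integral_cong offsets.nn_integral_fst)
    fix u :: "real^2"
    have "(\<lambda>q. (u, q)) \<in> shapes \<rightarrow>\<^sub>M full" by (rule measurable_Pair1') simp
    then show "(\<lambda>q. ennreal (?c * kern r l (u, q))) \<in> borel_measurable shapes"
      by (rule measurable_compose[OF _ meas])
  qed
  also have "\<dots> = (\<integral>\<^sup>+p. ennreal (?c * kern r l p) \<partial>full)"
    by (rule shapes.nn_integral_fst[OF meas])
  also have "\<dots> = ennreal (\<integral>p. ?c * kern r l p \<partial>full)"
    using r kern_nonneg
    by (intro nn_integral_eq_integral integrable_mult_right kern_integrable AE_I2) auto
  also have "(\<integral>p. ?c * kern r l p \<partial>full) = ?c * (\<integral>p. kern r l p \<partial>full)"
    by (rule integral_mult_right_zero)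
  finally show ?thesis .
qed

lemma iso_copies_bounded:
  assumes "finite I"
  shows "\<bar>real (card (iso_copies r I z))\<bar> \<le> real (card I ^ card V)"
    and "\<bar>real (card (sparse_copies K r I z))\<bar> \<le> real (card I ^ card V)"
proof -
  show "\<bar>real (card (iso_copies r I z))\<bar> \<le> real (card I ^ card V)"
    using card_iso_copies_le[OF assms] by (simp del: of_nat_power)
  have "card (sparse_copies K r I z) \<le> card (iso_copies r I z)"
    by (intro card_mono finite_iso_copies assms) (auto simp: sparse_copies_def)
  then show "\<bar>real (card (sparse_copies K r I z))\<bar> \<le> real (card I ^ card V)"
    using card_iso_copies_le[OF assms, of r z] by (simp del: of_nat_power)
qed

lemma integral_iso_copies:
  assumes r: "r > 0" and fin: "finite I"
  shows "(\<integral>z. real (card (iso_copies r I z)) \<partial>marks I)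
    = real (card I choose k) * (r ^ (2 * (k - 1)) * (\<integral>p. kern r (card I - k) p \<partial>full))"
proof -
  let ?P = "marks I"
  interpret P: prob_space ?P by (rule prob_space_PiM) (rule mark.prob_space_axioms)
  let ?J = "\<integral>p. kern r (card I - k) p \<partial>full"
  have J: "0 \<le> ?J" by (rule Bochner_Integration.integral_nonneg) (rule kern_nonneg)
  have int: "integrable ?P (\<lambda>z. real (card (iso_copies r I z)))"
    using iso_copies_bounded(1)[OF fin]
    by (intro P.integrable_const_bound[where B="real (card I ^ card V)"] iso_copies_measurable r fin AE_I2) simp
  have "ennreal (\<integral>z. real (card (iso_copies r I z)) \<partial>?P) = (\<integral>\<^sup>+z. ennreal (real (card (iso_copies r I z))) \<partial>?P)"
    by (rule nn_integral_eq_integral[OF int, symmetric]) simp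
  also have "\<dots> = of_nat (card I choose k) * ennreal (r ^ (2 * (k - 1)) * ?J)"
    unfolding nn_integral_iso_copies[OF r fin] nn_integral_copy_weight[OF r] ..
  also have "\<dots> = ennreal (real (card I choose k) * (r ^ (2 * (k - 1)) * ?J))"
    using r J by (simp add: ennreal_of_nat_eq_real_of_nat ennreal_mult)
  finally show ?thesis
    using r J by (subst (asm) ennreal_inj) (auto intro!: Bochner_Integration.integral_nonneg)
qed

definition shape_integral :: "real \<Rightarrow> real" where
  "shape_integral t = (\<integral>q. angle_prod (fst q) * exp_weight t (fst q) (snd q) \<partial>shapes)"

text \<open>A form of \<open>phi\<close> that covers \<open>k = 1\<close> without a case
  distinction: the angular densities take over the domain of integration and the factor
  \<open>(2 * pi) ^ k\<close>.\<close>

definition phi_fun :: "real \<Rightarrow> real" where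
  "phi_fun t = t ^ (k - 1) / fact (k - 1) * shape_integral t"

text \<open>The binomial coefficient behaves like \<open>n ^ k / fact k\<close>. Divided by
  \<open>n\<close> and multiplied by the Jacobian, it leaves a power of
  \<open>n * r\<^sup>2\<close>, hence \<open>\<Lambda> ^ (k - 1)\<close>. The factor
  \<open>1 / k\<close> of the theorem is what remains of \<open>1 / fact k\<close> once
  \<open>phi_fun\<close> has taken \<open>1 / fact (k - 1)\<close>.\<close>

lemma mean_iso_copies_lim:
  assumes r: "\<And>n. r n > 0" "r \<longlonglongrightarrow> 0" and \<Lambda>: "(\<lambda>n. real n * (r n)\<^sup>2) \<longlonglongrightarrow> \<Lambda>"
    and cont: "AE u in lborel. isCont f u"
  shows "(\<lambda>n. (\<integral>z. real (card (iso_copies (r n) {1..n} z)) \<partial>marks {1..n}) / real n)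
    \<longlonglongrightarrow> (1 / real k) * (\<integral>u. phi_fun (\<Lambda> * f u) * f u \<partial>lborel)"
proof -
  let ?J = "\<integral>p. lim_kern \<Lambda> p \<partial>full"
  have "(\<lambda>n. (real (n choose k) / real n ^ k) * (real n * (r n)\<^sup>2) ^ (k - 1) * (\<integral>p. kern (r n) (n - k) p \<partial>full))
     \<longlonglongrightarrow> (1 / fact k) * \<Lambda> ^ (k - 1) * ?J"
    by (intro tendsto_mult tendsto_power tendsto_binomial_div_power \<Lambda> kern_lim(2)[OF r \<Lambda> cont])
  moreover have "\<forall>\<^sub>F n in sequentially. (real (n choose k) / real n ^ k) * (real n * (r n)\<^sup>2) ^ (k - 1) * (\<integral>p. kern (r n) (n - k) p \<partial>full)
     = (\<integral>z. real (card (iso_copies (r n) {1..n} z)) \<partial>marks {1..n}) / real n"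
  proof (rule eventually_mono[OF eventually_gt_at_top[of 0]])
    fix n :: nat assume n: "0 < n"
    have "real n ^ k = real n * real n ^ (k - 1)"
      using card_V_pos by (simp add: power_eq_if)
    moreover have "(real n * (r n)\<^sup>2) ^ (k - 1) = real n ^ (k - 1) * r n ^ (2 * (k - 1))"
      by (simp add: power_mult_distrib power_mult)
    ultimately have "(real (n choose k) / real n ^ k) * (real n * (r n)\<^sup>2) ^ (k - 1) = real (n choose k) * r n ^ (2 * (k - 1)) / real n"
      using n by simp
    then show "(real (n choose k) / real n ^ k) * (real n * (r n)\<^sup>2) ^ (k - 1) * (\<integral>p. kern (r n) (n - k) p \<partial>full)
     = (\<integral>z. real (card (iso_copies (r n) {1..n} z)) \<partial>marks {1..n}) / real n"
      using integral_iso_copies[OF r(1), of "{1..n}" n] by simp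
  qed
  ultimately have lim: "(\<lambda>n. (\<integral>z. real (card (iso_copies (r n) {1..n} z)) \<partial>marks {1..n}) / real n)
    \<longlonglongrightarrow> (1 / fact k) * \<Lambda> ^ (k - 1) * ?J"
    by (rule Lim_transform_eventually)
  have "?J = (\<integral>u. \<integral>q. lim_kern \<Lambda> (u, q) \<partial>shapes \<partial>lborel)"
    by (rule full.integral_fst'[OF kern_lim(1)[OF r \<Lambda> cont], symmetric])
  also have "\<dots> = (\<integral>u. f u * f u ^ (k - 1) * shape_integral (\<Lambda> * f u) \<partial>lborel)"
  proof (intro Bochner_Integration.integral_cong refl)
    fix u
    have "(\<integral>q. lim_kern \<Lambda> (u, q) \<partial>shapes) =
       (\<integral>q. (f u * f u ^ (k - 1)) * (angle_prod (fst q) * exp_weight (\<Lambda> * f u) (fst q) (snd q)) \<partial>shapes)"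
      by (intro Bochner_Integration.integral_cong refl) (simp add: lim_kern_def case_prod_unfold)
    then show "(\<integral>q. lim_kern \<Lambda> (u, q) \<partial>shapes) =
      f u * f u ^ (k - 1) * shape_integral (\<Lambda> * f u)"
      unfolding shape_integral_def by (simp only: integral_mult_right_zero)
  qed
  finally have J: "?J = (\<integral>u. f u * f u ^ (k - 1) * shape_integral (\<Lambda> * f u) \<partial>lborel)" .
  have "(1 / real k) * (\<integral>u. phi_fun (\<Lambda> * f u) * f u \<partial>lborel)
    = (1 / real k) * (\<integral>u. (\<Lambda> ^ (k - 1) / fact (k - 1)) * (f u * f u ^ (k - 1) * shape_integral (\<Lambda> * f u)) \<partial>lborel)"
    unfolding phi_fun_def power_mult_distrib by (simp only: times_divide_eq_left times_divide_eq_right mult_ac)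
  also have "\<dots> = (1 / real k) * ((\<Lambda> ^ (k - 1) / fact (k - 1)) * ?J)"
    unfolding J by (simp only: integral_mult_right_zero)
  also have "\<dots> = (1 / fact k) * \<Lambda> ^ (k - 1) * ?J"
    using card_V_pos by (simp add: fact_reduce)
  finally show ?thesis using lim by simp
qed

text \<open>A density with total mass \<open>1\<close> cannot vanish almost everywhere. The point
  found serves to divide an integrable section of \<open>dom_kern\<close> by
  \<open>f u\<close>.\<close>

lemma f_pos_somewhere: 
  assumes "AE u in lborel. P u"
  obtains u where "P u" "f u > 0"
proof -
  have "\<exists>u. P u \<and> f u > 0"
  proof (rule ccontr)
    assume "\<nexists>u. P u \<and> f u > 0"
    then have "AE u in lborel. f u = 0"
      using assms f_nonneg by (elim eventually_mono) (metis less_eq_real_def)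
    then have "(\<integral>\<^sup>+u. ennreal (f u) \<partial>lborel) = (\<integral>\<^sup>+u. 0 \<partial>(lborel :: (real^2) measure))"
      by (intro nn_integral_cong_AE) auto
    moreover have "(\<integral>\<^sup>+u. ennreal (f u) \<partial>lborel) = 1"
      using point.emeasure_space_1 by (simp add: point_law_def emeasure_density)
    ultimately show False by simp
  qed
  then show ?thesis using that by blast
qed

text \<open>The Bochner integral in \<open>phi\<close> is an iterated one, so Fubini requires
  integrability for every \<open>t \<ge> 0\<close>. It is read off from a section of the integrable
  majorant \<open>dom_kern\<close>.\<close>

lemma exp_weight_integrable:
  assumes t: "t \<ge> 0"
  shows "integrable shapes (\<lambda>q. angle_prod (fst q) * exp_weight t (fst q) (snd q))"
proof -
  obtain u where u: "integrable shapes (\<lambda>q. dom_kern (u, q))" "f u > 0"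
    using f_pos_somewhere[OF full.AE_integrable_fst'[OF dom_kern_integrable]] by blast
  have B: "B > 0" using u(2) f_le[of u] by simp
  \<comment> \<open>Cancels the factors \<open>f u\<close> and \<open>B\<close> of the section,
    leaving the angular densities and the indicators of the ball.\<close>
  let ?c = "1 / (f u * B ^ (k - 1))"
  have int: "integrable shapes (\<lambda>q. ?c * dom_kern (u, q))"
    by (rule integrable_mult_right[OF u(1)])
  have meas: "(\<lambda>q. angle_prod (fst q) * exp_weight t (fst q) (snd q)) \<in> borel_measurable shapes"
  proof -
    have P: "(\<lambda>q. (0 :: real^2, q)) \<in> shapes \<rightarrow>\<^sub>M full" by (rule measurable_Pair1') simp
    have 2: "(\<lambda>p. exp_weight t (fst (snd p)) (snd (snd p))) \<in> borel_measurable full"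
      by (rule exp_weight_measurable) (rule borel_measurable_const)
    from measurable_compose[OF P borel_measurable_times[OF full_factor_measurable(2) 2]] show ?thesis by (simp only: snd_conv)
  qed
  have bound: "norm (angle_prod (fst q) * exp_weight t (fst q) (snd q)) \<le> norm (?c * dom_kern (u, q))" for q
  proof -
    obtain y z where q: "q = (y, z)" by (cases q)
    have a: "0 \<le> (angle_prod y)" by (intro prod_nonneg) simp
    have e: "0 \<le> exp_weight t y z" by (simp add: exp_weight_def)
    have dom: "?c * dom_kern (u, q) = angle_prod y * (\<Prod>i\<in>{2..k}. indicator (cball 0 (real D)) (z i))"
      using u(2) B by (simp add: q dom_kern_def prod.distrib)
    have "exp_weight t y z \<le> (\<Prod>i\<in>{2..k}. indicator (cball 0 (real D)) (z i))"
    proof (cases "copy 1 {1..k} (placed 0 1 y z)")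
      case True
      have "(\<Prod>i\<in>{2..k}. indicator (cball 0 (real D)) (z i) :: real) = 1"
        using copy_placed_cball[OF True] by (intro prod.neutral) simp
      moreover have "exp_weight t y z \<le> 1"
        using True t by (simp add: exp_weight_def)
      ultimately show ?thesis by simp
    next
      case False
      then show ?thesis unfolding exp_weight_def if_not_P[OF False] by (intro prod_nonneg) simp
    qed
    then have "angle_prod y * exp_weight t y z \<le> ?c * dom_kern (u, q)"
      unfolding dom using a by (rule mult_left_mono)
    moreover have "0 \<le> (angle_prod y) * exp_weight t y z"
      using a e by (rule mult_nonneg_nonneg)
    ultimately show ?thesis by (simp only: q fst_conv snd_conv real_norm_def)
  qed
  show ?thesis
    by (rule Bochner_Integration.integrable_bound[OF int meas AE_I2[OF bound]])
qed

end

section \<open>Identification of the limit\<close>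

lemma integral_angle_density_prod:
  fixes n :: nat
  shows
  "integral\<^sup>L (PiM {1..n} (\<lambda>_. lborel)) (\<lambda>y. \<Prod>i\<in>{1..n}. angle_density (y i)) = 1"
proof -
  interpret PL: product_sigma_finite "\<lambda>_. lborel :: real measure" ..
  have "(\<lambda>y. \<Prod>i\<in>{1..n}. angle_density (y i)) \<in> borel_measurable (PiM {1..n} (\<lambda>_. lborel))"
    by (intro borel_measurable_prod measurable_compose[OF measurable_component_singleton]) simp_all
  then have "integral\<^sup>L (PiM {1..n} (\<lambda>_. lborel)) (\<lambda>y. \<Prod>i\<in>{1..n}. angle_density (y i))
    = enn2real (\<integral>\<^sup>+y. ennreal (\<Prod>i\<in>{1..n}. angle_density (y i)) \<partial>PiM {1..n} (\<lambda>_. lborel))"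
    by (intro integral_eq_nn_integral AE_I2 prod_nonneg) simp_all
  also have "(\<integral>\<^sup>+y. ennreal (\<Prod>i\<in>{1..n}. angle_density (y i)) \<partial>PiM {1..n} (\<lambda>_. lborel))
    = (\<integral>\<^sup>+y. (\<Prod>i\<in>{1..n}. ennreal (angle_density (y i))) \<partial>PiM {1..n} (\<lambda>_. lborel))"
    by (simp add: prod_ennreal)
  also have "\<dots> = 1"
    by (subst PL.product_nn_integral_prod) (simp_all add: nn_integral_angle_density)
  finally show ?thesis by simp
qed

context sector_process
begin

text \<open>For \<open>k \<ge> 2\<close> the two sides differ only in how the cube of angles is
  written. For \<open>k = 1\<close> a single point always forms a copy, and its reach is one sector,
  of area \<alpha> / 2.\<close>

lemma phi_eq_phi_fun:
  fixes T :: "('v, 'e) pre_digraph"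
  assumes T: "digraph T" and V: "V = verts T" and E: "E = arc_rel T"
    and \<alpha>: "0 < \<alpha>" "\<alpha> \<le> 2 * pi" and t: "t \<ge> 0"
  shows "phi \<alpha> T t = phi_fun t"
proof -
  have place: "placed 0 1 y z i = ((z(1 := 0)) i, y i)" if "i \<in> {1..k}" for y z i
    using that by (simp only: placed_def restrict_apply' scaleR_one add_0)
  have copy_iff: "copy 1 {1..k} (placed 0 1 y z) \<longleftrightarrow> digraph_iso (sector_digraph \<alpha> {1..k} (z(1 := 0)) y 1) T" for y z
    unfolding sector_digraph_iso_iff[OF T] copy_def V[symmetric] E[symmetric] rel_iso_def sees_def
    by (intro arg_cong[where f=Ex] ext conj_cong refl ball_cong) (simp only: place fst_conv snd_conv)
  have reach_eq: "reach \<alpha> 1 {1..k} (placed 0 1 y z) = (\<Union>i\<in>{1..k}. sector \<alpha> ((z(1 := 0)) i) (y i) 1)" for y z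
    unfolding reach_def by (intro SUP_cong refl) (simp only: place fst_conv snd_conv)
  have ew: "exp_weight t y z = h_T \<alpha> T (z(1 := 0)) y * exp (- t * measure lborel (\<Union>i\<in>{1..k}. sector \<alpha> ((z(1 := 0)) i) (y i) 1))" for y z
    unfolding exp_weight_def h_T_def V[symmetric] copy_iff reach_eq by (cases "digraph_iso (sector_digraph \<alpha> {1..k} (z(1 := 0)) y 1) T") simp_all
  have "shape_integral t
    = (\<integral>y. \<integral>z. angle_prod y * exp_weight t y z \<partial>offsets \<partial>angles)"
    unfolding shape_integral_def using shapes.integral_fst'[OF exp_weight_integrable[OF t]] by (simp only: fst_conv snd_conv)
  also have "\<dots> = (\<integral>y. angle_prod y * (\<integral>z. exp_weight t y z \<partial>offsets) \<partial>angles)"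
    by (simp only: integral_mult_right_zero)
  finally have Q: "shape_integral t
    = (\<integral>y. angle_prod y * (\<integral>z. exp_weight t y z \<partial>offsets) \<partial>angles)" .
  show ?thesis
  proof (cases "k = 1")
    case True
    then obtain v where v: "V = {v}" by (auto simp: card_1_singleton_iff)
    \<comment> \<open>With a loop at \<open>v\<close> no point could form a copy, since
      \<open>copy\<close> compares loops of the pattern with an irreflexive relation.\<close>
    have loop: "\<not> E v v"
    proof -
      interpret T: digraph T by fact
      show ?thesis unfolding E arc_rel_def
      proof
        assume "\<exists>e\<in>arcs T. tail T e = v \<and> head T e = v"
        then obtain e where "e \<in> arcs T" "tail T e = v" "head T e = v" by blast
        then show False using T.no_loops[of e] by simp
      qed
    qed
    have one: "{1..k} = {1}" using True by simp
    have cp: "copy 1 {1..k} (placed 0 1 y z)" for y z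
      unfolding copy_def rel_iso_def one
    proof (intro exI[of _ "\<lambda>_. v"] conjI ballI)
      show "bij_betw (\<lambda>_. v) {1 :: nat} V" unfolding v by (simp add: bij_betw_def)
    qed (simp add: loop)
    have ew1: "exp_weight t y z = exp (- t * \<alpha> / 2)" for y z
    proof -
      have "reach \<alpha> 1 {1..k} (placed 0 1 y z) = (\<Union>i\<in>{1}. sector \<alpha> ((z(1 := 0)) i) (y i) 1)"
        unfolding reach_eq by (simp only: one)
      then have "measure lborel (reach \<alpha> 1 {1..k} (placed 0 1 y z)) = \<alpha> / 2"
        by (simp only: UN_insert UN_empty Un_empty_right fun_upd_same measure_sector[OF \<alpha>])
      then show ?thesis
        unfolding exp_weight_def if_P[OF cp] by simp
    qed
    \<comment> \<open>For \<open>k = 1\<close> there are no offsets and the product measure is the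
      unit mass on the empty tuple.\<close>
    have "measure offsets (space offsets) = 1"
      using True by (simp add: PiM_empty)
    then have inner: "(\<integral>z. exp_weight t y z \<partial>offsets) = exp (- t * \<alpha> / 2)" for y
      by (simp only: ew1 lebesgue_integral_const real_scaleR_def mult_1_left)
    have "(\<integral>y. angle_prod y * (\<integral>z. exp_weight t y z \<partial>offsets) \<partial>angles) = exp (- t * \<alpha> / 2)"
      unfolding inner by (simp only: integral_mult_left_zero integral_angle_density_prod mult_1_left)
    then have "phi_fun t = exp (- t * \<alpha> / 2)"
      unfolding phi_fun_def Q using True by simp
    moreover have "phi \<alpha> T t = exp (- t * \<alpha> / 2)"
      using True V by (simp add: phi_def)
    ultimately show ?thesis by simp
  next
    case False
    \<comment> \<open>Membership in \<open>Pi\<^sub>E\<close> also demands extensionality, which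
      holds only for \<open>y\<close> in the space of \<open>angles\<close>.\<close>
    have ind: "indicator (Pi\<^sub>E {1..k} (\<lambda>_. {0..2*pi})) y = (2*pi) ^ k * angle_prod y"
      if "y \<in> space angles" for y
    proof (cases "\<forall>i\<in>{1..k}. y i \<in> {0..2*pi}")
      case True
      then have "y \<in> Pi\<^sub>E {1..k} (\<lambda>_. {0..2*pi})" using that by (simp only: space_PiM PiE_iff simp_thms)
      moreover have "angle_prod y = (\<Prod>i\<in>{1..k}. 1 / (2*pi))"
        by (intro prod.cong refl) (use True in \<open>simp add: angle_density_def\<close>)
      ultimately show ?thesis by (simp add: power_divide)
    next
      case False
      then obtain i where i: "i \<in> {1..k}" "y i \<notin> {0..2*pi}" by blast
      then have "y \<notin> Pi\<^sub>E {1..k} (\<lambda>_. {0..2*pi})" by (auto simp: PiE_iff)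
      moreover have "angle_prod y = 0"
        by (rule prod_zero[OF _ bexI[OF _ i(1)]]) (use i(2) in \<open>simp_all add: angle_density_def\<close>)
      ultimately show ?thesis by simp
    qed
    have "phi \<alpha> T t = t ^ (k - 1) / (fact (k - 1) * (2 * pi) ^ k) *
        (\<integral>y. indicator (Pi\<^sub>E {1..k} (\<lambda>_. {0..2*pi})) y * (\<integral>z. exp_weight t y z \<partial>offsets) \<partial>angles)"
      unfolding phi_def Let_def V[symmetric] if_not_P[OF False] set_lebesgue_integral_def ew real_scaleR_def ..
    also have "(\<integral>y. indicator (Pi\<^sub>E {1..k} (\<lambda>_. {0..2*pi})) y * (\<integral>z. exp_weight t y z \<partial>offsets) \<partial>angles)
      = (\<integral>y. (2*pi) ^ k * (angle_prod y * (\<integral>z. exp_weight t y z \<partial>offsets)) \<partial>angles)"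
      by (intro Bochner_Integration.integral_cong refl) (simp only: ind mult.assoc)
    also have "\<dots> = (2*pi) ^ k * (\<integral>y. angle_prod y * (\<integral>z. exp_weight t y z \<partial>offsets) \<partial>angles)"
      by (rule integral_mult_right_zero)
    finally show ?thesis
      unfolding phi_fun_def Q by simp
  qed
qed

end

section \<open>Concentration\<close>

context sector_process
begin

text \<open>Off the event \<open>bad\<close>, the count and its truncation agree, and their means
  differ by at most \<open>t\<close>. So a deviation of the count by \<open>2 * t\<close> forces
  \<open>bad\<close> or a deviation of the truncated count by \<open>t\<close>, to which McDiarmid's
  inequality applies.\<close>

lemma tail_bound:
  fixes I :: "nat set"
  assumes r: "r > 0" and fin: "finite I" and ne: "I \<noteq> {}" and K: "K \<ge> 1" and t: "t > 0"
  defines "P \<equiv> marks I"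
  defines "pb \<equiv> real (card I) * exp (real (card I) * (B * r\<^sup>2)) / 2 ^ K"
  assumes pb: "real (card I) ^ k * pb \<le> t"
  shows "measure P {z \<in> space P. \<bar>real (card (iso_copies r I z)) - (\<integral>z. real (card (iso_copies r I z)) \<partial>P)\<bar> \<ge> 2 * t}
    \<le> pb + 2 * exp (- t\<^sup>2 / (2 * real (card I) * (real (diff_bound K))\<^sup>2))"
proof -
  interpret P: prob_space P unfolding P_def by (rule prob_space_PiM) (rule mark.prob_space_axioms)
  define H where "H z = real (card (iso_copies r I z))" for z
  define F where "F z = real (card (sparse_copies K r I z))" for z
  define bad where "bad = {z \<in> space P. \<exists>i\<in>I. \<not> crowd r I z i \<le> K}"
  have H_meas [measurable]: "H \<in> borel_measurable P" and F_meas [measurable]: "F \<in> borel_measurable P"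
    using iso_copies_measurable[OF r fin] by (simp_all add: H_def[abs_def] F_def[abs_def] P_def)
  have bad_i: "{z \<in> space P. \<not> crowd r I z i \<le> K} \<in> sets P" if "i \<in> I" for i
    using pred_crowd[OF fin that, of r K] unfolding P_def by (intro predE pred_intros_logic)
  have bad_eq: "bad = (\<Union>i\<in>I. {z \<in> space P. \<not> crowd r I z i \<le> K})" by (auto simp: bad_def)
  have bad_sets [measurable]: "bad \<in> sets P"
    unfolding bad_eq using fin bad_i by (intro sets.finite_UN)
  have "measure P bad \<le> (\<Sum>i\<in>I. measure P {z \<in> space P. \<not> crowd r I z i \<le> K})"
    unfolding bad_eq using bad_i by (intro P.finite_measure_subadditive_finite fin) auto
  also have "\<dots> \<le> (\<Sum>i\<in>I. exp (real (card I) * (B * r\<^sup>2)) / 2 ^ K)"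
    unfolding P_def by (intro sum_mono prob_crowd_le fin r)
  finally have bad_le: "measure P bad \<le> pb" by (simp add: pb_def)
  have HF: "H z = F z" if "z \<in> space P" "z \<notin> bad" for z
    using that sparse_copies_eq[of I r z K] by (simp add: H_def F_def bad_def)
  have Hb: "\<bar>H z\<bar> \<le> real (card I ^ k)" and Fb: "\<bar>F z\<bar> \<le> real (card I ^ k)" for z
    unfolding H_def F_def by (rule iso_copies_bounded[OF fin])+
  have intH: "integrable P H" by (rule P.integrable_const_bound[of _ "real (card I ^ k)"]) (use Hb in auto)
  have intF: "integrable P F" by (rule P.integrable_const_bound[of _ "real (card I ^ k)"]) (use Fb in auto)
  \<comment> \<open>Both counts lie between \<open>0\<close> and \<open>card I ^ k\<close>, so on
    \<open>bad\<close> they differ by at most that much.\<close>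
  have "\<bar>\<integral>z. H z - F z \<partial>P\<bar> \<le> (\<integral>z. real (card I ^ k) * indicator bad z \<partial>P)"
  proof (rule abs_integral_le)
    fix z assume z: "z \<in> space P"
    have "0 \<le> F z" "0 \<le> H z" by (simp_all add: F_def H_def)
    then have "\<bar>H z - F z\<bar> \<le> real (card I ^ k)" using Hb[of z] Fb[of z] by linarith
    then show "\<bar>H z - F z\<bar> \<le> real (card I ^ k) * indicator bad z"
      using HF[OF z] by (cases "z \<in> bad") simp_all
  next
    show "integrable P (\<lambda>z. real (card I ^ k) * indicator bad z)"
      by (intro integrable_mult_right integrable_real_indicator) (simp_all add: less_top[symmetric])
  qed (intro Bochner_Integration.integrable_diff intH intF)
  also have "(\<integral>z. real (card I ^ k) * indicator bad z \<partial>P) = real (card I ^ k) * measure P bad"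
    by simp
  also have "\<dots> \<le> real (card I) ^ k * pb"
    using bad_le by (simp add: mult_left_mono)
  finally have "\<bar>\<integral>z. H z - F z \<partial>P\<bar> \<le> t" using pb by linarith
  then have mean: "\<bar>(\<integral>z. H z \<partial>P) - (\<integral>z. F z \<partial>P)\<bar> \<le> t"
    by (simp add: Bochner_Integration.integral_diff[OF intH intF])
  have dpos: "real (diff_bound K) > 0" using K by (simp add: diff_bound_def)
  have F_tail: "measure P {z \<in> space P. \<bar>F z - (\<integral>z. F z \<partial>P)\<bar> \<ge> t} \<le> 2 * exp (- t\<^sup>2 / (2 * real (card I) * (real (diff_bound K))\<^sup>2))"
    unfolding P_def
  proof (rule mcdiarmid[OF mark.prob_space_axioms fin ne t dpos])
    show "F \<in> borel_measurable (marks I)" using F_meas by (simp add: P_def)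
    show "\<bar>F (x(i := a)) - F x\<bar> \<le> real (diff_bound K)" if "i \<in> I" for x i a
      unfolding F_def by (rule sparse_copies_bounded_diff[OF fin that r])
    show "\<bar>F x\<bar> \<le> real (card I ^ k)" for x by (rule Fb)
  qed
  have "measure P {z \<in> space P. \<bar>H z - (\<integral>z. H z \<partial>P)\<bar> \<ge> 2 * t}
      \<le> measure P (bad \<union> {z \<in> space P. \<bar>F z - (\<integral>z. F z \<partial>P)\<bar> \<ge> t})"
  proof (rule P.finite_measure_mono)
    show "{z \<in> space P. \<bar>H z - (\<integral>z. H z \<partial>P)\<bar> \<ge> 2 * t} \<subseteq> bad \<union> {z \<in> space P. \<bar>F z - (\<integral>z. F z \<partial>P)\<bar> \<ge> t}"
    proof
      fix z assume "z \<in> {z \<in> space P. \<bar>H z - (\<integral>z. H z \<partial>P)\<bar> \<ge> 2 * t}"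
      then have z: "z \<in> space P" "\<bar>H z - (\<integral>z. H z \<partial>P)\<bar> \<ge> 2 * t" by auto
      show "z \<in> bad \<union> {z \<in> space P. \<bar>F z - (\<integral>z. F z \<partial>P)\<bar> \<ge> t}"
      proof (cases "z \<in> bad")
        case False
        then have "\<bar>F z - (\<integral>z. F z \<partial>P)\<bar> \<ge> t" using HF[OF z(1)] z(2) mean by linarith
        then show ?thesis using z(1) by simp
      qed simp
    qed
  qed simp
  also have "\<dots> \<le> measure P bad + measure P {z \<in> space P. \<bar>F z - (\<integral>z. F z \<partial>P)\<bar> \<ge> t}"
    by (rule measure_Un_le) simp_all
  also have "\<dots> \<le> pb + 2 * exp (- t\<^sup>2 / (2 * real (card I) * (real (diff_bound K))\<^sup>2))"
    by (intro add_mono bad_le F_tail)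
  finally show ?thesis by (simp add: H_def)
qed

section \<open>Choice of the truncation level and summability\<close>

lemma tendsto_ln_power_div: "(\<lambda>n. ln (real n) ^ m / real n) \<longlonglongrightarrow> 0"
proof -
  have "filterlim (\<lambda>n. ln (real n)) at_top sequentially"
    by (rule filterlim_compose[OF ln_at_top filterlim_real_sequentially])
  from filterlim_compose[OF tendsto_power_div_exp_0 this, of m]
  have "(\<lambda>n. ln (real n) ^ m / exp (ln (real n))) \<longlonglongrightarrow> 0" .
  moreover have "\<forall>\<^sub>F n in sequentially. ln (real n) ^ m / exp (ln (real n)) = ln (real n) ^ m / real n"
    by (rule eventually_mono[OF eventually_gt_at_top[of 0]]) simp
  ultimately show ?thesis by (rule Lim_transform_eventually)
qed

text \<open>With \<open>t = \<epsilon> * n / 2\<close> in \<open>tail_bound\<close>, both error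
  terms are eventually bounded by a multiple of \<open>1 / n\<^sup>2\<close>.\<close>

lemma summable_tail:
  assumes r: "\<And>n. r n > 0" and \<Lambda>: "(\<lambda>n. real n * (r n)\<^sup>2) \<longlonglongrightarrow> \<Lambda>" and \<epsilon>: "\<epsilon> > 0"
  defines "P \<equiv> \<lambda>n. marks {1..n}"
  shows "summable (\<lambda>n. measure (P n) {z \<in> space (P n).
    \<bar>real (card (iso_copies (r n) {1..n} z)) - (\<integral>z. real (card (iso_copies (r n) {1..n} z)) \<partial>P n)\<bar> \<ge> \<epsilon> * real n})"
proof -
  \<comment> \<open>A cell has mass at most \<open>B * r\<^sup>2\<close>, so \<open>B * L\<close>
    bounds the expected number of points in a cell for all \<open>n\<close>, and the exponential
    factor in the Chernoff bound stays bounded.\<close>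
  obtain L where L: "\<And>n. real n * (r n)\<^sup>2 \<le> L"
  proof -
    obtain L where "\<forall>n. norm (real n * (r n)\<^sup>2) \<le> L"
      by (rule BseqE[OF convergent_imp_Bseq[OF convergentI[OF \<Lambda>]]])
    then have "real n * (r n)\<^sup>2 \<le> L" for n by (auto dest: abs_le_D1)
    then show ?thesis by (rule that)
  qed
  define q where "q n = nat \<lceil>log 2 (real n)\<rceil>" for n
  \<comment> \<open>Since \<open>2 ^ q n \<ge> n\<close>, this makes \<open>2 ^ K n\<close> at least
    \<open>n ^ (k + 3)\<close>: one power of \<open>n\<close> pays for the union bound over the
    points, \<open>k\<close> for the largest possible count in the comparison of means, and two
    remain for summability.\<close>
  define K where "K n = (k + 3) * q n" for n
  \<comment> \<open>Chosen so that \<open>diff_bound (K n)\<close> is eventually at most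
    \<open>(C * ln n) ^ k\<close>; the factor \<open>3\<close> comes from comparing
    \<open>q n\<close> with \<open>ln n\<close>.\<close>
  define C where "C = real (2 * (2 * D + 3)\<^sup>2 * (k + 3)) * 3"
  have q2: "real n \<le> 2 ^ q n" if "n \<ge> 1" for n
  proof -
    have "real n = 2 powr (log 2 (real n))" using that by simp
    also have "\<dots> \<le> 2 powr (real (q n))"
      unfolding q_def by (intro powr_mono) (auto simp: real_nat_ceiling_ge)
    also have "\<dots> = 2 ^ q n" by (simp add: powr_realpow)
    finally show ?thesis .
  qed
  have pb: "real n * exp (real n * (B * (r n)\<^sup>2)) / 2 ^ K n \<le> exp (B * L) / real n ^ (k + 2)" if n: "n \<ge> 1" for n
  proof -
    have "real n ^ (k + 3) \<le> (2 ^ q n) ^ (k + 3)" using q2[OF n] by (intro power_mono) auto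
    also have "\<dots> = 2 ^ K n" by (simp add: K_def power_mult[symmetric] mult.commute)
    finally have 1: "real n ^ (k + 3) \<le> 2 ^ K n" .
    have "real n * (B * (r n)\<^sup>2) = B * (real n * (r n)\<^sup>2)" by simp
    also have "\<dots> \<le> B * L" using L B_nonneg by (rule mult_left_mono)
    finally have 2: "exp (real n * (B * (r n)\<^sup>2)) \<le> exp (B * L)" by simp
    have "real n * exp (real n * (B * (r n)\<^sup>2)) / 2 ^ K n \<le> real n * exp (B * L) / real n ^ (k + 3)"
      using 1 2 n by (intro frac_le mult_left_mono) auto
    also have "\<dots> = exp (B * L) / real n ^ (k + 2)"
      using n by (simp add: power_add power3_eq_cube power2_eq_square)
    finally show ?thesis .
  qed
  \<comment> \<open>Rounding up costs \<open>1\<close>, which is eventually at most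
    \<open>ln n\<close>, and \<open>log 2 n \<le> 2 * ln n\<close> because
    \<open>ln 2 \<ge> 1 / 2\<close>.\<close>
  have qln: "\<forall>\<^sub>F n in sequentially. real (q n) \<le> 3 * ln (real n)"
  proof -
    have "\<forall>\<^sub>F n in sequentially. 1 \<le> ln (real n)" by real_asymp
    moreover have "\<forall>\<^sub>F n in sequentially. n \<ge> (1::nat)" by (rule eventually_ge_at_top)
    ultimately show ?thesis
    proof eventually_elim
      case (elim n)
      have "0 \<le> log 2 (real n)" using elim(2) by simp
      then have "real (q n) \<le> log 2 (real n) + 1" unfolding q_def by linarith
      moreover have "log 2 (real n) \<le> 2 * ln (real n)"
      proof -
        have "ln (real n) * 1 \<le> ln (real n) * (2 * ln 2)"
          using ln2_ge_two_thirds elim(1) by (intro mult_left_mono) auto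
        then show ?thesis by (simp add: log_def divide_le_eq mult_ac)
      qed
      ultimately show ?case using elim(1) by linarith
    qed
  qed
  have e0: "\<forall>\<^sub>F n in sequentially. exp (B * L) / real n ^ 2 \<le> \<epsilon> / 2 * real n"
    using \<epsilon> by real_asymp
  \<comment> \<open>For \<open>t = \<epsilon> * n / 2\<close> and difference bound \<open>d\<close>,
    the McDiarmid exponent is \<open>\<epsilon>\<^sup>2 * n / (8 * d\<^sup>2)\<close>. It reaches
    \<open>2 * ln n\<close>, which gives probability \<open>1 / n\<^sup>2\<close>, exactly when
    \<open>16 * d\<^sup>2 * ln n \<le> \<epsilon>\<^sup>2 * n\<close>.\<close>
  have lim: "(\<lambda>n. 16 * (C ^ k)\<^sup>2 / \<epsilon>\<^sup>2 * (ln (real n) ^ (2 * k + 1) / real n)) \<longlonglongrightarrow> 16 * (C ^ k)\<^sup>2 / \<epsilon>\<^sup>2 * 0"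
    by (intro tendsto_mult tendsto_const tendsto_ln_power_div)
  then have e1: "\<forall>\<^sub>F n in sequentially. 16 * (C ^ k)\<^sup>2 / \<epsilon>\<^sup>2 * (ln (real n) ^ (2 * k + 1) / real n) < 1"
    by (rule order_tendstoD) simp
  have bound: "\<forall>\<^sub>F n in sequentially. norm (measure (P n) {z \<in> space (P n).
    \<bar>real (card (iso_copies (r n) {1..n} z)) - (\<integral>z. real (card (iso_copies (r n) {1..n} z)) \<partial>P n)\<bar> \<ge> \<epsilon> * real n})
    \<le> (exp (B * L) + 2) * inverse (real n ^ 2)"
    \<comment> \<open>For \<open>n = 1\<close> both \<open>q n\<close> and \<open>ln n\<close>
      vanish, and the truncation level would be \<open>0\<close>.\<close>
    using qln e0 e1 eventually_ge_at_top[of 2]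
  proof eventually_elim
    case (elim n)
    then have n: "n \<ge> 2" by simp
    let ?t = "\<epsilon> / 2 * real n"
    let ?pb = "real n * exp (real n * (B * (r n)\<^sup>2)) / 2 ^ K n"
    have t: "?t > 0" using \<epsilon> n by simp
    have pbn: "?pb \<le> exp (B * L) / real n ^ (k + 2)" using pb n by simp
    have "q n \<ge> 1"
    proof (rule ccontr)
      assume "\<not> q n \<ge> 1"
      then have "q n = 0" by simp
      then show False using q2[of n] n by simp
    qed
    then have K: "K n \<ge> 1" by (simp add: K_def)
    have "real n ^ k * ?pb \<le> real n ^ k * (exp (B * L) / real n ^ (k + 2))"
      by (intro mult_left_mono pbn) simp
    also have "\<dots> = exp (B * L) / real n ^ 2" using n by (simp add: power_add power2_eq_square)
    also have "\<dots> \<le> ?t" by (rule elim(2))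
    finally have pbt: "real n ^ k * ?pb \<le> ?t" .
    have tb: "measure (P n) {z \<in> space (P n).
        \<bar>real (card (iso_copies (r n) {1..n} z)) - (\<integral>z. real (card (iso_copies (r n) {1..n} z)) \<partial>P n)\<bar> \<ge> 2 * ?t}
       \<le> ?pb + 2 * exp (- ?t\<^sup>2 / (2 * real n * (real (diff_bound (K n)))\<^sup>2))"
      using tail_bound[OF r, of "{1..n}" "K n" ?t n] n K t pbt unfolding P_def by simp
    have d: "real (diff_bound (K n)) \<le> (C * ln (real n)) ^ k"
    proof -
      have "real (2 * (2 * D + 3)\<^sup>2 * (k + 3)) * real (q n) \<le> real (2 * (2 * D + 3)\<^sup>2 * (k + 3)) * (3 * ln (real n))"
        by (intro mult_left_mono elim(1)) simp
      then have "real (2 * (2 * D + 3)\<^sup>2 * K n) \<le> C * ln (real n)"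
        by (simp add: K_def C_def algebra_simps)
      then have "real (2 * (2 * D + 3)\<^sup>2 * K n) ^ k \<le> (C * ln (real n)) ^ k"
        by (intro power_mono) auto
      then show ?thesis unfolding diff_bound_def of_nat_power .
    qed
    have ln0: "ln (real n) > 0" using n by simp
    have dpos: "real (diff_bound (K n)) > 0" using K by (simp add: diff_bound_def)
    have "(real (diff_bound (K n)))\<^sup>2 \<le> ((C * ln (real n)) ^ k)\<^sup>2"
      using d dpos by (intro power_mono) auto
    also have "\<dots> = (C ^ k)\<^sup>2 * ln (real n) ^ (2 * k)"
      by (simp add: power_mult_distrib power_mult[symmetric] mult.commute)
    finally have d2: "(real (diff_bound (K n)))\<^sup>2 \<le> (C ^ k)\<^sup>2 * ln (real n) ^ (2 * k)" .
    have "16 * (real (diff_bound (K n)))\<^sup>2 * ln (real n) \<le> 16 * ((C ^ k)\<^sup>2 * ln (real n) ^ (2 * k)) * ln (real n)"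
      using d2 ln0 by (intro mult_right_mono mult_left_mono) auto
    also have "\<dots> = (16 * (C ^ k)\<^sup>2 / \<epsilon>\<^sup>2 * (ln (real n) ^ (2 * k + 1) / real n)) * (\<epsilon>\<^sup>2 * real n)"
      using \<epsilon> n by simp
    also have "\<dots> \<le> 1 * (\<epsilon>\<^sup>2 * real n)"
      using elim(3) \<epsilon> by (intro mult_right_mono) auto
    finally have key: "16 * (real (diff_bound (K n)))\<^sup>2 * ln (real n) \<le> \<epsilon>\<^sup>2 * real n" by simp
    have "2 * ln (real n) \<le> ?t\<^sup>2 / (2 * real n * (real (diff_bound (K n)))\<^sup>2)"
    proof -
      have "2 * ln (real n) * (2 * real n * (real (diff_bound (K n)))\<^sup>2) = (16 * (real (diff_bound (K n)))\<^sup>2 * ln (real n)) * (real n / 4)"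
        by simp
      also have "\<dots> \<le> (\<epsilon>\<^sup>2 * real n) * (real n / 4)" by (intro mult_right_mono key) simp
      also have "\<dots> = ?t\<^sup>2" by (simp add: power2_eq_square)
      finally show ?thesis using dpos n by (subst pos_le_divide_eq) auto
    qed
    then have "exp (- ?t\<^sup>2 / (2 * real n * (real (diff_bound (K n)))\<^sup>2)) \<le> exp (- (2 * ln (real n)))" by simp
    also have "\<dots> = inverse (real n ^ 2)"
      using n by (simp add: exp_minus exp_double)
    finally have ex: "exp (- ?t\<^sup>2 / (2 * real n * (real (diff_bound (K n)))\<^sup>2)) \<le> inverse (real n ^ 2)" .
    have "exp (B * L) / real n ^ (k + 2) \<le> exp (B * L) / real n ^ 2"
      using n by (intro divide_left_mono power_increasing) auto
    from order_trans[OF pbn this] have "?pb \<le> exp (B * L) * inverse (real n ^ 2)"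
      by (simp only: divide_inverse[of "exp (B * L)"])
    then have "?pb + 2 * exp (- ?t\<^sup>2 / (2 * real n * (real (diff_bound (K n)))\<^sup>2)) \<le> exp (B * L) * inverse (real n ^ 2) + 2 * inverse (real n ^ 2)"
      using ex by linarith
    also have "\<dots> = (exp (B * L) + 2) * inverse (real n ^ 2)" by (simp only: distrib_right)
    finally show ?case using tb by simp
  qed
  show ?thesis
    by (rule summable_comparison_test_ev[OF bound]) (intro summable_mult inverse_power_summable, simp)
qed

end

section \<open>Almost sure convergence\<close>

text \<open>The sum of one path length per pair of vertices is a crude common bound; its size
  affects only constants.\<close>

lemma finite_diameter:
  assumes "finite V" "\<And>u v. u \<in> V \<Longrightarrow> v \<in> V \<Longrightarrow> (u, v) \<in> S\<^sup>*"
  shows "\<exists>D. \<forall>u\<in>V. \<forall>v\<in>V. \<exists>m\<le>D. (u, v) \<in> S ^^ m"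
proof -
  have "\<forall>p\<in>V \<times> V. \<exists>m. p \<in> S ^^ m"
    using assms(2) by (auto simp: rtrancl_power)
  then obtain m where m: "\<And>p. p \<in> V \<times> V \<Longrightarrow> p \<in> S ^^ m p" by metis
  have "m p \<le> (\<Sum>p\<in>V \<times> V. m p)" if "p \<in> V \<times> V" for p
    using that assms(1) by (intro member_le_sum) auto
  then show ?thesis using m by (intro exI[of _ "\<Sum>p\<in>V \<times> V. m p"]) blast
qed

context sector_model
begin

section \<open>Joint law of the marked points\<close>

lemma X_measurable: "i \<ge> 1 \<Longrightarrow> X i \<in> M \<rightarrow>\<^sub>M borel"
  using distributed_measurable[OF X_density] by simp

lemma Y_measurable: "i \<ge> 1 \<Longrightarrow> Y i \<in> M \<rightarrow>\<^sub>M borel"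
  using distributed_measurable[OF Y_uniform] by simp

lemma f_borel: "f \<in> borel_measurable borel"
proof -
  have "(\<lambda>x. ennreal (f x)) \<in> borel_measurable borel"
    using distributed_borel_measurable[OF X_density[of 1]] by simp
  then have "(\<lambda>x. enn2real (ennreal (f x))) \<in> borel_measurable borel" by measurable
  then show ?thesis by (simp add: density_nonneg)
qed

lemma distr_X: "i \<ge> 1 \<Longrightarrow> distr M borel (X i) = density lborel (\<lambda>x. ennreal (f x))"
  using distributed_distr_eq_density[OF X_density, of i] distr_cong[of M M borel lborel "X i" "X i"] by simp

lemma distr_Y: "i \<ge> 1 \<Longrightarrow> distr M borel (Y i) = angle_law"
  using distributed_distr_eq_density[OF Y_uniform, of i] distr_cong[of M M borel lborel "Y i" "Y i"]
  by (simp add: angle_law_def)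

lemma sector_density_axioms_model:
  assumes "\<And>x. f x \<le> B"
  shows "sector_density f B"
proof (rule sector_density.intro[OF f_borel density_nonneg assms])
  show "prob_space (density lborel (\<lambda>x. ennreal (f x)))"
    using prob_space_distr[OF X_measurable[of 1]] by (simp add: distr_X)
qed

text \<open>Rectangles determine a product measure, and on a rectangle the product formula is
  \<open>XY_indep\<close> at the two indices \<open>Inl i\<close> and \<open>Inr i\<close>.\<close>

lemma distr_mark:
  assumes i: "i \<ge> 1"
  shows "distr M (borel \<Otimes>\<^sub>M borel) (\<lambda>\<omega>. (X i \<omega>, Y i \<omega>)) = density lborel (\<lambda>x. ennreal (f x)) \<Otimes>\<^sub>M angle_law"
proof (rule pair_measure_eqI[symmetric])
  interpret DX: prob_space "density lborel (\<lambda>x. ennreal (f x))"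
    using prob_space_distr[OF X_measurable[of 1]] by (simp add: distr_X)
  interpret DY: prob_space angle_law by (rule prob_space_angle_law)
  show "sigma_finite_measure (density lborel (\<lambda>x. ennreal (f x)))" by (rule DX.sigma_finite_measure_axioms)
  show "sigma_finite_measure angle_law" by (rule DY.sigma_finite_measure_axioms)
  show "sets (density lborel (\<lambda>x. ennreal (f x)) \<Otimes>\<^sub>M angle_law) = sets (distr M (borel \<Otimes>\<^sub>M borel) (\<lambda>\<omega>. (X i \<omega>, Y i \<omega>)))"
    unfolding sets_distr by (rule sets_pair_measure_cong) simp_all
  fix A :: "(real^2) set" and C :: "real set" assume "A \<in> sets (density lborel (\<lambda>x. ennreal (f x)))" "C \<in> sets angle_law"
  then have A: "A \<in> sets borel" and C: "C \<in> sets borel" by simp_all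
  have XY: "(\<lambda>\<omega>. (X i \<omega>, Y i \<omega>)) \<in> M \<rightarrow>\<^sub>M borel \<Otimes>\<^sub>M borel"
    by (intro measurable_Pair X_measurable Y_measurable i)
  define F where "F j = (case j of Inl _ \<Rightarrow> X i -` A \<inter> space M | Inr _ \<Rightarrow> Y i -` C \<inter> space M)" for j :: "nat + nat"
  have "prob (\<Inter>j\<in>{Inl i, Inr i}. F j) = (\<Prod>j\<in>{Inl i, Inr i}. prob (F j))"
    by (rule indep_setsD[OF XY_indep]) (use i A C in \<open>auto simp: F_def\<close>)
  then have ind: "prob ((X i -` A \<inter> space M) \<inter> (Y i -` C \<inter> space M)) = prob (X i -` A \<inter> space M) * prob (Y i -` C \<inter> space M)"
    by (simp add: F_def)
  have "emeasure (distr M (borel \<Otimes>\<^sub>M borel) (\<lambda>\<omega>. (X i \<omega>, Y i \<omega>))) (A \<times> C) = emeasure M ((X i -` A \<inter> space M) \<inter> (Y i -` C \<inter> space M))"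
    using A C by (subst emeasure_distr[OF XY]) (auto intro!: arg_cong[where f="emeasure M"])
  also have "\<dots> = emeasure M (X i -` A \<inter> space M) * emeasure M (Y i -` C \<inter> space M)"
    by (simp add: emeasure_eq_measure ind ennreal_mult)
  also have "emeasure M (X i -` A \<inter> space M) = emeasure (distr M borel (X i)) A"
    by (rule emeasure_distr[OF X_measurable[OF i] A, symmetric])
  also have "emeasure M (Y i -` C \<inter> space M) = emeasure (distr M borel (Y i)) C"
    by (rule emeasure_distr[OF Y_measurable[OF i] C, symmetric])
  finally show "emeasure (density lborel (\<lambda>x. ennreal (f x))) A * emeasure angle_law C
     = emeasure (distr M (borel \<Otimes>\<^sub>M borel) (\<lambda>\<omega>. (X i \<omega>, Y i \<omega>))) (A \<times> C)"
    by (simp add: distr_X[OF i] distr_Y[OF i])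
qed

text \<open>Grouping the independent families by \<open>i\<close> keeps the generated
  \<sigma>-algebras independent, and the pair of \<open>X i\<close> and \<open>Y i\<close> is
  measurable with respect to the one generated by its group.\<close>

lemma indep_marks: "indep_vars (\<lambda>_. borel \<Otimes>\<^sub>M borel) (\<lambda>i \<omega>. (X i \<omega>, Y i \<omega>)) {1..}"
proof -
  define E where "E = (\<lambda>j. case j of
            Inl i \<Rightarrow> {X i -` A \<inter> space M | A. A \<in> sets borel}
          | Inr i \<Rightarrow> {Y i -` A \<inter> space M | A. A \<in> sets borel})"
  have E_Int: "Int_stable (E j)" for j
  proof (rule Int_stableI)
    fix a b assume ab: "a \<in> E j" "b \<in> E j"
    show "a \<inter> b \<in> E j"
    proof (cases j)
      case (Inl i)
      then obtain A C where "a = X i -` A \<inter> space M" "b = X i -` C \<inter> space M" "A \<in> sets borel" "C \<in> sets borel"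
        using ab by (auto simp: E_def)
      then show ?thesis unfolding E_def Inl sum.case by (intro CollectI exI[of _ "A \<inter> C"]) auto
    next
      case (Inr i)
      then obtain A C where "a = Y i -` A \<inter> space M" "b = Y i -` C \<inter> space M" "A \<in> sets borel" "C \<in> sets borel"
        using ab by (auto simp: E_def)
      then show ?thesis unfolding E_def Inr sum.case by (intro CollectI exI[of _ "A \<inter> C"]) auto
    qed
  qed
  have Un: "(\<Union>i\<in>{1..}. {Inl i, Inr i}) = ({1..} <+> {1..} :: (nat + nat) set)"
    by (auto simp: Plus_def)
  have sig: "indep_sets (\<lambda>i. sigma_sets (space M) (\<Union>j\<in>{Inl i, Inr i}. E j)) {1..}"
  proof (rule indep_sets_collect_sigma)
    show "indep_sets E (\<Union>i\<in>{1..}. {Inl i, Inr i})"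
      unfolding Un E_def by (rule XY_indep)
    show "disjoint_family_on (\<lambda>i. {Inl i, Inr i}) {1..}"
      by (auto simp: disjoint_family_on_def)
  qed (rule E_Int)
  have sub: "{(\<lambda>\<omega>. (X i \<omega>, Y i \<omega>)) -` A \<inter> space M | A. A \<in> sets (borel \<Otimes>\<^sub>M borel)} \<subseteq> sigma_sets (space M) (\<Union>j\<in>{Inl i, Inr i}. E j)" for i
  proof -
    let ?G = "\<Union>j\<in>{Inl i, Inr i}. E j"
    have G: "?G \<subseteq> Pow (space M)" by (auto simp: E_def)
    let ?N = "sigma (space M) ?G"
    have N: "space ?N = space M" "sets ?N = sigma_sets (space M) ?G"
      using G by (simp_all add: space_measure_of sets_measure_of)
    have "X i \<in> ?N \<rightarrow>\<^sub>M borel"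
    proof (rule measurableI)
      fix A :: "(real^2) set" assume "A \<in> sets borel"
      then have "X i -` A \<inter> space M \<in> ?G" by (auto simp: E_def)
      then show "X i -` A \<inter> space ?N \<in> sets ?N" unfolding N by (rule sigma_sets.Basic)
    qed simp
    moreover have "Y i \<in> ?N \<rightarrow>\<^sub>M borel"
    proof (rule measurableI)
      fix A :: "real set" assume "A \<in> sets borel"
      then have "Y i -` A \<inter> space M \<in> ?G" by (auto simp: E_def)
      then show "Y i -` A \<inter> space ?N \<in> sets ?N" unfolding N by (rule sigma_sets.Basic)
    qed simp
    ultimately have "(\<lambda>\<omega>. (X i \<omega>, Y i \<omega>)) \<in> ?N \<rightarrow>\<^sub>M borel \<Otimes>\<^sub>M borel" by (rule measurable_Pair)
    from measurable_sets[OF this] show ?thesis unfolding N by auto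
  qed
  show ?thesis
    unfolding indep_vars_def2
  proof (intro conjI ballI)
    show "(\<lambda>\<omega>. (X i \<omega>, Y i \<omega>)) \<in> M \<rightarrow>\<^sub>M borel \<Otimes>\<^sub>M borel" if "i \<in> {1..}" for i
      using that by (intro measurable_Pair X_measurable Y_measurable) auto
    show "indep_sets (\<lambda>i. {(\<lambda>\<omega>. (X i \<omega>, Y i \<omega>)) -` A \<inter> space M | A. A \<in> sets (borel \<Otimes>\<^sub>M borel)}) {1..}"
      by (rule indep_sets_mono_sets[OF sig sub])
  qed
qed

lemma distr_marks:
  assumes I: "I \<subseteq> {1..}" "I \<noteq> {}"
  shows "distr M (PiM I (\<lambda>_. borel \<Otimes>\<^sub>M borel)) (\<lambda>\<omega>. \<lambda>i\<in>I. (X i \<omega>, Y i \<omega>))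
    = PiM I (\<lambda>_. density lborel (\<lambda>x. ennreal (f x)) \<Otimes>\<^sub>M angle_law)"
proof -
  have "indep_vars (\<lambda>_. borel \<Otimes>\<^sub>M borel) (\<lambda>i \<omega>. (X i \<omega>, Y i \<omega>)) I"
    by (rule indep_vars_subset[OF indep_marks I(1)])
  moreover have "(\<lambda>\<omega>. (X i \<omega>, Y i \<omega>)) \<in> M \<rightarrow>\<^sub>M borel \<Otimes>\<^sub>M borel" if "i \<in> I" for i
    using that I(1) by (intro measurable_Pair X_measurable Y_measurable) auto
  ultimately have "distr M (PiM I (\<lambda>_. borel \<Otimes>\<^sub>M borel)) (\<lambda>\<omega>. \<lambda>i\<in>I. (X i \<omega>, Y i \<omega>))
    = PiM I (\<lambda>i. distr M (borel \<Otimes>\<^sub>M borel) (\<lambda>\<omega>. (X i \<omega>, Y i \<omega>)))"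
    using indep_vars_iff_distr_eq_PiM'[OF I(2), of "\<lambda>i \<omega>. (X i \<omega>, Y i \<omega>)" "\<lambda>_. borel \<Otimes>\<^sub>M borel"] by simp
  also have "\<dots> = PiM I (\<lambda>_. density lborel (\<lambda>x. ennreal (f x)) \<Otimes>\<^sub>M angle_law)"
    using I(1) by (intro PiM_cong refl distr_mark) auto
  finally show ?thesis .
qed

text \<open>For each \<open>n\<close> only the law of the first \<open>n\<close> marks matters, so
  the tail bounds on the product space carry over to \<open>M\<close>. Borel-Cantelli then gives the
  deviation from the mean, and the limit of the mean is assumed.\<close>

lemma iso_copies_strong_law:
  assumes "sector_process V E D f B"
    and r: "\<And>n. r n > 0" and \<Lambda>: "(\<lambda>n. real n * (r n)\<^sup>2) \<longlonglongrightarrow> \<Lambda>"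
    and mean: "(\<lambda>n. (\<integral>z. real (card (pattern.iso_copies \<alpha> V E (r n) {1..n} z))
        \<partial>PiM {1..n} (\<lambda>_. sector_density.mark_law f)) / real n) \<longlonglongrightarrow> l"
  shows "AE \<omega> in M. (\<lambda>n. real (card (pattern.iso_copies \<alpha> V E (r n) {1..n} (\<lambda>i. (X i \<omega>, Y i \<omega>)))) / real n) \<longlonglongrightarrow> l"
proof -
  interpret sector_process \<alpha> V E D f B by (rule assms(1))
  define Z where "Z n \<omega> = (\<lambda>i\<in>{1..n}. (X i \<omega>, Y i \<omega>))" for n \<omega>
  define P where "P n = marks {1..n}" for n :: nat
  define H where "H n z = real (card (iso_copies (r n) {1..n} z))" for n z
  define m where "m n = (\<integral>z. H n z \<partial>P n)" for n
  \<comment> \<open>Only a restricted tuple lies in the product space; the count looks at no index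
    outside \<open>{1..n}\<close>, so restricting leaves it unchanged.\<close>
  have H_restrict: "H n (Z n \<omega>) = real (card (iso_copies (r n) {1..n} (\<lambda>i. (X i \<omega>, Y i \<omega>))))" for n \<omega>
  proof -
    have "iso_copy (r n) {1..n} W (Z n \<omega>) = iso_copy (r n) {1..n} W (\<lambda>i. (X i \<omega>, Y i \<omega>))" if "W \<subseteq> {1..n}" for W
    proof -
      have s: "sees \<alpha> (r n) (Z n \<omega>) i j = sees \<alpha> (r n) (\<lambda>i. (X i \<omega>, Y i \<omega>)) i j" if "i \<in> {1..n}" "j \<in> {1..n}" for i j
        using that by (simp add: sees_def Z_def)
      have "copy (r n) W (Z n \<omega>) = copy (r n) W (\<lambda>i. (X i \<omega>, Y i \<omega>))"
        unfolding copy_def rel_iso_def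
        by (intro arg_cong[where f=Ex] ext conj_cong refl ball_cong)
           (simp only: s[OF subsetD[OF that] subsetD[OF that]])
      moreover have "(\<forall>i\<in>W. \<forall>j\<in>{1..n} - W. \<not> sees \<alpha> (r n) (Z n \<omega>) i j) = (\<forall>i\<in>W. \<forall>j\<in>{1..n} - W. \<not> sees \<alpha> (r n) (\<lambda>i. (X i \<omega>, Y i \<omega>)) i j)"
        by (intro ball_cong refl arg_cong[where f=Not] s) (use that in auto)
      ultimately show ?thesis by (simp add: iso_copy_def)
    qed
    then show ?thesis unfolding H_def iso_copies_def
      by (intro arg_cong[where f=real] arg_cong[where f=card] Collect_cong) auto
  qed
  have law: "distr M (PiM {1..n} (\<lambda>_. borel \<Otimes>\<^sub>M borel)) (Z n) = P n" if "n \<ge> 1" for n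
    unfolding Z_def P_def mark_law_def point_law_def using that by (intro distr_marks) auto
  have Z_meas: "Z n \<in> M \<rightarrow>\<^sub>M PiM {1..n} (\<lambda>_. borel \<Otimes>\<^sub>M borel)" for n
    unfolding Z_def by (intro measurable_restrict measurable_Pair X_measurable Y_measurable) auto
  have P_sets: "sets (P n) = sets (PiM {1..n} (\<lambda>_. borel \<Otimes>\<^sub>M borel))" for n
    unfolding P_def by (intro sets_PiM_cong refl) (simp add: sets_mark_law)
  have Z_P: "Z n \<in> M \<rightarrow>\<^sub>M P n" for n
    using Z_meas[of n] measurable_cong_sets[OF refl P_sets[of n], of M] by simp
  have H_meas: "H n \<in> borel_measurable (P n)" for n
    unfolding H_def[abs_def] P_def by (rule iso_copies_measurable(1)[OF r]) simp
  have dev: "AE \<omega> in M. \<forall>\<^sub>F n in sequentially. \<bar>H n (Z n \<omega>) - m n\<bar> < \<epsilon> * real n" if \<epsilon>: "\<epsilon> > 0" for \<epsilon>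
  proof -
    define A where "A n = {\<omega> \<in> space M. \<epsilon> * real n \<le> \<bar>H n (Z n \<omega>) - m n\<bar>}" for n
    define A' where "A' n = {z \<in> space (P n). \<epsilon> * real n \<le> \<bar>H n z - m n\<bar>}" for n
    have A'_sets: "A' n \<in> sets (P n)" for n
      unfolding A'_def using H_meas[of n] by measurable
    have A_eq: "A n = Z n -` A' n \<inter> space M" for n
      using measurable_space[OF Z_P] by (auto simp: A_def A'_def)
    have A_sets: "A n \<in> sets M" for n
      unfolding A_eq by (rule measurable_sets[OF Z_P A'_sets])
    have "measure M (A n) = measure (P n) (A' n)" if "n \<ge> 1" for n
    proof -
      have "measure (distr M (PiM {1..n} (\<lambda>_. borel \<Otimes>\<^sub>M borel)) (Z n)) (A' n) = measure M (Z n -` A' n \<inter> space M)"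
        using A'_sets[of n] P_sets[of n] by (intro measure_distr Z_meas) simp
      then show ?thesis by (simp only: law[OF that] A_eq)
    qed
    note measure_eq = this
    \<comment> \<open>The law of the tuple is available for \<open>n \<ge> 1\<close>; for
      summability this suffices.\<close>
    have "\<forall>\<^sub>F n in sequentially. measure (P n) (A' n) = measure M (A n)"
      by (rule eventually_mono[OF eventually_ge_at_top[of 1]]) (rule measure_eq[symmetric])
    moreover have "summable (\<lambda>n. measure (P n) (A' n))"
      using summable_tail[OF r \<Lambda> \<epsilon>] unfolding A'_def H_def m_def P_def .
    ultimately have "summable (\<lambda>n. measure M (A n))"
      by (simp add: summable_cong)
    then have "AE \<omega> in M. \<forall>\<^sub>F n in sequentially. \<omega> \<in> space M - A n"
      by (intro borel_cantelli_AE1 A_sets) (simp_all add: less_top[symmetric])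
    then show ?thesis
    proof eventually_elim
      case (elim \<omega>)
      then show ?case by (rule eventually_mono) (auto simp: A_def)
    qed
  qed
  \<comment> \<open>Countably many tolerances \<open>1 / (p + 1)\<close> keep the union of the
    exceptional sets null.\<close>
  have "AE \<omega> in M. \<forall>p. \<forall>\<^sub>F n in sequentially. \<bar>H n (Z n \<omega>) - m n\<bar> < (1 / real (Suc p)) * real n"
    unfolding AE_all_countable by (intro allI dev) simp
  then show ?thesis
  proof eventually_elim
    case (elim \<omega>)
    have "(\<lambda>n. H n (Z n \<omega>) / real n - m n / real n) \<longlonglongrightarrow> 0"
    proof (rule tendstoI)
      fix e :: real assume "e > 0"
      then obtain p where p: "1 / real (Suc p) < e" using nat_approx_posE by blast
      show "\<forall>\<^sub>F n in sequentially. dist (H n (Z n \<omega>) / real n - m n / real n) 0 < e"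
        using elim[rule_format, of p] eventually_gt_at_top[of 0]
      proof eventually_elim
        case (elim n)
        have "\<bar>H n (Z n \<omega>) - m n\<bar> / real n < 1 / real (Suc p)"
          using elim by (simp only: pos_divide_less_eq of_nat_0_less_iff)
        then show ?case
          using p elim(2) by (simp add: dist_real_def diff_divide_distrib[symmetric])
      qed
    qed
    moreover have "(\<lambda>n. m n / real n) \<longlonglongrightarrow> l"
      using mean unfolding m_def H_def P_def .
    ultimately have "(\<lambda>n. (H n (Z n \<omega>) / real n - m n / real n) + m n / real n) \<longlonglongrightarrow> 0 + l"
      by (rule tendsto_add)
    then show ?case by (simp add: H_restrict)
  qed
qed

end

theorem theorem1:
  fixes M :: "'w measure"
    and f :: "real^2 \<Rightarrow> real"
    and X :: "nat \<Rightarrow> 'w \<Rightarrow> real^2"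
    and Y :: "nat \<Rightarrow> 'w \<Rightarrow> real"
    and \<alpha> \<Lambda> :: real
    and r :: "nat \<Rightarrow> real"
    and k :: nat
    and T :: "('v, 'e) pre_digraph"
  assumes "0 < \<alpha>" and "\<alpha> \<le> 2 * pi"
    and "sector_model M f X Y"
    and "bounded (range f)"
    and "AE x in lborel. isCont f x"
    and "\<And>n. n \<ge> 1 \<Longrightarrow> r n > 0"
    and "r \<longlonglongrightarrow> 0"
    and "k \<ge> 1"
    and "digraph T" and "card (verts T) = k"
    and "Digraph_Component.connected T"
    and "feasible M \<alpha> X Y T"
    and "0 < \<Lambda>"
    and "(\<lambda>n. real n * (r n)\<^sup>2) \<longlonglongrightarrow> \<Lambda>"
  shows "AE \<omega> in M.
    (\<lambda>n. real (num_isolated (random_sector_digraph \<alpha> X Y n (r n) \<omega>) T) / real n)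
      \<longlonglongrightarrow> (1 / real k) * (LINT x | lborel. phi \<alpha> T (\<Lambda> * f x) * f x)"
proof -
  interpret model: sector_model M f X Y by fact
  interpret T: digraph T by fact
  obtain B where B: "\<And>x. f x \<le> B"
  proof -
    obtain B where "\<forall>x\<in>range f. norm x \<le> B" using assms(4) by (auto simp: bounded_iff)
    then have "f x \<le> B" for x by (auto dest: abs_le_D1)
    then show ?thesis by (rule that)
  qed
  obtain D where D: "\<forall>u\<in>verts T. \<forall>v\<in>verts T. \<exists>m\<le>D. (u, v) \<in>
      {(a, b). a \<in> verts T \<and> b \<in> verts T \<and> (arc_rel T a b \<or> arc_rel T b a)} ^^ m"
    using finite_diameter[OF T.finite_verts connected_imp_rtrancl[OF assms(9,11)]] by blast
  have pattern: "pattern (verts T) (arc_rel T) D"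
  proof
    show "verts T \<noteq> {}" using assms(8,10) by auto
  qed (use D in auto)
  interpret sector_density f B by (rule model.sector_density_axioms_model[OF B])
  interpret sp: sector_process \<alpha> "verts T" "arc_rel T" D f B
    by (intro sector_process.intro pattern sector_density_axioms)
  \<comment> \<open>the hypotheses leave the sign of \<open>r 0\<close> open\<close>
  define r' where "r' n = (if n = 0 then 1 else r n)" for n
  have r'_pos: "r' n > 0" for n using assms(6)[of n] by (simp add: r'_def)
  have ev: "\<forall>\<^sub>F n in sequentially. r n = r' n"
    by (rule eventually_mono[OF eventually_gt_at_top[of 0]]) (simp add: r'_def)
  have r'_lim: "r' \<longlonglongrightarrow> 0" by (rule Lim_transform_eventually[OF assms(7) ev])
  have r'_\<Lambda>: "(\<lambda>n. real n * (r' n)\<^sup>2) \<longlonglongrightarrow> \<Lambda>"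
    by (rule Lim_transform_eventually[OF assms(14)]) (rule eventually_mono[OF ev], simp)
  \<comment> \<open>The identification of \<open>phi\<close> requires a nonnegative argument, which
    the signs of \<Lambda> and \<open>f\<close> provide.\<close>
  have phi: "phi \<alpha> T (\<Lambda> * f x) = sp.phi_fun (\<Lambda> * f x)" for x
    using assms(13) f_nonneg[of x] by (intro sp.phi_eq_phi_fun[OF assms(9) refl refl assms(1,2)]) simp
  have "AE \<omega> in M. (\<lambda>n. real (card (pattern.iso_copies \<alpha> (verts T) (arc_rel T) (r' n) {1..n} (\<lambda>i. (X i \<omega>, Y i \<omega>)))) / real n)
    \<longlonglongrightarrow> (1 / real k) * (LINT x | lborel. phi \<alpha> T (\<Lambda> * f x) * f x)"
    using sp.mean_iso_copies_lim[OF r'_pos r'_lim r'_\<Lambda> assms(5)]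
    unfolding phi assms(10)
    by (rule model.iso_copies_strong_law[OF sp.sector_process_axioms r'_pos r'_\<Lambda>])
  then show ?thesis
  proof eventually_elim
    case (elim \<omega>)
    have "num_isolated (random_sector_digraph \<alpha> X Y n (r n) \<omega>) T =
        card (pattern.iso_copies \<alpha> (verts T) (arc_rel T) (r n) {1..n} (\<lambda>i. (X i \<omega>, Y i \<omega>)))" for n
      unfolding random_sector_digraph_def num_isolated_sector_digraph[OF assms(9)]
        sp.iso_copies_def sp.iso_copy_def sp.copy_def sees_def fst_conv snd_conv
      by (intro arg_cong[where f=card] Collect_cong) (simp only: conj_ac)
    note eq = this
    from ev have "\<forall>\<^sub>F n in sequentially.
        real (card (pattern.iso_copies \<alpha> (verts T) (arc_rel T) (r' n) {1..n} (\<lambda>i. (X i \<omega>, Y i \<omega>)))) / real n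
        = real (num_isolated (random_sector_digraph \<alpha> X Y n (r n) \<omega>) T) / real n"
      by (rule eventually_mono) (subst eq, simp)
    from Lim_transform_eventually[OF elim this] show ?case .
  qed
qed

end
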